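(* Let $0<p\le1$, $d\ge d_p$, where $d_p=n/p-n$, and let $q\in[1,\infty]\cap(p,\infty]$. Assume that $\phi,\eta\in\mathcal G_1$ satisfy, for some constant $C_0>0$, $$\int_r^\infty\frac{\phi(x,s)}{\eta(x,s)\,s}\,ds\le C_0\,\frac{\phi(x,r)}{\eta(x,r)}\qquad(x\in\mathbb R^n,\ r>0).$$ Then there is a constant $C>0$ such that the following holds. Assume that $\{Q_j\}_{j=1}^\infty\subset\mathcal Q(\mathbb R^n)$, $\{a_j\}_{j=1}^\infty\subset\mathcal M_{q,\eta}(\mathbb R^n)$ and $\{\lambda_j\}_{j=1}^\infty\subset[0,\infty)$ satisfy $$\Big\|\Big(\sum_{j=1}^\infty(\lambda_j\chi_{Q_j})^p\Big)^{1/p}\Big\|_{\mathcal M_{p,\phi}}<\infty$$ and, for every $j$, $$\|a_j\|_{\mathcal M_{q,\eta}}\le\frac1{\eta(Q_j)},\qquad\operatorname{supp}(a_j)\subset Q_j,\qquad\int_{Q_j}a_j(x)x^\alpha\,dx=0$$ for all multi-indices $\alpha$ with $|\alpha|\le d$. Then $f\equiv\sum_{j=1}^\infty\lambda_ja_j$ converges in $\mathcal S'(\mathbb R^n)$, belongs to $H\mathcal M_{p,\phi}(\mathbb R^n)$ and satisfies $$\|f\|_{H\mathcal M_{p,\phi}}\le C\Big\|\Big(\sum_{j=1}^\infty(\lambda_j\chi_{Q_j})^p\Big)^{1/p}\Big\|_{\mathcal M_{p,\phi}} .$$ Here $C$ does not depend on $\{Q_j\},\{a_j\},\{\lambda_j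\}$.
   Context: $\mathcal Q(\mathbb R^n)=\mathcal Q$ is the set of all compact cubes in $\mathbb R^n$ with sides parallel to the coordinate axes. For a cube $Q$, $c(Q)$ is its center, $\ell(Q)=|Q|^{1/n}$ its side-length, $\chi_Q$ its indicator function. For a function $\phi:\mathbb R^n\times(0,\infty)\to(0,\infty)$ write $\phi(Q)=\phi(c(Q),\ell(Q))$. For $0<p<\infty$, $\mathcal G_p$ is the set of all functions $\phi:\mathbb R^n\times(0,\infty)\to(0,\infty)$ for which there is $C>0$ with $\phi(x,r)\le\phi(x,s)$ and $C\phi(x,r)r^{n/p}\ge\phi(x,s)s^{n/p}$ for all $x\in\mathbb R^n$ and $0<s\le r<\infty$. Standing assumption: every $\phi\in\mathcal G_p$ under consideration also satisfies $\phi(y,s)s^{n/p}\le\phi(x,r)r^{n/p}$ for all $x,y\in\mathbb R^n$ and $r,s>0$ with $\|x-y\|_\infty\le r-s$. For $0<p<\infty$ the generalized Morrey space $\mathcal M_{p,\phi}(\mathbb R^n)$ is the set of measurable functions $f$ with finite $$\|f\|_{\mathcal M_{p,\phi}}=\sup_{Q\in\mathcal Q}\frac1{\phi(Q)}\Big(\frac1{|Q|}\int_Q|f(y)|^p\,dy\Big)^{1/p};$$ for $p=\infty$ the $L^p$-average over $Q$ is replaced by the essential supremum of $|f|$ over $Q$. For $t>0$ and $x\in\mathbb R^n$, $e^{t\Delta}f(x)=\int_{\mathbb R^n}(4\pi t)^{-n/2}\exp(-|x-y|^2/(4t))f(y)\,dy$, extended to $f\in\mathcal S'(\mathbb R^n)$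 by duality. For $0<p\le1$ and $\phi\in\mathcal G_p$ (note $\mathcal G_1\subset\mathcal G_p$), the generalized Hardy-Morrey space $H\mathcal M_{p,\phi}(\mathbb R^n)$ is the set of all $f\in\mathcal S'(\mathbb R^n)$ with $\|f\|_{H\mathcal M_{p,\phi}}=\big\|\sup_{t>0}|e^{t\Delta}f|\big\|_{\mathcal M_{p,\phi}}<\infty$. *)

theory Defs
  imports "HOL-Analysis.Analysis" "HOL-Probability.Essential_Supremum"
begin

section \<open>Cubes\<close>

definition cube :: "real ^ 'n \<Rightarrow> real \<Rightarrow> (real ^ 'n) set" where
  "cube c l = cbox (c - (l / 2) *\<^sub>R One) (c + (l / 2) *\<^sub>R One)"

text \<open>Only non-degenerate cubes are admitted, since growth functions are evaluated at
  positive side-lengths only.\<close>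

definition cubes :: "(real ^ 'n) set set" where
  "cubes = {cube c l | c l. 0 < l}"

definition cube_center :: "(real ^ 'n) set \<Rightarrow> real ^ 'n" where
  "cube_center Q = (THE c. \<exists>l>0. Q = cube c l)"

definition cube_side :: "(real ^ 'n) set \<Rightarrow> real" where
  "cube_side Q = measure lebesgue Q powr (1 / real CARD('n))"

definition at_cube :: "(real ^ 'n \<Rightarrow> real \<Rightarrow> real) \<Rightarrow> (real ^ 'n) set \<Rightarrow> real" where
  "at_cube \<phi> Q = \<phi> (cube_center Q) (cube_side Q)"

lemma cube_center_cube:
  fixes c :: "real ^ 'n"
  assumes "0 < l"
  shows "cube_center (cube c l) = c"
  unfolding cube_center_def
proof (rule the_equality)
  show "\<exists>l'>0. cube c l = cube c l'" using assms by blast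
next
  fix c' assume "\<exists>l'>0. cube c l = cube c' l'"
  then obtain l' where l': "0 < l'" and eq: "cube c l = cube c' l'" by blast
  have ne: "cube c l \<noteq> {}"
    using assms by (auto simp: cube_def box_ne_empty algebra_simps)
  have "c - (l / 2) *\<^sub>R One = c' - (l' / 2) *\<^sub>R One"
    "c + (l / 2) *\<^sub>R One = c' + (l' / 2) *\<^sub>R One"
    using eq ne by (simp_all add: cube_def eq_cbox)
  then have "(c - (l / 2) *\<^sub>R One) + (c + (l / 2) *\<^sub>R One) =
    (c' - (l' / 2) *\<^sub>R One) + (c' + (l' / 2) *\<^sub>R One)" by simp
  then have "2 *\<^sub>R c = 2 *\<^sub>R c'" by (simp add: scaleR_2)
  then show "c' = c" by simp
qed

lemma cube_side_cube:
  fixes c :: "real ^ 'n"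
  assumes "0 < l"
  shows "cube_side (cube c l) = l"
proof -
  have "measure lebesgue (cube c l) = l ^ CARD('n)"
    using assms by (simp add: cube_def content_cbox' box_ne_empty algebra_simps inner_sum_left_Basis
      flip: scaleR_add_left)
  then show ?thesis
    using assms by (simp add: cube_side_def powr_realpow[symmetric] powr_powr)
qed

section \<open>Growth functions\<close>

text \<open>Functions on $\mathbb{R}^n \times (0,\infty)$ are total here; their values at
  non-positive second arguments are never used.\<close>

definition growth_class :: "real \<Rightarrow> (real ^ 'n \<Rightarrow> real \<Rightarrow> real) set" where
  "growth_class p = {\<phi>. (\<forall>x r. 0 < r \<longrightarrow> 0 < \<phi> x r) \<and>
     (\<exists>C>0. \<forall>x s r. 0 < s \<and> s \<le> r \<longrightarrow>
        \<phi> x r \<le> \<phi> x s \<and>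
        C * \<phi> x r * r powr (real CARD('n) / p) \<ge> \<phi> x s * s powr (real CARD('n) / p))}"

text \<open>The cube with centre $y$ and side-length $2s$ is contained in the cube with centre $x$ and
  side-length $2r$ iff $\|x-y\|_\infty \le r-s$.\<close>

definition cube_monotone :: "real \<Rightarrow> (real ^ 'n \<Rightarrow> real \<Rightarrow> real) \<Rightarrow> bool" where
  "cube_monotone p \<phi> \<longleftrightarrow> (\<forall>x y r s. 0 < r \<and> 0 < s \<and> infnorm (x - y) \<le> r - s \<longrightarrow>
     \<phi> y s * s powr (real CARD('n) / p) \<le> \<phi> x r * r powr (real CARD('n) / p))"

section \<open>Generalized Morrey spaces\<close>

text \<open>The power $x^a$ on $[0,\infty]$ for $a > 0$.\<close>

definition ennpowr :: "ennreal \<Rightarrow> real \<Rightarrow> ennreal" where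
  "ennpowr x a = (if x = \<infinity> then \<infinity> else ennreal (enn2real x powr a))"

text \<open>Norms are taken of $[0,\infty]$-valued functions, because sums and suprema occurring below
  may be infinite at some points; the norm of a complex function is that of its modulus.\<close>

definition cube_mean :: "ennreal \<Rightarrow> (real ^ 'n \<Rightarrow> ennreal) \<Rightarrow> (real ^ 'n) set \<Rightarrow> ennreal" where
  "cube_mean p F Q = (if p = \<infinity> then esssup (lebesgue_on Q) F
     else ennpowr ((\<integral>\<^sup>+ y\<in>Q. ennpowr (F y) (enn2real p) \<partial>lebesgue) / emeasure lebesgue Q)
            (1 / enn2real p))"

definition morrey_norm ::
    "ennreal \<Rightarrow> (real ^ 'n \<Rightarrow> real \<Rightarrow> real) \<Rightarrow> (real ^ 'n \<Rightarrow> ennreal) \<Rightarrow> ennreal" where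
  "morrey_norm p \<phi> F = (SUP Q\<in>cubes. ennreal (1 / at_cube \<phi> Q) * cube_mean p F Q)"

definition modulus :: "('a \<Rightarrow> complex) \<Rightarrow> 'a \<Rightarrow> ennreal" where
  "modulus f x = ennreal (cmod (f x))"

definition morrey_space ::
    "ennreal \<Rightarrow> (real ^ 'n \<Rightarrow> real \<Rightarrow> real) \<Rightarrow> (real ^ 'n \<Rightarrow> complex) set" where
  "morrey_space p \<phi> = {f \<in> borel_measurable lebesgue. morrey_norm p \<phi> (modulus f) < \<infinity>}"

text \<open>The support of a function that is only determined almost everywhere: the complement of
  the largest open set on which it vanishes almost everywhere.\<close>

definition supp :: "(real ^ 'n \<Rightarrow> complex) \<Rightarrow> (real ^ 'n) set" where
  "supp f = - \<Union> {U. open U \<and> (AE x in lebesgue. x \<in> U \<longrightarrow> f x = 0)}"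

section \<open>Schwartz functions and tempered distributions\<close>

definition monomial :: "('n \<Rightarrow> nat) \<Rightarrow> real ^ 'n \<Rightarrow> real" where
  "monomial \<alpha> x = (\<Prod>i\<in>UNIV. (x $ i) ^ \<alpha> i)"

definition partial_deriv :: "'n \<Rightarrow> (real ^ 'n \<Rightarrow> complex) \<Rightarrow> real ^ 'n \<Rightarrow> complex" where
  "partial_deriv i f x = frechet_derivative f (at x) (axis i 1)"

text \<open>Iterated partial derivatives are indexed by lists of directions instead of multi-indices.
  For smooth functions the order of the directions is irrelevant.\<close>

definition partial_derivs :: "'n list \<Rightarrow> (real ^ 'n \<Rightarrow> complex) \<Rightarrow> real ^ 'n \<Rightarrow> complex" where
  "partial_derivs is f = foldr partial_deriv is f"

definition smooth :: "(real ^ 'n \<Rightarrow> complex) \<Rightarrow> bool" where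
  "smooth f \<longleftrightarrow> (\<forall>is x. partial_derivs is f differentiable (at x))"

definition schwartz :: "(real ^ 'n \<Rightarrow> complex) set" where
  "schwartz = {f. smooth f \<and>
     (\<forall>\<alpha> is. bounded (range (\<lambda>x. monomial \<alpha> x *\<^sub>R partial_derivs is f x)))}"

definition schwartz_seminorm ::
    "('n \<Rightarrow> nat) \<Rightarrow> 'n list \<Rightarrow> (real ^ 'n \<Rightarrow> complex) \<Rightarrow> real" where
  "schwartz_seminorm \<alpha> is f = (SUP x. cmod (monomial \<alpha> x *\<^sub>R partial_derivs is f x))"

definition schwartz_topology :: "(real ^ 'n \<Rightarrow> complex) topology" where
  "schwartz_topology = topology_generated_by
     {{g \<in> schwartz. schwartz_seminorm \<alpha> is (\<lambda>x. g x - f x) < e} | f \<alpha> is e.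
        f \<in> schwartz \<and> 0 < e}"

text \<open>Distributions are total functionals of which only the values on Schwartz functions matter.\<close>

type_synonym 'n functional = "(real ^ 'n \<Rightarrow> complex) \<Rightarrow> complex"

definition tempered :: "('n::finite) functional set" where
  "tempered = {T.
     (\<forall>f\<in>schwartz. \<forall>g\<in>schwartz. T (\<lambda>x. f x + g x) = T f + T g) \<and>
     (\<forall>c. \<forall>f\<in>schwartz. T (\<lambda>x. c * f x) = c * T f) \<and>
     continuous_map schwartz_topology euclidean T}"

definition distribution_of :: "(real ^ 'n \<Rightarrow> complex) \<Rightarrow> 'n functional" where
  "distribution_of f g = (LINT x|lebesgue. f x * g x)"

definition tempered_tendsto :: "(nat \<Rightarrow> ('n::finite) functional) \<Rightarrow> 'n functional \<Rightarrow> bool" where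
  "tempered_tendsto F T \<longleftrightarrow> (\<forall>N. F N \<in> tempered) \<and> T \<in> tempered \<and>
     (\<forall>g\<in>schwartz. (\<lambda>N. F N g) \<longlonglongrightarrow> T g)"

section \<open>Generalized Hardy-Morrey spaces\<close>

definition heat_kernel :: "real \<Rightarrow> real ^ 'n \<Rightarrow> real ^ 'n \<Rightarrow> real" where
  "heat_kernel t x y =
     (4 * pi * t) powr (- real CARD('n) / 2) * exp (- (norm (x - y))\<^sup>2 / (4 * t))"

text \<open>The heat extension of a tempered distribution is a function of $x$, obtained by pairing with
  the heat kernel centred at $x$, which is a Schwartz function of the other variable.\<close>

definition heat :: "real \<Rightarrow> ('n::finite) functional \<Rightarrow> real ^ 'n \<Rightarrow> complex" where
  "heat t T x = T (\<lambda>y. complex_of_real (heat_kernel t x y))"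

definition hardy_morrey_norm ::
    "real \<Rightarrow> (real ^ 'n \<Rightarrow> real \<Rightarrow> real) \<Rightarrow> 'n functional \<Rightarrow> ennreal" where
  "hardy_morrey_norm p \<phi> T = morrey_norm (ennreal p) \<phi> (\<lambda>x. SUP t\<in>{0<..}. modulus (heat t T) x)"

definition hardy_morrey_space ::
    "real \<Rightarrow> (real ^ 'n \<Rightarrow> real \<Rightarrow> real) \<Rightarrow> ('n::finite) functional set" where
  "hardy_morrey_space p \<phi> = {T \<in> tempered. hardy_morrey_norm p \<phi> T < \<infinity>}"

definition atomic_sum ::
    "real \<Rightarrow> (nat \<Rightarrow> real) \<Rightarrow> (nat \<Rightarrow> (real ^ 'n) set) \<Rightarrow> real ^ 'n \<Rightarrow> ennreal" where
  "atomic_sum p lam Q x =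
     ennpowr (\<Sum>j. ennreal ((lam j * indicator (Q j) x) powr p)) (1 / p)"

end

theory Submission
  imports Defs
begin

text \<open>The mechanism is that each atom has a pointwise majorant that depends on it only through its
  cube and its size. Let the atom \<open>a\<close> live on the cube with centre \<open>c\<close> and side \<open>l\<close>, let \<open>n\<close> be the
  dimension, \<open>L\<close> the integer part of \<open>d\<close>, and \<open>N = n + L + 1\<close>. If a smooth kernel \<open>g\<close>, adapted to a
  point \<open>x\<close> and a scale \<open>s\<close>, is paired with \<open>a\<close>, then near the cube the size of \<open>g\<close> alone
  bounds the pairing by the Hardy-Littlewood maximal function of \<open>\<bar>a\<bar>\<close> at \<open>x\<close>; far from the cube the
  vanishing moments allow one to subtract the Taylor polynomial of \<open>g\<close> of degree \<open>L\<close>, which gains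
  the factor \<open>(l / \<bar>x - c\<bar>) ^ N\<close> (\<open>pairing_le_atom_majorant\<close>). The bound does not depend
  on \<open>s\<close>. It therefore applies to all heat kernels at once, that is to the maximal function defining
  the Hardy-Morrey norm, and to an arbitrary Schwartz function, that is to convergence in the
  space of tempered distributions.

  Since \<open>p \<le> 1\<close>, the \<open>p\<close>-th power of the sum of the majorants \<open>H j\<close> is at most the sum of their
  \<open>p\<close>-th powers, and everything reduces to integrating \<open>\<Sum>j. (lam j * H j) powr p\<close> over a cube with
  centre \<open>z\<close> and side \<open>m\<close>. A single term is governed by the number \<open>D = max m l \<bar>z - c\<bar>\<close>: its
  average over the cube is at most a constant times
  \<open>(l / D) ^ n * (\<eta> z m / \<eta> z D) powr p\<close> (\<open>nn_integral_atom_majorant_cube\<close>). Integrability of the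
  tail, \<open>p * N > n\<close>, is exactly what the number of moments provides; the quotient of the values
  of \<open>\<eta>\<close> appears because on a small cube inside a large atom only the Morrey norm of the atom
  controls its average; and passing from the exponent \<open>q\<close> to a smaller \<open>p\<close> makes the weak type
  estimate for the maximal function sufficient.

  All atoms with \<open>D \<le> \<rho>\<close> sit inside the cube with centre \<open>z\<close> and side \<open>3 * \<rho>\<close>, so the hypothesis
  on \<open>(\<Sum>j. (lam j * \<chi> j) powr p)\<close> bounds \<open>\<Sum>j. lam j powr p * l j ^ n\<close> over these atoms by
  \<open>\<phi> z \<rho> powr p * \<rho> ^ n\<close>. Grouping the atoms by dyadic size of \<open>D\<close> leaves the series
  \<open>\<Sum>k. (\<phi> z (2 ^ k * m) / \<eta> z (2 ^ k * m)) powr p\<close>, and the integral condition forces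
  \<open>\<phi> / \<eta>\<close> to decay geometrically along dyadic radii (\<open>ratio_geometric_decay\<close>), so
  the series is dominated by its first term (\<open>nn_integral_sum_atom_majorants\<close>).\<close>

section \<open>Powers of extended nonnegative numbers\<close>

lemma ennreal_term_le_suminf: "f k \<le> (\<Sum>j. f j :: ennreal)" using sum_le_suminf[of f "{k}"] by simp

lemma suminf_ennreal_geometric:
  assumes "0 \<le> a" "0 \<le> r" "r < 1"
  shows "(\<Sum>k. ennreal (a * r ^ k)) = ennreal (a * (1 / (1 - r)))"
proof -
  have "(\<lambda>k. a * r ^ k) sums (a * (1 / (1 - r)))"
    using assms by (intro sums_mult geometric_sums) auto
  then show ?thesis using assms by (subst suminf_ennreal_eq) auto
qed

lemma ennpowr_ennreal: "0 \<le> x \<Longrightarrow> ennpowr (ennreal x) a = ennreal (x powr a)"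
  by (simp add: ennpowr_def)

lemma ennpowr_top [simp]: "ennpowr \<infinity> a = \<infinity>" "ennpowr top a = top" by (simp_all add: ennpowr_def)

lemma ennpowr_zero [simp]: "ennpowr 0 a = 0" by (simp add: ennpowr_def)

lemma ennpowr_one_left [simp]: "ennpowr 1 a = 1" by (simp add: ennpowr_def)

lemma ennpowr_one [simp]: "ennpowr x 1 = x" by (cases x) (auto simp: ennpowr_def)

lemma ennpowr_mono: "x \<le> y \<Longrightarrow> 0 \<le> a \<Longrightarrow> ennpowr x a \<le> ennpowr y a"
  by (cases x; cases y) (auto simp: ennpowr_def top_unique intro!: ennreal_leI powr_mono2)

lemma ennpowr_ennpowr: "ennpowr (ennpowr x a) b = ennpowr x (a * b)"
  by (cases x) (auto simp: ennpowr_def powr_powr)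

lemma ennpowr_mult: "ennpowr (x * y) a = ennpowr x a * ennpowr y a"
proof (cases "x = 0 \<or> y = 0")
  case True
  then show ?thesis by auto
next
  case False
  then show ?thesis by (cases x; cases y)
      (auto simp: ennpowr_def ennreal_mult_top ennreal_top_mult ennreal_mult[symmetric] powr_mult)
qed

lemma ennpowr_le_iff:
  assumes "0 < a" shows "ennpowr x a \<le> y \<longleftrightarrow> x \<le> ennpowr y (1 / a)"
  using ennpowr_mono[of "ennpowr x a" y "1 / a"] ennpowr_mono[of x "ennpowr y (1 / a)" a] assms
  by (auto simp: ennpowr_ennpowr)

lemma ennpowr_eq_top_iff [simp]: "ennpowr x a = top \<longleftrightarrow> x = top"
  by (cases x) (auto simp: ennpowr_def)

lemma borel_measurable_ennpowr [measurable (raw)]: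
  assumes [measurable]: "f \<in> borel_measurable M"
  shows "(\<lambda>x. ennpowr (f x) a) \<in> borel_measurable M"
  unfolding ennpowr_def by measurable

text \<open>Every term of a sum \<open>S\<close> of \<open>p\<close>-th powers has size at most \<open>S powr (1/p)\<close>, so it is at
  most its own \<open>p\<close>-th power times \<open>S powr (1/p - 1)\<close>; adding up gives the inclusion of the sequence
  spaces.\<close>

lemma suminf_le_ennpowr_suminf:
  assumes p: "0 < p" "p \<le> 1"
  shows "(\<Sum>j. u j) \<le> ennpowr (\<Sum>j. ennpowr (u j) p) (1 / p)"
proof (cases "(\<Sum>j. ennpowr (u j) p)")
  case top
  then show ?thesis by simp
next
  case (real S)
  have bnd: "u j \<le> ennpowr (u j) p * ennreal (S powr (1 / p - 1))" for j
  proof -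
    have *: "ennpowr (u j) p \<le> ennreal S"
      using sum_le_suminf[of "\<lambda>j. ennpowr (u j) p" "{j}"] real by simp
    then have "u j \<noteq> top" by (auto simp: top_unique)
    then obtain v where v: "0 \<le> v" "u j = ennreal v" by (cases "u j") auto
    with * real have vS: "v powr p \<le> S" by (simp add: ennpowr_ennreal)
    have "v = v powr p * (v powr p) powr (1 / p - 1)"
      using p v by (cases "v = 0") (auto simp: powr_powr powr_add[symmetric] algebra_simps)
    also have "\<dots> \<le> v powr p * S powr (1 / p - 1)"
      using vS p by (intro mult_left_mono powr_mono2) (auto simp: field_simps)
    finally show ?thesis using v by (simp add: ennpowr_ennreal ennreal_mult[symmetric])
  qed
  have "(\<Sum>j. u j) \<le> (\<Sum>j. ennpowr (u j) p * ennreal (S powr (1 / p - 1)))"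
    by (intro suminf_le bnd) auto
  also have "\<dots> = ennreal S * ennreal (S powr (1 / p - 1))" using real by simp
  also have "\<dots> = ennreal (S powr (1 / p))"
    using real p by (cases "S = 0") (auto simp: ennreal_mult[symmetric] powr_diff)
  finally show ?thesis using real by (simp add: ennpowr_ennreal)
qed

text \<open>Subadditivity is the inclusion of the sequence spaces for a sequence with two nonzero terms.\<close>

lemma ennpowr_add_le:
  assumes "0 < p" "p \<le> 1"
  shows "ennpowr (x + y) p \<le> ennpowr x p + ennpowr y p"
proof -
  define u where "u j = (if j = 0 then x else if j = Suc 0 then y else 0)" for j :: nat
  have "(\<Sum>j. u j) = (\<Sum>j\<in>{0, 1}. u j)" by (rule suminf_finite) (auto simp: u_def)
  moreover have "(\<Sum>j. ennpowr (u j) p) = (\<Sum>j\<in>{0, 1}. ennpowr (u j) p)"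
    by (rule suminf_finite) (auto simp: u_def)
  ultimately have "x + y \<le> ennpowr (ennpowr x p + ennpowr y p) (1 / p)"
    using suminf_le_ennpowr_suminf[OF assms, of u] by (simp add: u_def)
  with assms show ?thesis by (simp add: ennpowr_le_iff)
qed

section \<open>The maximal function\<close>

lemma mem_cube_iff: "x \<in> cube (c :: real ^ 'a) l \<longleftrightarrow> (\<forall>i. \<bar>x $ i - c $ i\<bar> \<le> l / 2)"
proof -
  have one: "(One :: real ^ 'a) $ i = 1" for i
    unfolding cart_eq_inner_axis by (simp add: inner_sum_left_Basis axis_in_Basis_iff)
  have "((c - (l / 2) *\<^sub>R One) $ i \<le> x $ i \<and> x $ i \<le> (c + (l / 2) *\<^sub>R One) $ i) =
      (\<bar>x $ i - c $ i\<bar> \<le> l / 2)" for i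
    unfolding vector_minus_component vector_add_component vector_scaleR_component one real_scaleR_def mult_1_right
    by linarith
  then show ?thesis by (simp add: cube_def mem_box_cart del: sum_component)
qed

lemma cube_sets [measurable, simp]: "cube c l \<in> sets lebesgue" "cube c l \<in> sets borel"
  by (auto simp: cube_def)

lemma lebesgue_cball [measurable, simp]: "cball x r \<in> sets lebesgue"
  for x :: "real ^ 'n" by simp

lemma emeasure_cube:
  fixes c :: "real ^ 'n"
  assumes "0 < l"
  shows "emeasure lebesgue (cube c l) = ennreal (l ^ CARD('n))"
    "emeasure lborel (cube c l) = ennreal (l ^ CARD('n))"
  using assms by (simp add: cube_def emeasure_lborel_cbox_eq inner_sum_left_Basis algebra_simps
      flip: scaleR_add_left)+

lemma cball_subset_cube: "cball x r \<subseteq> cube x (2 * r)"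
  by (auto simp: mem_cube_iff dist_norm norm_minus_commute
      intro: order_trans[OF component_le_norm_cart[of "_ - _", simplified]])

lemma norm_le_of_mem_cube:
  fixes c :: "real ^ 'n"
  assumes "x \<in> cube c l"
  shows "norm (x - c) \<le> real CARD('n) * l / 2"
proof -
  have "norm (x - c) \<le> (\<Sum>i\<in>UNIV. \<bar>(x - c) $ i\<bar>)" by (rule norm_le_l1_cart)
  also have "\<dots> \<le> (\<Sum>i\<in>(UNIV :: 'n set). l / 2)"
    using assms by (intro sum_mono) (simp add: mem_cube_iff)
  finally show ?thesis by simp
qed

abbreviation power_integral :: "(real ^ 'n \<Rightarrow> ennreal) \<Rightarrow> real \<Rightarrow> (real ^ 'n) set \<Rightarrow> ennreal" where
  "power_integral F p A \<equiv> (\<integral>\<^sup>+ x\<in>A. ennpowr (F x) p \<partial>lebesgue)"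

abbreviation ball_integral :: "(real ^ 'n \<Rightarrow> ennreal) \<Rightarrow> real ^ 'n \<Rightarrow> real \<Rightarrow> ennreal" where
  "ball_integral F x r \<equiv> (\<integral>\<^sup>+ y\<in>cball x r. F y \<partial>lebesgue)"

text \<open>The centred Hardy-Littlewood maximal function over Euclidean balls, normalized by \<open>r ^ n\<close> instead of
  the volume of the ball; the two differ by the volume of the unit ball.\<close>

definition maximal :: "(real ^ 'n \<Rightarrow> ennreal) \<Rightarrow> real ^ 'n \<Rightarrow> ennreal" where
  "maximal F x =
     (SUP r\<in>{0<..}. ennreal (1 / r ^ CARD('n)) * ball_integral F x r)"

text \<open>Lower semicontinuity, which gives measurability: a large mean over a ball around \<open>x\<close> persists for
  nearby centres \<open>x'\<close> if the ball is enlarged by the distance, because the normalizing factor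
  depends continuously on the radius.\<close>

lemma open_maximal_greater:
  fixes F :: "real ^ 'n \<Rightarrow> ennreal"
  shows "open {x. s < maximal F x}"
proof (rule openI)
  fix x :: "real ^ 'n" assume "x \<in> {x. s < maximal F x}"
  then obtain r where r: "0 < r"
    and s: "s < ennreal (1 / r ^ CARD('n)) * ball_integral F x r"
    by (auto simp: maximal_def less_SUP_iff)
  define I where "I = ball_integral F x r"
  \<comment> \<open>If the mean is infinite, enlarging the radius does no harm; otherwise continuity in the radius is used.\<close>
  have "\<exists>e>0. s < ennreal (1 / (r + e) ^ CARD('n)) * I"
  proof (cases "I = top")
    case True
    then have "s < ennreal (1 / (r + 1) ^ CARD('n)) * I"
      using s r by (auto simp: I_def ennreal_mult_top less_top)
    then show ?thesis by (intro exI[of _ 1]) auto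
  next
    case False
    have "((\<lambda>e. 1 / (r + e) ^ CARD('n)) \<longlongrightarrow> 1 / (r + 0) ^ CARD('n)) (at_right 0)"
      using r by (intro tendsto_intros) auto
    then have "((\<lambda>e. I * ennreal (1 / (r + e) ^ CARD('n))) \<longlongrightarrow> I * ennreal (1 / r ^ CARD('n)))
        (at_right 0)"
      using False by (intro ennreal_tendsto_cmult tendsto_ennrealI) (auto simp: less_top)
    then have "\<forall>\<^sub>F e in at_right 0. s < I * ennreal (1 / (r + e) ^ CARD('n))"
      using s by (intro order_tendstoD) (auto simp: I_def mult.commute)
    then have "\<forall>\<^sub>F e in at_right (0::real). 0 < e \<and> s < I * ennreal (1 / (r + e) ^ CARD('n))"
      using eventually_at_right_less by (rule eventually_elim2) auto
    then obtain e where "0 < e" "s < I * ennreal (1 / (r + e) ^ CARD('n))"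
      using eventually_happens trivial_limit_at_right_real by blast
    then show ?thesis by (auto simp: mult.commute)
  qed
  then obtain e where e: "0 < e" "s < ennreal (1 / (r + e) ^ CARD('n)) * I" by blast
  have "s < maximal F x'" if "x' \<in> ball x e" for x'
  proof -
    have "dist x' y \<le> r + e" if "dist x y \<le> r" for y
      using that \<open>x' \<in> ball x e\<close> dist_triangle[of x' y x] by (simp add: dist_commute)
    then have "I \<le> ball_integral F x' (r + e)"
      unfolding I_def by (intro nn_integral_mono) (auto simp: indicator_def)
    then have "s < ennreal (1 / (r + e) ^ CARD('n)) * ball_integral F x' (r + e)"
      using e by (meson less_le_trans mult_left_mono zero_le)
    then show ?thesis
      using e r unfolding maximal_def less_SUP_iff by (intro bexI[of _ "r + e"]) auto
  qed
  with e show "\<exists>T>0. ball x T \<subseteq> {x. s < maximal F x}" by auto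
qed

lemma borel_measurable_maximal [measurable]: "maximal F \<in> borel_measurable lebesgue"
proof (rule borel_measurableI_greater)
  fix s
  have "{x. s < maximal F x} \<in> sets borel" using open_maximal_greater by (rule borel_open)
  then show "{x \<in> space lebesgue. s < maximal F x} \<in> sets lebesgue" by simp
qed

lemma maximal_cmult:
  assumes [measurable]: "F \<in> borel_measurable lebesgue"
  shows "maximal (\<lambda>y. c * F y) x = c * maximal F x"
proof -
  have "(\<integral>\<^sup>+ y\<in>cball x r. c * F y \<partial>lebesgue) = c * ball_integral F x r" for r
    by (simp add: mult.assoc nn_integral_cmult lebesgue_cball)
  then show ?thesis
    unfolding maximal_def SUP_mult_left_ennreal by (simp add: mult.left_commute)
qed

text \<open>The Vitali covering argument: every point of the level set is the centre of a ball on which \<open>F\<close>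
  has large mean, a disjoint subfamily of these balls covers the level set after dilation by 5, and the
  integrals of \<open>F\<close> over disjoint balls add up to at most the full integral.\<close>

theorem maximal_weak_type:
  fixes F :: "real ^ 'n \<Rightarrow> ennreal"
  assumes F [measurable]: "F \<in> borel_measurable lebesgue" and s: "0 < s"
  shows "ennreal s * emeasure lebesgue {x. ennreal s < maximal F x}
    \<le> ennreal (5 ^ CARD('n) * unit_ball_vol CARD('n)) * (\<integral>\<^sup>+ y. F y \<partial>lebesgue)"
proof (cases "(\<integral>\<^sup>+ y. F y \<partial>lebesgue)")
  case top
  then show ?thesis using unit_ball_vol_pos[of "real CARD('n)"]
    by (auto simp: ennreal_mult_top less_imp_neq[THEN not_sym] simp del: unit_ball_vol_pos)
next
  case (real I)
  let ?n = "CARD('n)"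
  define K where "K = {(x :: real ^ 'n, r). 0 < r \<and>
    ennreal s < ennreal (1 / r ^ ?n) * ball_integral F x r}"
  have K: "0 < r" "ennreal (s * r ^ ?n) \<le> ball_integral F x r"
    if "(x, r) \<in> K" for x r
  proof -
    show r: "0 < r" using that by (simp add: K_def)
    have "ennreal (s * r ^ ?n) = ennreal s * ennreal (r ^ ?n)"
      using s r by (simp add: ennreal_mult)
    also have "\<dots> \<le> (ennreal (1 / r ^ ?n) * ball_integral F x r) * ennreal (r ^ ?n)"
      using that by (intro mult_right_mono) (auto simp: K_def)
    also have "\<dots> = (ennreal (1 / r ^ ?n) * ennreal (r ^ ?n)) * ball_integral F x r"
      by (simp add: mult_ac)
    finally show "ennreal (s * r ^ ?n) \<le> ball_integral F x r" using r by (simp flip: ennreal_mult)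
  qed
  \<comment> \<open>The covering lemma needs bounded radii; finiteness of the integral supplies them.\<close>
  have bounded: "r \<le> max 1 (I / s)" if "(x, r) \<in> K" for x r
  proof -
    have "ball_integral F x r \<le> ennreal I"
      unfolding real(2)[symmetric] by (intro nn_integral_mono) (auto simp: indicator_def)
    with K[OF that] have "ennreal (s * r ^ ?n) \<le> ennreal I" by (meson order_trans)
    then have "r ^ ?n \<le> I / s" using s real by (simp add: field_simps)
    moreover have "r \<le> r ^ ?n" if "1 \<le> r" using that by (simp add: self_le_power)
    ultimately show ?thesis by (cases "1 \<le> r") auto
  qed
  have cover: "{x. ennreal s < maximal F x} \<subseteq> (\<Union>i\<in>K. cball (fst i) (snd i))"
  proof
    fix x assume "x \<in> {x. ennreal s < maximal F x}"
    then obtain r where "(x, r) \<in> K" by (auto simp: maximal_def less_SUP_iff K_def)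
    with K(1)[OF this] show "x \<in> (\<Union>i\<in>K. cball (fst i) (snd i))" by (intro UN_I[of "(x, r)"]) auto
  qed
  obtain C where C: "countable C" "C \<subseteq> K"
    "pairwise (\<lambda>i j. disjnt (cball (fst i) (snd i)) (cball (fst j) (snd j))) C"
    "{x. ennreal s < maximal F x} \<subseteq> (\<Union>i\<in>C. cball (fst i) (5 * snd i))"
    by (rule Vitali_covering_lemma_cballs[OF cover, of "max 1 (I / s)"])
      (use K bounded in force)+
  let ?c = "ennreal (5 ^ ?n * unit_ball_vol ?n)"
  have "ennreal s * emeasure lebesgue {x. ennreal s < maximal F x}
      \<le> ennreal s * (\<integral>\<^sup>+ x. (\<integral>\<^sup>+ i. indicator (cball (fst i) (5 * snd i)) x \<partial>count_space C) \<partial>lebesgue)"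
  proof (intro mult_left_mono)
    have "indicator {x. ennreal s < maximal F x} x
        \<le> (\<integral>\<^sup>+ i. indicator (cball (fst i) (5 * snd i)) x \<partial>count_space C)" for x :: "real ^ 'n"
    proof (cases "ennreal s < maximal F x")
      case True
      then obtain i where "i \<in> C" "x \<in> cball (fst i) (5 * snd i)" using C(4) by blast
      then show ?thesis
        using nn_integral_ge_point[of i C "\<lambda>i. indicator (cball (fst i) (5 * snd i)) x"]
        by (simp add: indicator_def)
    qed auto
    moreover have "{x. ennreal s < maximal F x} \<in> sets lebesgue"
      using borel_open[OF open_maximal_greater[of "ennreal s" F]] by simp
    ultimately show "emeasure lebesgue {x. ennreal s < maximal F x}
        \<le> (\<integral>\<^sup>+ x. (\<integral>\<^sup>+ i. indicator (cball (fst i) (5 * snd i)) x \<partial>count_space C) \<partial>lebesgue)"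
      using nn_integral_mono by (metis (no_types, lifting) nn_integral_indicator)
  qed simp
  also have "\<dots> = ennreal s * (\<integral>\<^sup>+ i. emeasure lebesgue (cball (fst i) (5 * snd i)) \<partial>count_space C)"
    using C(1) by (subst nn_integral_count_space_nn_integral) auto
  also have "\<dots> = (\<integral>\<^sup>+ i. ennreal s * emeasure lebesgue (cball (fst i) (5 * snd i)) \<partial>count_space C)"
    by (simp add: nn_integral_cmult)
  also have "\<dots> \<le> (\<integral>\<^sup>+ i. ?c * (\<integral>\<^sup>+ y\<in>cball (fst i) (snd i). F y \<partial>lebesgue) \<partial>count_space C)"
  proof (rule nn_integral_mono)
    fix i assume "i \<in> space (count_space C)"
    then have i: "(fst i, snd i) \<in> K" using C(2) by auto
    have "ennreal s * emeasure lebesgue (cball (fst i) (5 * snd i)) = ?c * ennreal (s * snd i ^ ?n)"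
      using K(1)[OF i] s
      by (simp add: emeasure_cball power_mult_distrib mult_ac flip: ennreal_mult)
    then show "ennreal s * emeasure lebesgue (cball (fst i) (5 * snd i))
        \<le> ?c * (\<integral>\<^sup>+ y\<in>cball (fst i) (snd i). F y \<partial>lebesgue)"
      using K(2)[OF i] by (simp add: mult_left_mono)
  qed
  also have "\<dots> = ?c * (\<integral>\<^sup>+ i. emeasure (density lebesgue F) (cball (fst i) (snd i)) \<partial>count_space C)"
    by (simp add: nn_integral_cmult emeasure_density)
  also have "(\<integral>\<^sup>+ i. emeasure (density lebesgue F) (cball (fst i) (snd i)) \<partial>count_space C) =
      emeasure (density lebesgue F) (\<Union>i\<in>C. cball (fst i) (snd i))"
    using C(1,3) by (intro emeasure_UN_countable[symmetric])
      (auto simp: pairwise_def disjoint_family_on_def disjnt_def)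
  also have "\<dots> \<le> emeasure (density lebesgue F) (space (density lebesgue F))"
    by (rule emeasure_space)
  also have "\<dots> = (\<integral>\<^sup>+ y. F y \<partial>lebesgue)" by (simp add: emeasure_density)
  finally show ?thesis by (simp add: mult_left_mono)
qed

text \<open>On a set of finite measure a weak type bound of order \<open>q\<close> gives integrability of the power \<open>p < q\<close>:
  summing over the dyadic level sets produces the geometric series with ratio \<open>2 powr (p - q)\<close>,
  while the part where the function is at most 1 contributes the measure of the set.\<close>

lemma nn_integral_ennpowr_le_of_weak_type:
  assumes p: "0 < p" "p < q" and A: "0 \<le> A"
    and G [measurable]: "G \<in> borel_measurable M" and R [measurable]: "R \<in> sets M"
    and weak: "\<And>k::nat. emeasure M {x \<in> R. ennreal (2 ^ k) < G x} \<le> ennreal (A * 2 powr (- real k * q))"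
  shows "(\<integral>\<^sup>+ x\<in>R. ennpowr (G x) p \<partial>M) \<le>
    emeasure M R + ennreal (A * 2 powr p / (1 - 2 powr (p - q)))"
proof -
  define B where "B k = {x \<in> R. ennreal (2 ^ k) < G x}" for k :: nat
  have [measurable]: "B k \<in> sets M" for k
    unfolding B_def using R sets.sets_into_space[OF R]
    by (auto intro!: measurable_sets_Collect simp: Collect_conj_eq[symmetric]) measurable
  let ?w = "\<lambda>k. ennreal (2 powr (real (Suc k) * p))"
  have pointwise: "ennpowr (G x) p * indicator R x \<le> indicator R x + (\<Sum>k. ?w k * indicator (B k) x)" for x
  proof (cases "x \<in> R")
    case True
    let ?S = "\<Sum>k. ?w k * indicator (B k) x"
    have level: "ennreal (2 powr (real m * p)) \<le> 1 + ?S" if "\<And>k. k < m \<Longrightarrow> ennreal (2 ^ k) < G x" for m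
    proof (cases m)
      case 0
      then show ?thesis by simp
    next
      case (Suc k)
      then have "x \<in> B k" using that True by (auto simp: B_def)
      then have "?w k \<le> ?S" using sum_le_suminf[of "\<lambda>k. ?w k * indicator (B k) x" "{k}"] by simp
      also have "\<dots> \<le> 1 + ?S" by simp
      finally show ?thesis using Suc by simp
    qed
    have "ennpowr (G x) p \<le> 1 + ?S"
    proof (cases "G x")
      case top
      have "ennreal (real m * p * ln 2) \<le> 1 + ?S" for m :: nat
      proof -
        have "real m * p * ln 2 \<le> exp (real m * p * ln 2)"
          using exp_ge_add_one_self[of "real m * p * ln 2"] by linarith
        then have "ennreal (real m * p * ln 2) \<le> ennreal (2 powr (real m * p))"
          by (intro ennreal_leI) (simp add: powr_def)
        also have "\<dots> \<le> 1 + ?S" using top by (intro level) auto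
        finally show ?thesis .
      qed
      moreover have "\<exists>m. \<not> ennreal (real m * p * ln 2) \<le> ennreal s" if "0 \<le> s" for s
      proof -
        obtain m where "s / (p * ln 2) < real m" using reals_Archimedean2 by blast
        then have "s < real m * p * ln 2" using p by (simp add: field_simps)
        then show ?thesis using that by (auto simp: not_le ennreal_less_iff)
      qed
      ultimately have "1 + ?S = top" by (cases "1 + ?S") auto
      then show ?thesis by simp
    next
      case (real v)
      obtain m' :: nat where "v < 2 ^ m'" using real_arch_pow[of 2 v] by auto
      then have ex: "\<exists>m::nat. v \<le> 2 ^ m" by (intro exI[of _ m']) simp
      define m where "m = (LEAST m::nat. v \<le> 2 ^ m)"
      have m: "v \<le> 2 ^ m" unfolding m_def using ex by (rule LeastI_ex)
      have "\<not> v \<le> 2 ^ k" if "k < m" for k using not_less_Least that unfolding m_def by blast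
      then have "ennreal (2 powr (real m * p)) \<le> 1 + ?S"
        using real by (intro level) (auto simp: ennreal_less_iff not_le)
      moreover have "v powr p \<le> (2 ^ m) powr p" using m real p by (intro powr_mono2) auto
      then have "v powr p \<le> 2 powr (real m * p)" by (simp add: powr_powr flip: powr_realpow)
      ultimately show ?thesis
        using real by (auto simp: ennpowr_ennreal intro: order_trans[OF ennreal_leI])
    qed
    then show ?thesis using True by simp
  qed simp
  have "(\<integral>\<^sup>+ x\<in>R. ennpowr (G x) p \<partial>M) \<le> (\<integral>\<^sup>+ x. indicator R x + (\<Sum>k. ?w k * indicator (B k) x) \<partial>M)"
    by (intro nn_integral_mono pointwise)
  also have "\<dots> = emeasure M R + (\<Sum>k. ?w k * emeasure M (B k))"
    by (simp add: nn_integral_add nn_integral_suminf nn_integral_cmult)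
  also have "\<dots> \<le> emeasure M R + (\<Sum>k. ennreal (A * 2 powr p * (2 powr (p - q)) ^ k))"
  proof (intro add_left_mono suminf_le)
    fix k
    have "?w k * emeasure M (B k) \<le> ?w k * ennreal (A * 2 powr (- real k * q))"
      using weak[of k] by (intro mult_left_mono) (auto simp: B_def)
    also have "\<dots> = ennreal (A * 2 powr p * (2 powr (p - q)) ^ k)"
    proof -
      have "2 powr (real (Suc k) * p) * 2 powr (- real k * q) = 2 powr p * (2 powr (p - q)) ^ k"
        by (simp add: powr_power algebra_simps flip: powr_add)
      then show ?thesis using A by (simp add: mult_ac flip: ennreal_mult)
    qed
    finally show "?w k * emeasure M (B k) \<le> ennreal (A * 2 powr p * (2 powr (p - q)) ^ k)" .
  qed auto
  also have "(\<Sum>k. ennreal (A * 2 powr p * (2 powr (p - q)) ^ k)) =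
      ennreal (A * 2 powr p / (1 - 2 powr (p - q)))"
    using A p powr_less_mono[of "p - q" 0 2] by (subst suminf_ennreal_geometric) auto
  finally show ?thesis .
qed

text \<open>This crude inequality replaces the inequalities of Jensen and Hoelder throughout: after normalization
  the extra 1 costs only a constant.\<close>

lemma le_one_add_ennpowr: "1 \<le> q \<Longrightarrow> x \<le> 1 + ennpowr x q"
proof (cases x)
  case (real v)
  assume q: "1 \<le> q"
  have "v \<le> 1 + v powr q"
  proof (cases "v \<le> 1")
    case False
    then have "v powr 1 \<le> v powr q" using q by (intro powr_mono) auto
    with False show ?thesis by auto
  qed (simp add: add_increasing2)
  then have "ennreal v \<le> ennreal (1 + v powr q)" by (rule ennreal_leI)
  with real show ?thesis by (simp add: ennpowr_ennreal ennreal_plus)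
qed auto

text \<open>If a mean of \<open>u\<close> exceeds the volume of the unit ball by more than 1, then the corresponding mean
  of \<open>u powr q\<close> exceeds 1. This turns the weak type estimate of order 1 into one of order \<open>q\<close>.\<close>

lemma one_less_maximal_ennpowr:
  fixes u :: "real ^ 'n \<Rightarrow> ennreal"
  assumes q: "1 \<le> q" and u [measurable]: "u \<in> borel_measurable lebesgue"
    and gt: "ennreal (unit_ball_vol CARD('n) + 1) < maximal u x"
  shows "1 < maximal (\<lambda>y. ennpowr (u y) q) x"
proof -
  let ?n = "CARD('n)" and ?V = "unit_ball_vol CARD('n)"
  obtain r where r: "0 < r"
    and gt: "ennreal (?V + 1) < ennreal (1 / r ^ ?n) * ball_integral u x r"
    using gt by (auto simp: maximal_def less_SUP_iff)
  define X where "X = ennreal (1 / r ^ ?n) * power_integral u q (cball x r)"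
  have "ball_integral u x r
      \<le> (\<integral>\<^sup>+ y. indicator (cball x r) y + ennpowr (u y) q * indicator (cball x r) y \<partial>lebesgue)"
    by (intro nn_integral_mono) (auto simp: indicator_def le_one_add_ennpowr[OF q])
  also have "\<dots> = ennreal (?V * r ^ ?n) + power_integral u q (cball x r)"
    using r by (simp add: nn_integral_add emeasure_cball)
  finally have "ennreal (1 / r ^ ?n) * ball_integral u x r
      \<le> ennreal (1 / r ^ ?n) * ennreal (?V * r ^ ?n) + X"
    unfolding X_def distrib_left[symmetric] by (rule mult_left_mono) simp
  also have "ennreal (1 / r ^ ?n) * ennreal (?V * r ^ ?n) = ennreal ?V"
    using r by (simp flip: ennreal_mult)
  finally have le: "ennreal (1 / r ^ ?n) * ball_integral u x r \<le> ennreal ?V + X" .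
  have "ennreal ?V + 1 = ennreal (?V + 1)" by (subst ennreal_plus) auto
  then have "ennreal ?V + 1 < ennreal ?V + X" using less_le_trans[OF gt le] by simp
  then have "1 < X" by (simp add: ennreal_add_left_cancel_less)
  with r show ?thesis
    unfolding maximal_def less_SUP_iff X_def by (intro bexI[of _ r]) auto
qed

lemma ball_in_cube:
  assumes "x \<in> cube z l" "l / 2 + r \<le> m / 2"
  shows "cball x r \<subseteq> cube z m"
proof
  fix y assume y: "y \<in> cball x r"
  show "y \<in> cube z m"
    unfolding mem_cube_iff
  proof
    fix i
    have "\<bar>y $ i - x $ i\<bar> \<le> r"
      using component_le_norm_cart[of "y - x" i] y by (simp add: dist_norm norm_minus_commute)
    moreover have "\<bar>x $ i - z $ i\<bar> \<le> l / 2" using assms by (simp add: mem_cube_iff)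
    ultimately show "\<bar>y $ i - z $ i\<bar> \<le> m / 2" using assms(2) by linarith
  qed
qed

definition maximal_const :: "nat \<Rightarrow> real \<Rightarrow> real \<Rightarrow> real" where
  "maximal_const n p q = (unit_ball_vol n + 1) powr p *
     (1 + 5 ^ n * unit_ball_vol n * 3 ^ n * 2 powr p / (1 - 2 powr (p - q))) + (2 * 3 ^ n) powr p"

lemma maximal_const_pos: "p < q \<Longrightarrow> 0 < maximal_const n p q"
  using powr_less_mono[of "p - q" 0 2] unfolding maximal_const_def
  by (intro add_nonneg_pos mult_nonneg_nonneg add_nonneg_nonneg divide_nonneg_nonneg)
    (auto intro: less_imp_le)

text \<open>For a point of \<open>cube z l\<close>, balls of radius larger than \<open>l\<close> lie in concentric cubes on which the mean
  of \<open>F powr q\<close> is at most 1, and contribute a constant. Balls of smaller radius only see \<open>F\<close> on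
  \<open>cube z (3 * l)\<close>, where the weak type estimate of order \<open>q\<close> is turned into integrability of
  the power \<open>p < q\<close>.\<close>

lemma local_maximal_bound_normalized:
  fixes F :: "real ^ 'n \<Rightarrow> ennreal"
  assumes p: "0 < p" "p \<le> 1" and q: "1 \<le> q" "p < q"
    and F [measurable]: "F \<in> borel_measurable lebesgue" and l: "0 < l"
    and F_le: "\<And>L. l \<le> L \<Longrightarrow> power_integral F q (cube z L) \<le> ennreal (L ^ CARD('n))"
  shows "power_integral (maximal F) p (cube z l) \<le> ennreal (maximal_const CARD('n) p q * l ^ CARD('n))"
proof -
  let ?n = "CARD('n)"
  define V where V: "V = unit_ball_vol ?n"
  have V0: "0 < V" by (simp add: V)
  \<comment> \<open>Balls of radius at most \<open>l\<close> centred in the cube only see this part of \<open>F\<close>.\<close>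
  define F1 where "F1 y = F y * indicator (cube z (3 * l)) y" for y
  have [measurable]: "F1 \<in> borel_measurable lebesgue" unfolding F1_def by measurable
  have split: "maximal F x \<le> maximal F1 x + ennreal (2 * 3 ^ ?n)" if x: "x \<in> cube z l" for x
    unfolding maximal_def[of F]
  proof (rule SUP_least)
    fix r :: real assume "r \<in> {0<..}"
    then have r: "0 < r" by simp
    show "ennreal (1 / r ^ ?n) * ball_integral F x r \<le> maximal F1 x + ennreal (2 * 3 ^ ?n)"
    proof (cases "r \<le> l")
      case True
      then have "cball x r \<subseteq> cube z (3 * l)" using x by (intro ball_in_cube) auto
      then have "ball_integral F x r = ball_integral F1 x r"
        by (intro nn_integral_cong) (auto simp: F1_def indicator_def)
      then have "ennreal (1 / r ^ ?n) * ball_integral F x r \<le> maximal F1 x"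
        unfolding maximal_def using r by (auto intro: SUP_upper2)
      then show ?thesis by (rule add_increasing2[rotated]) simp
    next
      case False
      then have sub: "cball x r \<subseteq> cube z (3 * r)" using x by (intro ball_in_cube) auto
      have "ball_integral F x r
          \<le> (\<integral>\<^sup>+ y. indicator (cube z (3 * r)) y + ennpowr (F y) q * indicator (cube z (3 * r)) y \<partial>lebesgue)"
        using sub by (intro nn_integral_mono) (auto simp: indicator_def le_one_add_ennpowr[OF q(1)])
      also have "\<dots> = ennreal ((3 * r) ^ ?n) + power_integral F q (cube z (3 * r))"
        using r by (simp add: nn_integral_add emeasure_cube)
      also have "\<dots> \<le> ennreal ((3 * r) ^ ?n) + ennreal ((3 * r) ^ ?n)"
        using False l by (intro add_left_mono F_le) auto
      also have "\<dots> = ennreal (2 * (3 * r) ^ ?n)" using r by (simp flip: ennreal_plus)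
      finally have "ennreal (1 / r ^ ?n) * ball_integral F x r
          \<le> ennreal (1 / r ^ ?n) * ennreal (2 * (3 * r) ^ ?n)" by (rule mult_left_mono) simp
      also have "\<dots> = ennreal (2 * 3 ^ ?n)"
        using r by (simp add: power_mult_distrib flip: ennreal_mult)
      finally show ?thesis by (rule add_increasing[rotated]) simp
    qed
  qed
  define G where "G x = ennreal (1 / (V + 1)) * maximal F1 x" for x
  have [measurable]: "G \<in> borel_measurable lebesgue" unfolding G_def by measurable
  let ?A = "5 ^ ?n * V * (3 * l) ^ ?n"
  \<comment> \<open>The factor \<open>1 / (V + 1)\<close> in \<open>G\<close> makes the level \<open>2 ^ k\<close> correspond to the level \<open>V + 1\<close> for
    \<open>F1 / 2 ^ k\<close>, as required for passing to the power \<open>q\<close>.\<close>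
  have weak: "emeasure lebesgue {x \<in> cube z l. ennreal (2 ^ k) < G x} \<le> ennreal (?A * 2 powr (- real k * q))"
    for k :: nat
  proof -
    define u where "u y = ennreal (1 / 2 ^ k) * F1 y" for y
    have [measurable]: "u \<in> borel_measurable lebesgue" unfolding u_def by measurable
    have "1 < maximal (\<lambda>y. ennpowr (u y) q) x" if "ennreal (2 ^ k) < G x" for x
    proof (rule one_less_maximal_ennpowr[OF q(1)])
      have "ennreal (V + 1) = ennreal ((V + 1) / 2 ^ k) * ennreal (2 ^ k)"
        using V0 by (simp flip: ennreal_mult)
      also have "\<dots> < ennreal ((V + 1) / 2 ^ k) * G x"
        using V0 that by (intro ennreal_mult_strict_left_mono) auto
      also have "\<dots> = ennreal (1 / 2 ^ k) * maximal F1 x"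
        using V0 by (simp add: G_def mult.assoc[symmetric] flip: ennreal_mult)
      also have "\<dots> = maximal u x"
        unfolding u_def by (subst maximal_cmult) auto
      finally show "ennreal (unit_ball_vol CARD('n) + 1) < maximal u x" by (simp add: V)
    qed measurable
    then have "{x \<in> cube z l. ennreal (2 ^ k) < G x} \<subseteq> {x. ennreal 1 < maximal (\<lambda>y. ennpowr (u y) q) x}"
      by auto
    then have "emeasure lebesgue {x \<in> cube z l. ennreal (2 ^ k) < G x}
        \<le> emeasure lebesgue {x. ennreal 1 < maximal (\<lambda>y. ennpowr (u y) q) x}"
      using borel_open[OF open_maximal_greater[of "ennreal 1" "\<lambda>y. ennpowr (u y) q"]]
      by (intro emeasure_mono) auto
    also have "\<dots> \<le> ennreal (5 ^ ?n * V) * (\<integral>\<^sup>+ y. ennpowr (u y) q \<partial>lebesgue)"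
      using maximal_weak_type[of "\<lambda>y. ennpowr (u y) q" 1] by (simp add: V)
    also have "(\<integral>\<^sup>+ y. ennpowr (u y) q \<partial>lebesgue) =
        (\<integral>\<^sup>+ y. ennreal (2 powr (- real k * q)) * (ennpowr (F y) q * indicator (cube z (3 * l)) y) \<partial>lebesgue)"
    proof (intro nn_integral_cong)
      fix y
      have "(1 / 2 ^ k) powr q = 2 powr (- real k * q)"
        by (simp add: powr_divide powr_powr powr_minus_divide flip: powr_realpow)
      then show "ennpowr (u y) q =
          ennreal (2 powr (- real k * q)) * (ennpowr (F y) q * indicator (cube z (3 * l)) y)"
        by (auto simp: u_def F1_def ennpowr_mult ennpowr_ennreal indicator_def)
    qed
    also have "\<dots> = ennreal (2 powr (- real k * q)) * power_integral F q (cube z (3 * l))"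
      by (rule nn_integral_cmult) measurable
    also have "\<dots> \<le> ennreal (2 powr (- real k * q)) * ennreal ((3 * l) ^ ?n)"
      using l by (intro mult_left_mono F_le) auto
    finally have "emeasure lebesgue {x \<in> cube z l. ennreal (2 ^ k) < G x}
        \<le> ennreal (5 ^ ?n * V) * (ennreal (2 powr (- real k * q)) * ennreal ((3 * l) ^ ?n))"
      by (simp only: mult_left_mono zero_le)
    also have "\<dots> = ennreal (?A * 2 powr (- real k * q))"
      using V0 l by (simp add: mult_ac flip: ennreal_mult)
    finally show ?thesis .
  qed
  let ?B = "1 + 5 ^ ?n * V * 3 ^ ?n * 2 powr p / (1 - 2 powr (p - q))"
  have lt1: "2 powr (p - q) < 1" using powr_less_mono[of "p - q" 0 2] q by simp
  have G_le: "power_integral G p (cube z l) \<le> ennreal (?B * l ^ ?n)"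
  proof -
    have "power_integral G p (cube z l)
        \<le> ennreal (l ^ ?n) + ennreal (?A * 2 powr p / (1 - 2 powr (p - q)))"
      using nn_integral_ennpowr_le_of_weak_type[OF p(1) q(2), of ?A G lebesgue "cube z l"] weak V0 l
      by (simp add: emeasure_cube)
    also have "\<dots> = ennreal (l ^ ?n + ?A * 2 powr p / (1 - 2 powr (p - q)))"
      using V0 l lt1 by (intro ennreal_plus[symmetric]) auto
    also have "l ^ ?n + ?A * 2 powr p / (1 - 2 powr (p - q)) = ?B * l ^ ?n"
      by (simp add: distrib_right power_mult_distrib)
    finally show ?thesis .
  qed
  have "power_integral (maximal F) p (cube z l) \<le>
      (\<integral>\<^sup>+ x. ennreal ((V + 1) powr p) * (ennpowr (G x) p * indicator (cube z l) x) +
        ennreal ((2 * 3 ^ ?n) powr p) * indicator (cube z l) x \<partial>lebesgue)"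
  proof (intro nn_integral_mono)
    fix x
    show "ennpowr (maximal F x) p * indicator (cube z l) x \<le>
      ennreal ((V + 1) powr p) * (ennpowr (G x) p * indicator (cube z l) x) +
        ennreal ((2 * 3 ^ ?n) powr p) * indicator (cube z l) x"
    proof (cases "x \<in> cube z l")
      case True
      have "maximal F1 x = ennreal (V + 1) * G x"
        unfolding G_def using V0
        by (subst mult.assoc[symmetric], subst ennreal_mult[symmetric]) auto
      then have "ennpowr (maximal F x) p \<le> ennpowr (ennreal (V + 1) * G x + ennreal (2 * 3 ^ ?n)) p"
        using split[OF True] p by (intro ennpowr_mono) auto
      also have "\<dots> \<le> ennpowr (ennreal (V + 1) * G x) p + ennpowr (ennreal (2 * 3 ^ ?n)) p"
        by (rule ennpowr_add_le[OF p])
      also have "\<dots> = ennreal ((V + 1) powr p) * ennpowr (G x) p + ennreal ((2 * 3 ^ ?n) powr p)"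
        using V0 by (simp add: ennpowr_mult ennpowr_ennreal del: ennreal_plus)
      finally show ?thesis using True by simp
    qed simp
  qed
  also have "\<dots> = ennreal ((V + 1) powr p) * power_integral G p (cube z l) +
      ennreal ((2 * 3 ^ ?n) powr p) * ennreal (l ^ ?n)"
    using l by (simp add: nn_integral_add nn_integral_cmult emeasure_cube)
  also have "\<dots> \<le> ennreal ((V + 1) powr p) * ennreal (?B * l ^ ?n) + ennreal ((2 * 3 ^ ?n) powr p) * ennreal (l ^ ?n)"
    by (intro add_right_mono mult_left_mono G_le) simp
  also have "\<dots> = ennreal (((V + 1) powr p * ?B + (2 * 3 ^ ?n) powr p) * l ^ ?n)"
  proof -
    define B where "B = ?B"
    have "0 \<le> B" unfolding B_def using V0 lt1 by simp
    then have "ennreal ((V + 1) powr p) * ennreal (B * l ^ ?n) = ennreal ((V + 1) powr p * B * l ^ ?n)"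
      using l by (subst ennreal_mult[symmetric]) (auto simp: mult.assoc)
    moreover have "ennreal ((2 * 3 ^ ?n) powr p) * ennreal (l ^ ?n) = ennreal ((2 * 3 ^ ?n) powr p * l ^ ?n)"
      using l by (subst ennreal_mult[symmetric]) auto
    ultimately show ?thesis using l \<open>0 \<le> B\<close> unfolding B_def[symmetric] distrib_right
      by (subst ennreal_plus) auto
  qed
  finally show ?thesis by (simp add: maximal_const_def V)
qed

text \<open>The bound for general means follows from the normalized one by homogeneity.\<close>

lemma local_maximal_bound:
  fixes F :: "real ^ 'n \<Rightarrow> ennreal"
  assumes p: "0 < p" "p \<le> 1" and q: "1 \<le> q" "p < q"
    and [measurable]: "F \<in> borel_measurable lebesgue" and l: "0 < l" and K: "0 < K"
    and F_le: "\<And>L. l \<le> L \<Longrightarrow> power_integral F q (cube z L) \<le> ennreal (K powr q * L ^ CARD('n))"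
  shows "power_integral (maximal F) p (cube z l) \<le> ennreal (maximal_const CARD('n) p q * K powr p * l ^ CARD('n))"
proof -
  let ?n = "CARD('n)"
  define F' where "F' y = ennreal (1 / K) * F y" for y
  have [measurable]: "F' \<in> borel_measurable lebesgue" unfolding F'_def by measurable
  have *: "power_integral F' q (cube z L) \<le> ennreal (L ^ ?n)" if "l \<le> L" for L
  proof -
    have "power_integral F' q (cube z L) = ennreal ((1 / K) powr q) * power_integral F q (cube z L)"
      using K by (simp add: F'_def ennpowr_mult ennpowr_ennreal mult.assoc nn_integral_cmult)
    also have "\<dots> \<le> ennreal ((1 / K) powr q) * ennreal (K powr q * L ^ ?n)"
      by (intro mult_left_mono F_le that) simp
    also have "\<dots> = ennreal (L ^ ?n)" using K that l by (simp add: powr_divide flip: ennreal_mult)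
    finally show ?thesis .
  qed
  have M: "maximal F x = ennreal K * maximal F' x" for x
    unfolding F'_def using K by (simp add: maximal_cmult mult.assoc[symmetric] flip: ennreal_mult)
  have "power_integral (maximal F) p (cube z l) = ennreal (K powr p) * power_integral (maximal F') p (cube z l)"
    using K by (simp add: M ennpowr_mult ennpowr_ennreal mult.assoc nn_integral_cmult)
  also have "\<dots> \<le> ennreal (K powr p) * ennreal (maximal_const ?n p q * l ^ ?n)"
    by (intro mult_left_mono local_maximal_bound_normalized[OF p q _ l *]) auto
  finally show ?thesis using maximal_const_pos[OF q(2), of ?n] l by (simp add: mult_ac flip: ennreal_mult)
qed

section \<open>The majorant of an atom\<close>

text \<open>The majorant of an atom on \<open>cube c l\<close> with size function \<open>F\<close>. The cube is contained in the ball
  around \<open>c\<close> of half the radius \<open>n * l\<close>, so that outside this radius the distances to all its points are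
  comparable with the distance to \<open>c\<close>.\<close>

definition atom_majorant ::
    "nat \<Rightarrow> real ^ 'n \<Rightarrow> real \<Rightarrow> (real ^ 'n \<Rightarrow> ennreal) \<Rightarrow> real ^ 'n \<Rightarrow> ennreal" where
  "atom_majorant N c l F x =
     (if norm (x - c) < real CARD('n) * l then maximal F x else ennreal ((l / norm (x - c)) ^ N))"

lemma borel_measurable_atom_majorant [measurable]:
  "atom_majorant N c l F \<in> borel_measurable lebesgue"
proof -
  have [measurable]: "{x. norm (x - c) < real CARD('a) * l} \<in> sets lebesgue"
  proof -
    have "open {x. norm (x - c) < real CARD('a) * l}"
      by (intro open_Collect_less continuous_intros)
    then show ?thesis using borel_open by simp
  qed
  have [measurable]: "(\<lambda>x. ennreal ((l / norm (x - c)) ^ N)) \<in> borel_measurable lebesgue"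
    by (rule measurable_completion) measurable
  show ?thesis unfolding atom_majorant_def by (intro measurable_If) auto
qed

lemma dyadic_bracket:
  fixes v :: real
  assumes "1 \<le> v"
  obtains k :: nat where "2 ^ k \<le> v" "v < 2 ^ Suc k"
proof -
  obtain m :: nat where m: "v < 2 ^ m" using real_arch_pow[of 2 v] by auto
  define k where "k = (LEAST m::nat. v < 2 ^ m)"
  have k: "v < 2 ^ k" unfolding k_def using m by (rule LeastI)
  have k0: "k \<noteq> 0" using k assms by (intro notI) simp
  then have "\<not> v < 2 ^ (k - 1)"
    unfolding k_def by (intro not_less_Least) (simp add: k_def[symmetric])
  with k k0 show thesis by (intro that[of "k - 1"]) auto
qed

text \<open>The complement of the ball is cut into dyadic annuli; the condition on \<open>w\<close> makes their
  contributions a geometric series.\<close>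

lemma nn_integral_power_tail:
  fixes c :: "real ^ 'n"
  assumes w: "real CARD('n) < w" and l: "0 < l"
  shows "(\<integral>\<^sup>+ x\<in>{x. l \<le> norm (x - c)}. ennreal ((l / norm (x - c)) powr w) \<partial>lebesgue)
    \<le> ennreal (4 ^ CARD('n) / (1 - 2 powr (real CARD('n) - w)) * l ^ CARD('n))"
proof -
  let ?n = "CARD('n)"
  let ?f = "\<lambda>k x. ennreal (2 powr (- real k * w)) * indicator (cube c (2 ^ (k + 2) * l)) x"
  have "(\<integral>\<^sup>+ x\<in>{x. l \<le> norm (x - c)}. ennreal ((l / norm (x - c)) powr w) \<partial>lebesgue)
      \<le> (\<integral>\<^sup>+ x. (\<Sum>k. ?f k x) \<partial>lebesgue)"
  proof (intro nn_integral_mono)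
    fix x
    show "ennreal ((l / norm (x - c)) powr w) * indicator {x. l \<le> norm (x - c)} x \<le> (\<Sum>k. ?f k x)"
    proof (cases "l \<le> norm (x - c)")
      case True
      then have r0: "0 < norm (x - c)" using l by linarith
      have "1 \<le> norm (x - c) / l" using l True by simp
      then obtain k :: nat where k: "2 ^ k \<le> norm (x - c) / l" "norm (x - c) / l < 2 ^ Suc k"
        by (rule dyadic_bracket)
      have "x \<in> cube c (2 * (2 ^ Suc k * l))" using k l by (intro subsetD[OF cball_subset_cube])
          (auto simp: dist_norm norm_minus_commute field_simps)
      then have x: "x \<in> cube c (2 ^ (k + 2) * l)" by (simp add: mult_ac)
      have "(l / norm (x - c)) powr w \<le> (1 / 2 ^ k) powr w"
        using k l w r0 by (intro powr_mono2) (auto simp: field_simps)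
      also have "\<dots> = 2 powr (- real k * w)"
        by (simp add: powr_divide powr_powr powr_minus_divide flip: powr_realpow)
      finally have "ennreal ((l / norm (x - c)) powr w) \<le> ?f k x"
        using x by (simp add: ennreal_leI)
      also have "\<dots> \<le> (\<Sum>k. ?f k x)" by (rule ennreal_term_le_suminf)
      finally show ?thesis using True by simp
    qed simp
  qed
  also have "\<dots> = (\<Sum>k. ennreal (2 powr (- real k * w)) * ennreal ((2 ^ (k + 2) * l) ^ ?n))"
  proof -
    have "(\<integral>\<^sup>+ x. ?f k x \<partial>lebesgue) = ennreal (2 powr (- real k * w)) * ennreal ((2 ^ (k + 2) * l) ^ ?n)" for k
      using l by (subst nn_integral_cmult) (auto simp: emeasure_cube)
    then show ?thesis by (subst nn_integral_suminf) auto
  qed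
  also have "\<dots> = (\<Sum>k. ennreal (4 ^ ?n * l ^ ?n * (2 powr (real ?n - w)) ^ k))"
  proof (intro suminf_cong)
    fix k
    have "2 powr (- real k * w) * (2 ^ k) ^ ?n = (2 powr (real ?n - w)) ^ k"
    proof -
      have "((2::real) ^ k) ^ ?n = 2 powr (real k * real ?n)"
        by (simp add: powr_powr powr_realpow[symmetric])
      then show ?thesis by (simp add: powr_power algebra_simps flip: powr_add)
    qed
    then have "2 powr (- real k * w) * (2 ^ (k + 2) * l) ^ ?n = 4 ^ ?n * l ^ ?n * (2 powr (real ?n - w)) ^ k"
      by (simp add: power_mult_distrib mult_ac)
    then show "ennreal (2 powr (- real k * w)) * ennreal ((2 ^ (k + 2) * l) ^ ?n) =
        ennreal (4 ^ ?n * l ^ ?n * (2 powr (real ?n - w)) ^ k)"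
      using l by (subst ennreal_mult[symmetric]) auto
  qed
  also have "\<dots> = ennreal (4 ^ ?n * l ^ ?n * (1 / (1 - 2 powr (real ?n - w))))"
    using l w powr_less_mono[of "real ?n - w" 0 2] by (intro suminf_ennreal_geometric) auto
  finally show ?thesis by (simp add: mult_ac)
qed

lemma growth_class_pos: "\<eta> \<in> growth_class p \<Longrightarrow> 0 < r \<Longrightarrow> 0 < \<eta> x r" by (auto simp: growth_class_def)

lemma growth_class_antimono: "\<eta> \<in> growth_class p \<Longrightarrow> 0 < s \<Longrightarrow> s \<le> r \<Longrightarrow> \<eta> x r \<le> \<eta> x s"
  by (auto simp: growth_class_def)

lemma growth_class_mono_ratio:
  assumes "\<eta> \<in> growth_class p" "0 < s" "s \<le> r"
  shows "1 \<le> \<eta> x s / \<eta> x r"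
  using growth_class_antimono[OF assms] growth_class_pos[OF assms(1), of r] assms by simp

text \<open>Both cubes are compared with the cube around \<open>c\<close> of side \<open>2 * D\<close>: it contains the cube around \<open>z\<close>
  of side \<open>D\<close>, and \<open>\<eta> c\<close> is decreasing.\<close>

lemma cube_monotone_compare:
  fixes \<eta> :: "real ^ 'n \<Rightarrow> real \<Rightarrow> real"
  assumes \<eta>: "\<eta> \<in> growth_class 1" "cube_monotone 1 \<eta>"
    and D: "0 < l" "l \<le> D" "norm (z - c) \<le> D"
  shows "\<eta> z D \<le> 2 ^ CARD('n) * \<eta> c l"
proof -
  have D0: "0 < D" using D by simp
  have "infnorm (c - z) \<le> 2 * D - D"
    using D infnorm_le_norm[of "c - z"] by (simp add: norm_minus_commute)
  then have "\<eta> z D * D powr (real CARD('n) / 1) \<le> \<eta> c (2 * D) * (2 * D) powr (real CARD('n) / 1)"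
    using \<eta>(2) D0 unfolding cube_monotone_def by (metis mult_pos_pos zero_less_numeral)
  then have "\<eta> z D * D ^ CARD('n) \<le> (2 ^ CARD('n) * \<eta> c (2 * D)) * D ^ CARD('n)"
    using D0 by (simp add: powr_realpow power_mult_distrib mult_ac)
  then have "\<eta> z D \<le> 2 ^ CARD('n) * \<eta> c (2 * D)" using D0 by simp
  also have "\<dots> \<le> 2 ^ CARD('n) * \<eta> c l"
    using D by (intro mult_left_mono growth_class_antimono[OF \<eta>(1)]) auto
  finally show ?thesis .
qed

text \<open>The Morrey normalization of an atom on \<open>cube c l\<close>, for a finite exponent and spelled out on
  every cube. On \<open>cube c l\<close> itself it says that the mean of the \<open>q\<close>-th power is at most 1; on smaller
  cubes the mean may grow like \<open>\<eta> powr q\<close>.\<close>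

definition morrey_atom ::
    "real \<Rightarrow> (real ^ 'n \<Rightarrow> real \<Rightarrow> real) \<Rightarrow> real ^ 'n \<Rightarrow> real \<Rightarrow> (real ^ 'n \<Rightarrow> ennreal) \<Rightarrow> bool" where
  "morrey_atom q \<eta> c l F \<longleftrightarrow> F \<in> borel_measurable lebesgue \<and> 0 < l \<and>
     (\<forall>w L. 0 < L \<longrightarrow> power_integral F q (cube w L)
        \<le> ennreal ((\<eta> w L / \<eta> c l) powr q * L ^ CARD('n)))"

lemma ennpowr_atom_majorant_le:
  fixes c :: "real ^ 'n"
  assumes "0 < l" "0 < p"
  shows "ennpowr (atom_majorant N c l F x) p \<le>
    ennpowr (maximal F x) p * indicator (cube c (2 * real CARD('n) * l)) x +
    ennreal ((l / norm (x - c)) powr (p * real N)) * indicator {x. l \<le> norm (x - c)} x"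
proof (cases "norm (x - c) < real CARD('n) * l")
  case True
  then have "x \<in> cube c (2 * (real CARD('n) * l))"
    by (intro subsetD[OF cball_subset_cube]) (auto simp: dist_norm norm_minus_commute)
  with True show ?thesis by (simp add: atom_majorant_def mult.assoc add_increasing2)
next
  case False
  have "1 * l \<le> real CARD('n) * l" using assms by (intro mult_right_mono) auto
  with False have x: "l \<le> norm (x - c)" by simp
  have "((l / norm (x - c)) ^ N) powr p = (l / norm (x - c)) powr (p * real N)"
  proof -
    have "0 < l / norm (x - c)" using assms(1) x by (intro divide_pos_pos) linarith+
    then show ?thesis by (simp add: powr_powr mult.commute flip: powr_realpow)
  qed
  with False x assms show ?thesis by (simp add: atom_majorant_def ennpowr_ennreal add_increasing)
qed

text \<open>The part near the cube is covered by a concentric cube of comparable side, on which and beyond which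
  the means of \<open>F powr q\<close> are at most 1 because \<open>\<eta> c\<close> is decreasing.\<close>

lemma nn_integral_atom_majorant:
  fixes \<eta> :: "real ^ 'n \<Rightarrow> real \<Rightarrow> real"
  assumes p: "0 < p" "p \<le> 1" and q: "1 \<le> q" "p < q" and N: "real CARD('n) < p * real N"
    and \<eta>: "\<eta> \<in> growth_class 1"
  shows "\<exists>C>0. \<forall>F c l. morrey_atom q \<eta> c l F \<longrightarrow>
    (\<integral>\<^sup>+ x. ennpowr (atom_majorant N c l F x) p \<partial>lebesgue) \<le> ennreal (C * l ^ CARD('n))"
proof -
  let ?n = "CARD('n)"
  define C1 where "C1 = maximal_const ?n p q"
  have C1: "0 < C1" unfolding C1_def using q by (intro maximal_const_pos)
  define C2 where "C2 = 4 ^ ?n / (1 - 2 powr (real ?n - p * real N))"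
  have "2 powr (real ?n - p * real N) < 1"
    using powr_less_mono[of "real ?n - p * real N" 0 2] N by simp
  then have C2: "0 < C2" by (simp add: C2_def)
  have main: "(\<integral>\<^sup>+ x. ennpowr (atom_majorant N c l F x) p \<partial>lebesgue)
      \<le> ennreal ((C1 * (2 * real ?n) ^ ?n + C2) * l ^ ?n)" if F: "morrey_atom q \<eta> c l F" for F c l
  proof -
    have [measurable]: "F \<in> borel_measurable lebesgue" and l: "0 < l"
      using F by (auto simp: morrey_atom_def)
    have ll: "l \<le> 2 * real ?n * l"
    proof -
      have "1 \<le> real ?n" by (simp add: Suc_leI)
      then have "1 * l \<le> 2 * real ?n * l" using l by (intro mult_right_mono) linarith+
      then show ?thesis by simp
    qed
    \<comment> \<open>The means over larger concentric cubes are at most 1, so the local bound applies with \<open>K = 1\<close>.\<close>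
    have near: "power_integral (maximal F) p (cube c (2 * real ?n * l))
        \<le> ennreal (C1 * 1 powr p * (2 * real ?n * l) ^ ?n)"
      unfolding C1_def
    proof (rule local_maximal_bound[OF p q])
      fix L assume "2 * real ?n * l \<le> L"
      then have L: "l \<le> L" using ll by simp
      have "\<eta> c L / \<eta> c l \<le> 1"
        using growth_class_antimono[OF \<eta> l L] growth_class_pos[OF \<eta> l, of c] by simp
      then have "(\<eta> c L / \<eta> c l) powr q \<le> 1 powr q"
        using growth_class_pos[OF \<eta> l, of c] growth_class_pos[OF \<eta>, of L c] l L q
        by (intro powr_mono2) auto
      then have "(\<eta> c L / \<eta> c l) powr q * L ^ ?n \<le> 1 powr q * L ^ ?n"
        using l L by (intro mult_right_mono) auto
      then show "power_integral F q (cube c L) \<le> ennreal (1 powr q * L ^ ?n)"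
        using F l L unfolding morrey_atom_def
        by (elim conjE) (rule order_trans[OF _ ennreal_leI], blast intro: less_le_trans, assumption)
    qed (use l in auto)
    have [measurable]: "(\<lambda>x. ennreal ((l / norm (x - c)) powr (p * real N)) * indicator {x. l \<le> norm (x - c)} x)
        \<in> borel_measurable lebesgue" by (rule measurable_completion) measurable
    have "(\<integral>\<^sup>+ x. ennpowr (atom_majorant N c l F x) p \<partial>lebesgue) \<le>
        (\<integral>\<^sup>+ x. ennpowr (maximal F x) p * indicator (cube c (2 * real CARD('n) * l)) x +
          ennreal ((l / norm (x - c)) powr (p * real N)) * indicator {x. l \<le> norm (x - c)} x \<partial>lebesgue)"
      using l p by (intro nn_integral_mono ennpowr_atom_majorant_le)
    also have "\<dots> = power_integral (maximal F) p (cube c (2 * real ?n * l)) +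
        (\<integral>\<^sup>+ x\<in>{x. l \<le> norm (x - c)}. ennreal ((l / norm (x - c)) powr (p * real N)) \<partial>lebesgue)"
      by (rule nn_integral_add) measurable
    also have "\<dots> \<le> ennreal (C1 * 1 powr p * (2 * real ?n * l) ^ ?n) + ennreal (C2 * l ^ ?n)"
      using nn_integral_power_tail[OF N l, of c] by (intro add_mono near) (simp add: C2_def)
    also have "\<dots> = ennreal ((C1 * (2 * real ?n) ^ ?n + C2) * l ^ ?n)"
      using C1 C2 l by (subst ennreal_plus[symmetric]) (auto simp: distrib_right power_mult_distrib)
    finally show ?thesis .
  qed
  show ?thesis
  proof (intro exI conjI allI impI)
    show "0 < C1 * (2 * real ?n) ^ ?n + C2" using C1 C2 by (intro add_nonneg_pos) auto
  qed (rule main)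
qed

text \<open>Three situations have to be distinguished. If the cube of integration is far from the atom compared with
  both sides, only the tail of the majorant is seen. If it is near and at least as large as the
  atom, the integral over the whole space is good enough. If it is near and smaller than the atom, the tail
  is bounded by 1 and the maximal function by the Morrey normalization at scale \<open>m\<close>; this is where
  the quotient of the values of \<open>\<eta>\<close> is needed.\<close>

lemma nn_integral_atom_majorant_cube:
  fixes \<eta> :: "real ^ 'n \<Rightarrow> real \<Rightarrow> real"
  assumes p: "0 < p" "p \<le> 1" and q: "1 \<le> q" "p < q" and N: "real CARD('n) < p * real N"
    and \<eta>: "\<eta> \<in> growth_class 1" "cube_monotone 1 \<eta>"
  shows "\<exists>C>0. \<forall>F c l z m. morrey_atom q \<eta> c l F \<longrightarrow> 0 < m \<longrightarrow>
    power_integral (atom_majorant N c l F) p (cube z m) \<le>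
      ennreal (C * m ^ CARD('n) * ((l / max (max m l) (norm (z - c))) ^ CARD('n) *
        (\<eta> z m / \<eta> z (max (max m l) (norm (z - c)))) powr p))"
proof -
  let ?n = "CARD('n)"
  have n1: "1 \<le> real ?n" by (simp add: Suc_leI)
  define C1 where "C1 = maximal_const ?n p q"
  have C1: "0 < C1" unfolding C1_def using q by (intro maximal_const_pos)
  obtain C2 where C2: "0 < C2" and all_le: "\<And>F c l. morrey_atom q \<eta> c l F \<Longrightarrow>
    (\<integral>\<^sup>+ x. ennpowr (atom_majorant N c l F x) p \<partial>lebesgue) \<le> ennreal (C2 * l ^ ?n)"
    using nn_integral_atom_majorant[OF p q N \<eta>(1)] by blast
  define C where "C = 2 ^ ?n + C2 * (2 * real ?n) ^ ?n + (C1 * (2 ^ ?n) powr p + 1) * (2 * real ?n) ^ ?n"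
  have main: "power_integral (atom_majorant N c l F) p (cube z m) \<le>
      ennreal (C * m ^ ?n * ((l / D) ^ ?n * (\<eta> z m / \<eta> z D) powr p))"
    if F: "morrey_atom q \<eta> c l F" and m: "0 < m" and D: "D = max (max m l) (norm (z - c))"
    for F c l z m D
  proof -
    have l: "0 < l" and [measurable]: "F \<in> borel_measurable lebesgue"
      using F by (auto simp: morrey_atom_def)
    have D0: "0 < D" "m \<le> D" "l \<le> D" "norm (z - c) \<le> D" using m by (auto simp: D)
    define \<rho> where "\<rho> = \<eta> z m / \<eta> z D"
    have \<rho>1: "1 \<le> \<rho>" unfolding \<rho>_def using D0 m by (intro growth_class_mono_ratio[OF \<eta>(1)]) auto
    then have \<rho>p: "1 \<le> \<rho> powr p" using p by (simp add: ge_one_powr_ge_zero)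
    \<comment> \<open>All three situations end with a bound of this shape, where \<open>b\<close> is at most a constant times \<open>l / D\<close>.\<close>
    have scale: "ennreal (c0 * m ^ ?n * (b ^ ?n * \<rho> powr p)) \<le> ennreal (C * m ^ ?n * ((l / D) ^ ?n * \<rho> powr p))"
      if "0 \<le> c0" "0 \<le> b" "b \<le> a * (l / D)" "0 \<le> a" "c0 * a ^ ?n \<le> C" for c0 a b
    proof (intro ennreal_leI)
      have "b ^ ?n \<le> (a * (l / D)) ^ ?n" using that by (intro power_mono)
      then have "c0 * m ^ ?n * (b ^ ?n * \<rho> powr p) \<le> c0 * m ^ ?n * ((a * (l / D)) ^ ?n * \<rho> powr p)"
        using that m by (intro mult_left_mono mult_right_mono) auto
      also have "\<dots> = (c0 * a ^ ?n) * (m ^ ?n * ((l / D) ^ ?n * \<rho> powr p))"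
        by (simp only: power_mult_distrib mult_ac)
      also have "\<dots> \<le> C * (m ^ ?n * ((l / D) ^ ?n * \<rho> powr p))"
        using that m l D0 by (intro mult_right_mono) auto
      finally show "c0 * m ^ ?n * (b ^ ?n * \<rho> powr p) \<le> C * m ^ ?n * ((l / D) ^ ?n * \<rho> powr p)"
        by (simp only: mult.assoc)
    qed
    show ?thesis
    proof (cases "2 * real ?n * max m l \<le> norm (z - c)")
      case far: True
      have "1 * max m l \<le> 2 * real ?n * max m l" using n1 m by (intro mult_right_mono) linarith+
      then have Deq: "D = norm (z - c)" unfolding D using far by simp
      have maj: "ennpowr (atom_majorant N c l F x) p \<le> ennreal ((2 * (l / D)) ^ ?n)" if x: "x \<in> cube z m" for x
      proof -
        have "norm (x - z) \<le> real ?n * m / 2" using x by (rule norm_le_of_mem_cube)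
        moreover have "real ?n * m \<le> real ?n * max m l" by (intro mult_left_mono) auto
        moreover have farD: "2 * (real ?n * max m l) \<le> D" using far Deq by (simp only: mult.assoc)
        moreover have "0 \<le> real ?n * max m l" using m by simp
        ultimately have "norm (x - z) \<le> D / 2" by linarith
        moreover have "norm (z - c) \<le> norm (x - z) + norm (x - c)"
          using norm_triangle_ineq[of "z - x" "x - c"] by (simp add: norm_minus_commute)
        ultimately have xc: "D / 2 \<le> norm (x - c)" using Deq by simp
        have "real ?n * l \<le> real ?n * max m l" by (intro mult_left_mono) auto
        then have nl: "real ?n * l \<le> D / 2" using farD by linarith
        have xc0: "0 < norm (x - c)" using xc D0(1) by linarith
        have "l / norm (x - c) \<le> l / (D / 2)"
          using xc xc0 l D0(1) by (intro divide_left_mono mult_pos_pos) linarith+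
        then have le: "l / norm (x - c) \<le> 2 * (l / D)" by (simp add: mult.commute)
        have "1 * l \<le> real ?n * l" using n1 l by (intro mult_right_mono) auto
        then have le1: "2 * (l / D) \<le> 1" using nl D0 by (simp add: field_simps)
        have "((l / norm (x - c)) ^ N) powr p \<le> ((2 * (l / D)) ^ N) powr p"
          using le l p by (intro powr_mono2 power_mono) auto
        also have "\<dots> = (2 * (l / D)) powr (p * real N)"
          using l D0 by (simp add: powr_powr mult.commute flip: powr_realpow)
        also have "\<dots> \<le> (2 * (l / D)) powr real ?n" using le1 N l D0 by (intro powr_mono') auto
        also have "\<dots> = (2 * (l / D)) ^ ?n" using l D0 by (simp add: powr_realpow)
        finally show ?thesis
          using xc nl l D0 by (auto simp: atom_majorant_def ennpowr_ennreal intro!: ennreal_leI)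
      qed
      have "power_integral (atom_majorant N c l F) p (cube z m)
          \<le> (\<integral>\<^sup>+ x. ennreal ((2 * (l / D)) ^ ?n) * indicator (cube z m) x \<partial>lebesgue)"
        using maj by (intro nn_integral_mono) (auto simp: indicator_def)
      also have "\<dots> = ennreal ((2 * (l / D)) ^ ?n) * ennreal (m ^ ?n)"
        using m by (simp add: nn_integral_cmult_indicator emeasure_cube)
      also have "\<dots> = ennreal (1 * m ^ ?n * ((2 * (l / D)) ^ ?n * 1))"
        using m l D0 by (subst ennreal_mult[symmetric]) (auto simp: mult_ac)
      also have "\<dots> \<le> ennreal (1 * m ^ ?n * ((2 * (l / D)) ^ ?n * \<rho> powr p))"
        using \<rho>p m l D0 by (intro ennreal_leI mult_left_mono) auto
      also have "\<dots> \<le> ennreal (C * m ^ ?n * ((l / D) ^ ?n * \<rho> powr p))"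
        using l D0 C1 C2 by (intro scale[where a = 2]) (auto simp: C_def)
      finally show ?thesis unfolding \<rho>_def .
    next
      case near: False
      have "1 * max m l \<le> 2 * real ?n * max m l" using n1 m by (intro mult_right_mono) linarith+
      then have Dle: "D \<le> 2 * real ?n * max m l" unfolding D using near by simp
      show ?thesis
      proof (cases "l \<le> m")
        case True
        have "l \<le> m * (2 * real ?n * (l / D))" using Dle True l D0 by (simp add: field_simps)
        then have lm: "l / m \<le> 2 * real ?n * (l / D)" using m by (simp add: field_simps)
        have "power_integral (atom_majorant N c l F) p (cube z m)
            \<le> (\<integral>\<^sup>+ x. ennpowr (atom_majorant N c l F x) p \<partial>lebesgue)"
          by (intro nn_integral_mono) (auto simp: indicator_def)
        also have "\<dots> \<le> ennreal (C2 * l ^ ?n)" by (rule all_le[OF F])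
        also have "\<dots> = ennreal (C2 * m ^ ?n * ((l / m) ^ ?n * 1))" using m by (simp add: power_divide)
        also have "\<dots> \<le> ennreal (C2 * m ^ ?n * ((l / m) ^ ?n * \<rho> powr p))"
          using \<rho>p m l C2 by (intro ennreal_leI mult_left_mono) auto
        also have "\<dots> \<le> ennreal (C * m ^ ?n * ((l / D) ^ ?n * \<rho> powr p))"
          using l m lm C1 C2 by (intro scale[where a = "2 * real ?n"]) (auto simp: C_def)
        finally show ?thesis unfolding \<rho>_def .
      next
        case False
        then have lm: "1 \<le> 2 * real ?n * (l / D)" using Dle l D0 by (simp add: field_simps)
        define K where "K = \<eta> z m / \<eta> c l"
        have K0: "0 < K" unfolding K_def using growth_class_pos[OF \<eta>(1)] m l by simp
        \<comment> \<open>Here the value of \<open>\<eta>\<close> on the atom is compared with its value on a cube around \<open>z\<close>.\<close>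
        have K: "K \<le> 2 ^ ?n * \<rho>"
          using cube_monotone_compare[OF \<eta> l D0(3,4)] growth_class_pos[OF \<eta>(1)] m l D0
          by (simp add: K_def \<rho>_def field_simps)
        have near_le: "power_integral (maximal F) p (cube z m) \<le> ennreal (C1 * K powr p * m ^ ?n)"
          unfolding C1_def
        proof (rule local_maximal_bound[OF p q])
          fix L assume L: "m \<le> L"
          have "\<eta> z L / \<eta> c l \<le> K"
            unfolding K_def using growth_class_antimono[OF \<eta>(1) m L] growth_class_pos[OF \<eta>(1) l]
            by (intro divide_right_mono) (auto intro: less_imp_le)
          then have "(\<eta> z L / \<eta> c l) powr q \<le> K powr q"
            using growth_class_pos[OF \<eta>(1) l, of c] growth_class_pos[OF \<eta>(1), of L z] m L q
            by (intro powr_mono2) auto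
          then have "(\<eta> z L / \<eta> c l) powr q * L ^ ?n \<le> K powr q * L ^ ?n"
            using m L by (intro mult_right_mono) auto
          then show "power_integral F q (cube z L) \<le> ennreal (K powr q * L ^ ?n)"
            using F m L unfolding morrey_atom_def
            by (elim conjE) (rule order_trans[OF _ ennreal_leI], blast intro: less_le_trans, assumption)
        qed (use m K0 in auto)
        have "power_integral (atom_majorant N c l F) p (cube z m)
            \<le> (\<integral>\<^sup>+ x. ennpowr (maximal F x) p * indicator (cube z m) x + indicator (cube z m) x \<partial>lebesgue)"
        proof (intro nn_integral_mono)
          fix x
          have "ennpowr (atom_majorant N c l F x) p \<le> ennpowr (maximal F x) p + 1"
          proof (cases "norm (x - c) < real ?n * l")
            case False
            have "1 * l \<le> real ?n * l" using n1 l by (intro mult_right_mono) auto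
            then have "l \<le> norm (x - c)" using False by simp
            then have "l / norm (x - c) \<le> 1" using l by (simp add: divide_le_eq_1)
            then have "(l / norm (x - c)) ^ N \<le> 1" using l by (intro power_le_one) auto
            then have "ennpowr (ennreal ((l / norm (x - c)) ^ N)) p \<le> ennpowr 1 p"
              using p by (intro ennpowr_mono) (auto simp flip: ennreal_1 intro: ennreal_leI)
            then show ?thesis using False by (simp add: atom_majorant_def add_increasing)
          qed (simp add: atom_majorant_def)
          then show "ennpowr (atom_majorant N c l F x) p * indicator (cube z m) x \<le>
              ennpowr (maximal F x) p * indicator (cube z m) x + indicator (cube z m) x"
            by (simp add: indicator_def)
        qed
        also have "\<dots> = power_integral (maximal F) p (cube z m) + ennreal (m ^ ?n)"
          using m by (simp add: nn_integral_add emeasure_cube)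
        also have "\<dots> \<le> ennreal (C1 * K powr p * m ^ ?n) + ennreal (m ^ ?n)"
          by (intro add_right_mono near_le)
        also have "\<dots> = ennreal ((C1 * K powr p + 1) * m ^ ?n)"
          using C1 m by (subst ennreal_plus[symmetric]) (auto simp: distrib_right)
        also have "\<dots> \<le> ennreal ((C1 * (2 ^ ?n) powr p + 1) * m ^ ?n * (1 ^ ?n * \<rho> powr p))"
        proof (intro ennreal_leI)
          have "K powr p \<le> (2 ^ ?n * \<rho>) powr p" using K K0 p by (intro powr_mono2) auto
          also have "\<dots> = (2 ^ ?n) powr p * \<rho> powr p" using \<rho>1 by (simp add: powr_mult)
          finally have "C1 * K powr p + 1 \<le> C1 * ((2 ^ ?n) powr p * \<rho> powr p) + \<rho> powr p"
            using C1 \<rho>p by (intro add_mono mult_left_mono) auto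
          then have "(C1 * K powr p + 1) * m ^ ?n \<le> (C1 * ((2 ^ ?n) powr p * \<rho> powr p) + \<rho> powr p) * m ^ ?n"
            using m by (intro mult_right_mono) auto
          then show "(C1 * K powr p + 1) * m ^ ?n \<le> (C1 * (2 ^ ?n) powr p + 1) * m ^ ?n * (1 ^ ?n * \<rho> powr p)"
            by (simp add: algebra_simps)
        qed
        also have "\<dots> \<le> ennreal (C * m ^ ?n * ((l / D) ^ ?n * \<rho> powr p))"
          using lm C1 C2 by (intro scale[where a = "2 * real ?n"]) (auto simp: C_def)
        finally show ?thesis unfolding \<rho>_def .
      qed
    qed
  qed
  show ?thesis
  proof (intro exI conjI allI impI)
    show "0 < C" unfolding C_def using C1 C2 by (intro add_pos_nonneg) auto
  qed (rule main[OF _ _ refl])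
qed

text \<open>Each tail of the series is at most a fixed multiple of its first term, so passing from one
  tail to the next removes a fixed proportion.\<close>

lemma geometric_decay_of_tail_sums:
  fixes u :: "nat \<Rightarrow> real"
  assumes u: "\<And>k. 0 \<le> u k" and C: "1 \<le> C"
    and tail: "\<And>k M. (\<Sum>i<M. u (k + i)) \<le> C * u k"
  shows "u k \<le> C * (1 - 1 / C) ^ k * u 0"
proof -
  define T where "T M k = (\<Sum>i<M. u (k + i))" for M k
  have step: "T M (Suc k) \<le> (1 - 1 / C) * T (Suc M) k" for M k
  proof -
    have "T (Suc M) k = u k + T M (Suc k)"
      unfolding T_def by (subst sum.lessThan_Suc_shift) simp
    moreover have "T (Suc M) k / C \<le> u k"
      using tail[where k = k and M = "Suc M"] C by (simp add: T_def divide_le_eq mult.commute)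
    ultimately show ?thesis by (simp add: left_diff_distrib)
  qed
  have "T M k \<le> (1 - 1 / C) ^ k * T (M + k) 0" for M
  proof (induction k arbitrary: M)
    case (Suc k)
    have "T M (Suc k) \<le> (1 - 1 / C) * T (Suc M) k" by (rule step)
    also have "\<dots> \<le> (1 - 1 / C) * ((1 - 1 / C) ^ k * T (Suc M + k) 0)"
      using C by (intro mult_left_mono Suc) auto
    finally show ?case by (simp add: mult_ac)
  qed simp
  from this[of 1] have "u k \<le> (1 - 1 / C) ^ k * T (1 + k) 0" by (simp add: T_def)
  also have "\<dots> \<le> (1 - 1 / C) ^ k * (C * u 0)"
    using C tail[where k = 0 and M = "1 + k"] by (intro mult_left_mono) (auto simp: T_def)
  finally show ?thesis by (simp add: mult_ac)
qed

section \<open>Summation over the atoms\<close>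

abbreviation integral_condition ::
    "(real ^ 'n \<Rightarrow> real \<Rightarrow> real) \<Rightarrow> (real ^ 'n \<Rightarrow> real \<Rightarrow> real) \<Rightarrow> bool" where
  "integral_condition \<phi> \<eta> \<equiv> (\<exists>C0>0. \<forall>x r. 0 < r \<longrightarrow>
     (\<integral>\<^sup>+ s\<in>{r<..}. ennreal (\<phi> x s / (\<eta> x s * s)) \<partial>lborel) \<le> ennreal (C0 * (\<phi> x r / \<eta> x r)))"

text \<open>The integral over the dyadic interval from \<open>2 ^ k * m\<close> to \<open>2 ^ (k + 1) * m\<close> is at least a
  multiple of the value of \<open>\<phi> / \<eta>\<close> at the right endpoint, so the integral condition bounds
  the dyadic tails and forces geometric decay.\<close>

lemma ratio_geometric_decay:
  fixes \<phi> \<eta> :: "real ^ 'n \<Rightarrow> real \<Rightarrow> real"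
  assumes \<phi>: "\<phi> \<in> growth_class 1" and \<eta>: "\<eta> \<in> growth_class 1"
    and int: "integral_condition \<phi> \<eta>"
  shows "\<exists>K>0. \<exists>\<theta>>0. \<theta> < 1 \<and> (\<forall>z m k. 0 < m \<longrightarrow>
     \<phi> z (2 ^ k * m) / \<eta> z (2 ^ k * m) \<le> K * \<theta> ^ k * (\<phi> z m / \<eta> z m))"
proof -
  let ?n = "CARD('n)"
  obtain C0 where C0: "0 < C0" and int: "\<And>x r. 0 < r \<Longrightarrow>
      (\<integral>\<^sup>+ s\<in>{r<..}. ennreal (\<phi> x s / (\<eta> x s * s)) \<partial>lborel) \<le> ennreal (C0 * (\<phi> x r / \<eta> x r))"
    using int by blast
  obtain C1 where C1: "0 < C1" and "\<forall>x s r. 0 < s \<and> s \<le> r \<longrightarrow> \<eta> x r \<le> \<eta> x s \<and>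
      C1 * \<eta> x r * r powr (real ?n / 1) \<ge> \<eta> x s * s powr (real ?n / 1)"
    using \<eta> by (auto simp: growth_class_def)
  then have growth: "\<eta> x s * s ^ ?n \<le> C1 * \<eta> x r * r ^ ?n" if "0 < s" "s \<le> r" for x s r
    using that by (simp add: powr_realpow)
  define c where "c = 1 / (C1 * 2 ^ ?n)"
  have c0: "0 < c" using C1 by (simp add: c_def)
  define \<psi> where "\<psi> z r = \<phi> z r / \<eta> z r" for z r
  have \<psi>0: "0 < \<psi> z r" if "0 < r" for z r
    using growth_class_pos[OF \<phi> that] growth_class_pos[OF \<eta> that] by (simp add: \<psi>_def)
  have lower: "c * \<psi> z (2 * r) / (2 * r) \<le> \<phi> z s / (\<eta> z s * s)"
    if r: "0 < r" "r < s" "s \<le> 2 * r" for z r s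
  proof -
    have pos: "0 < \<eta> z s" "0 < \<eta> z (2 * r)" "0 < \<phi> z (2 * r)"
      using r growth_class_pos[OF \<phi>] growth_class_pos[OF \<eta>] by auto
    have "\<eta> z s * r ^ ?n \<le> \<eta> z s * s ^ ?n" using r pos by (intro mult_left_mono power_mono) auto
    also have "\<dots> \<le> C1 * \<eta> z (2 * r) * (2 * r) ^ ?n" using r by (intro growth) auto
    finally have "\<eta> z s * r ^ ?n \<le> (C1 * 2 ^ ?n * \<eta> z (2 * r)) * r ^ ?n"
      by (simp add: power_mult_distrib mult_ac)
    then have le: "\<eta> z s \<le> C1 * 2 ^ ?n * \<eta> z (2 * r)" using r by simp
    have "c * \<psi> z (2 * r) / (2 * r) = \<phi> z (2 * r) / ((C1 * 2 ^ ?n * \<eta> z (2 * r)) * (2 * r))"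
      by (simp add: c_def \<psi>_def)
    also have "\<dots> \<le> \<phi> z s / (\<eta> z s * s)" using r pos le growth_class_antimono[OF \<phi>, of s "2 * r" z]
      by (intro frac_le mult_mono mult_pos_pos) auto
    finally show ?thesis .
  qed
  have tails: "(\<Sum>i<M. c / 2 * \<psi> z (2 ^ Suc i * r)) \<le> C0 * \<psi> z r" if r: "0 < r" for z r M
  proof -
    define I where "I i = {2 ^ i * r<..2 * (2 ^ i * r)}" for i :: nat
    define a where "a i = c * \<psi> z (2 * (2 ^ i * r)) / (2 * (2 ^ i * r))" for i :: nat
    have a0: "0 \<le> a i" for i unfolding a_def using r c0 \<psi>0[of "2 * (2 ^ i * r)" z] by simp
    \<comment> \<open>The dyadic intervals are disjoint, so at most one summand is nonzero at each \<open>s\<close>.\<close>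
    have unique: "i = j" if "s \<in> I i" "s \<in> I j" for i j s
    proof -
      have *: "\<not> i < j" if "s \<in> I i" "s \<in> I j" for i j
      proof
        assume "i < j"
        then have "2 * 2 ^ i \<le> (2::real) ^ j"
          using power_increasing[of "Suc i" j "2::real"] by simp
        then have "2 * (2 ^ i * r) \<le> 2 ^ j * r" using r by (simp add: mult.assoc[symmetric])
        with that show False by (auto simp: I_def)
      qed
      from *[of i j] *[of j i] that show ?thesis by auto
    qed
    have "ennreal (\<Sum>i<M. c / 2 * \<psi> z (2 ^ Suc i * r)) = (\<Sum>i<M. ennreal (a i) * emeasure lborel (I i))"
    proof -
      have "ennreal (c / 2 * \<psi> z (2 ^ Suc i * r)) = ennreal (a i) * emeasure lborel (I i)" for i
        using r a0[of i] by (simp add: I_def a_def mult.assoc flip: ennreal_mult)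
      moreover have "0 \<le> c / 2 * \<psi> z (2 ^ Suc i * r)" for i
        using c0 r \<psi>0[of "2 ^ Suc i * r" z] by simp
      ultimately show ?thesis by (subst sum_ennreal[symmetric]) auto
    qed
    also have "\<dots> = (\<integral>\<^sup>+ s. (\<Sum>i<M. ennreal (a i) * indicator (I i) s) \<partial>lborel)"
      by (subst nn_integral_sum) (auto simp: nn_integral_cmult_indicator I_def)
    also have "\<dots> \<le> (\<integral>\<^sup>+ s\<in>{r<..}. ennreal (\<phi> z s / (\<eta> z s * s)) \<partial>lborel)"
    proof (intro nn_integral_mono)
      fix s
      show "(\<Sum>i<M. ennreal (a i) * indicator (I i) s) \<le> ennreal (\<phi> z s / (\<eta> z s * s)) * indicator {r<..} s"
      proof (cases "\<exists>i<M. s \<in> I i")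
        case True
        then obtain i where i: "i < M" "s \<in> I i" by blast
        have "(\<Sum>j<M. ennreal (a j) * indicator (I j) s) = (\<Sum>j\<in>{i}. ennreal (a j) * indicator (I j) s)"
          using i unique by (intro sum.mono_neutral_right) (auto simp: indicator_def)
        also have "\<dots> \<le> ennreal (\<phi> z s / (\<eta> z s * s))"
          using i lower[of "2 ^ i * r" s z] r by (auto simp: I_def a_def intro!: ennreal_leI)
        also have "r < s"
        proof -
          have "1 * r \<le> 2 ^ i * r" using r by (intro mult_right_mono) auto
          then show ?thesis using i by (simp add: I_def)
        qed
        then have "ennreal (\<phi> z s / (\<eta> z s * s)) = ennreal (\<phi> z s / (\<eta> z s * s)) * indicator {r<..} s"
          by simp
        finally show ?thesis .
      next
        case False
        then have "(\<Sum>i<M. ennreal (a i) * indicator (I i) s) = 0"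
          by (intro sum.neutral) (auto simp: indicator_def)
        then show ?thesis by simp
      qed
    qed
    also have "\<dots> \<le> ennreal (C0 * \<psi> z r)" unfolding \<psi>_def by (rule int[OF r])
    finally show ?thesis using C0 \<psi>0[OF r, of z] by (subst (asm) ennreal_le_iff) auto
  qed
  \<comment> \<open>The summand 2 includes the first term of the tail and makes the ratio \<open>1 - 1 / C\<close> positive.\<close>
  define C where "C = 2 + 2 * C0 / c"
  have C2: "2 \<le> C" unfolding C_def using c0 C0 by simp
  have decay: "\<psi> z (2 ^ k * m) \<le> C * (1 - 1 / C) ^ k * \<psi> z m" if m: "0 < m" for z m k
  proof -
    have tail: "(\<Sum>i<M. \<psi> z (2 ^ (k + i) * m)) \<le> C * \<psi> z (2 ^ k * m)" for k M
    proof -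
      have km: "0 < 2 ^ k * m" using m by simp
      have nn: "0 \<le> \<psi> z (2 ^ i * m)" for i using \<psi>0[of "2 ^ i * m" z] m by simp
      have "(\<Sum>i<M. c / 2 * \<psi> z (2 ^ Suc i * (2 ^ k * m))) \<le> C0 * \<psi> z (2 ^ k * m)"
        by (rule tails[OF km])
      then have "(c / 2) * (\<Sum>i<M. \<psi> z (2 ^ Suc i * (2 ^ k * m))) \<le> C0 * \<psi> z (2 ^ k * m)"
        by (simp only: sum_distrib_left)
      then have "(\<Sum>i<M. \<psi> z (2 ^ Suc i * (2 ^ k * m))) \<le> 2 * C0 / c * \<psi> z (2 ^ k * m)"
        using c0 by (simp add: field_simps)
      then have shifted: "(\<Sum>i<M. \<psi> z (2 ^ (k + Suc i) * m)) \<le> 2 * C0 / c * \<psi> z (2 ^ k * m)"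
        by (simp add: power_add mult_ac)
      have "(\<Sum>i<M. \<psi> z (2 ^ (k + i) * m)) \<le> (\<Sum>i<Suc M. \<psi> z (2 ^ (k + i) * m))" using nn by simp
      also have "\<dots> = \<psi> z (2 ^ k * m) + (\<Sum>i<M. \<psi> z (2 ^ (k + Suc i) * m))"
        by (subst sum.lessThan_Suc_shift) simp
      also have "\<dots> \<le> \<psi> z (2 ^ k * m) + 2 * C0 / c * \<psi> z (2 ^ k * m)"
        by (intro add_left_mono shifted)
      also have "\<dots> = (1 + 2 * C0 / c) * \<psi> z (2 ^ k * m)" by (simp only: distrib_right mult_1)
      also have "\<dots> \<le> C * \<psi> z (2 ^ k * m)"
        unfolding C_def using nn by (intro mult_right_mono) auto
      finally show ?thesis .
    qed
    have "\<psi> z (2 ^ k * m) \<le> C * (1 - 1 / C) ^ k * \<psi> z (2 ^ 0 * m)"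
    proof (rule geometric_decay_of_tail_sums[where u = "\<lambda>k. \<psi> z (2 ^ k * m)"])
      show "0 \<le> \<psi> z (2 ^ k * m)" for k using \<psi>0[of "2 ^ k * m" z] m by simp
    qed (use C2 tail in auto)
    then show ?thesis by simp
  qed
  show ?thesis
  proof (intro exI conjI allI impI)
    show "0 < C" "0 < 1 - 1 / C" "1 - 1 / C < 1" using C2 by (auto simp: field_simps)
    show "\<phi> z (2 ^ k * m) / \<eta> z (2 ^ k * m) \<le> C * (1 - 1 / C) ^ k * (\<phi> z m / \<eta> z m)"
      if "0 < m" for z m k using decay[OF that] by (simp add: \<psi>_def)
  qed
qed

text \<open>Tonelli for the counting measure on the natural numbers.\<close>

lemma suminf_swap_ennreal: "(\<Sum>i. \<Sum>j. f i j) = (\<Sum>j. \<Sum>i. f i j :: ennreal)"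
proof -
  have "(\<Sum>j. \<Sum>i. f i j) = (\<integral>\<^sup>+ j. (\<Sum>i. f i j) \<partial>count_space UNIV)"
    by (simp add: nn_integral_count_space_nat)
  also have "\<dots> = (\<Sum>i. \<integral>\<^sup>+ j. f i j \<partial>count_space UNIV)" by (rule nn_integral_suminf) simp
  finally show ?thesis by (simp add: nn_integral_count_space_nat)
qed

abbreviation weighted_cubes ::
    "real \<Rightarrow> (nat \<Rightarrow> real) \<Rightarrow> (nat \<Rightarrow> real ^ 'n) \<Rightarrow> (nat \<Rightarrow> real) \<Rightarrow> real ^ 'n \<Rightarrow> ennreal" where
  "weighted_cubes p lam c l x \<equiv> (\<Sum>j. ennreal (lam j powr p) * indicator (cube (c j) (l j)) x)"

abbreviation weighted_majorants ::
    "nat \<Rightarrow> real \<Rightarrow> (nat \<Rightarrow> real) \<Rightarrow> (nat \<Rightarrow> real ^ 'n) \<Rightarrow> (nat \<Rightarrow> real) \<Rightarrow> (nat \<Rightarrow> real ^ 'n \<Rightarrow> ennreal) \<Rightarrow>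
      real ^ 'n \<Rightarrow> ennreal" where
  "weighted_majorants N p lam c l F x \<equiv>
     (\<Sum>j. ennreal (lam j powr p) * ennpowr (atom_majorant N (c j) (l j) (F j) x) p)"

text \<open>The atoms are sorted by the dyadic size of \<open>D j\<close>. All atoms with \<open>D j \<le> \<rho>\<close> lie in one cube
  of side \<open>3 * \<rho>\<close>, and the assumed bound for that cube controls their total weighted volume. The
  remaining series over the dyadic sizes converges by the geometric decay of \<open>\<phi> / \<eta>\<close>.\<close>

theorem nn_integral_sum_atom_majorants:
  fixes \<phi> \<eta> :: "real ^ 'n \<Rightarrow> real \<Rightarrow> real"
  assumes p: "0 < p" "p \<le> 1" and q: "1 \<le> q" "p < q" and N: "real CARD('n) < p * real N"
    and \<phi>: "\<phi> \<in> growth_class 1"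
    and \<eta>: "\<eta> \<in> growth_class 1" "cube_monotone 1 \<eta>"
    and int: "integral_condition \<phi> \<eta>"
  shows "\<exists>C>0. \<forall>c l F lam b. (\<forall>j::nat. morrey_atom q \<eta> (c j) (l j) (F j)) \<longrightarrow> 0 \<le> b \<longrightarrow>
    (\<forall>z L. 0 < L \<longrightarrow> (\<integral>\<^sup>+ x\<in>cube z L. weighted_cubes p lam c l x \<partial>lebesgue)
        \<le> ennreal ((b * \<phi> z L) powr p * L ^ CARD('n))) \<longrightarrow>
    (\<forall>z m. 0 < m \<longrightarrow> (\<integral>\<^sup>+ x\<in>cube z m. weighted_majorants N p lam c l F x \<partial>lebesgue)
        \<le> ennreal (C * (b * \<phi> z m) powr p * m ^ CARD('n)))"
proof -
  let ?n = "CARD('n)"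
  obtain C1 where C1: "0 < C1" and single: "\<And>F c l z m. morrey_atom q \<eta> c l F \<Longrightarrow> 0 < m \<Longrightarrow>
    power_integral (atom_majorant N c l F) p (cube z m) \<le>
      ennreal (C1 * m ^ ?n * ((l / max (max m l) (norm (z - c))) ^ ?n *
        (\<eta> z m / \<eta> z (max (max m l) (norm (z - c)))) powr p))"
    using nn_integral_atom_majorant_cube[OF p q N \<eta>] by blast
  obtain K \<theta> where K: "0 < K" and \<theta>: "0 < \<theta>" "\<theta> < 1" and decay: "\<And>z m k. 0 < m \<Longrightarrow>
     \<phi> z (2 ^ k * m) / \<eta> z (2 ^ k * m) \<le> K * \<theta> ^ k * (\<phi> z m / \<eta> z m)"
    using ratio_geometric_decay[OF \<phi> \<eta>(1) int] by blast
  define C where "C = C1 * 6 ^ ?n * K powr p * \<theta> powr p * (1 / (1 - \<theta> powr p))"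
  have \<theta>p: "\<theta> powr p < 1" using powr_less_mono2[of p \<theta> 1] \<theta> p by simp
  have C0: "0 < C" unfolding C_def using C1 K \<theta> \<theta>p by simp
  have main: "(\<integral>\<^sup>+ x\<in>cube z m. weighted_majorants N p lam c l F x \<partial>lebesgue)
        \<le> ennreal (C * (b * \<phi> z m) powr p * m ^ ?n)"
    if atoms: "\<And>j::nat. morrey_atom q \<eta> (c j) (l j) (F j)" and b: "0 \<le> b"
      and sum_le: "\<And>z L. 0 < L \<Longrightarrow> (\<integral>\<^sup>+ x\<in>cube z L. weighted_cubes p lam c l x \<partial>lebesgue)
        \<le> ennreal ((b * \<phi> z L) powr p * L ^ ?n)"
      and m: "0 < m" for c l F lam b z m
  proof -
    have l: "0 < l j" for j using atoms[of j] by (simp add: morrey_atom_def)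
    define D where "D j = max (max m (l j)) (norm (z - c j))" for j
    have D: "0 < D j" "m \<le> D j" "l j \<le> D j" "norm (z - c j) \<le> D j" for j
      using m by (auto simp: D_def)
    define \<rho> where "\<rho> k = 2 ^ Suc k * m" for k :: nat
    have \<rho>: "0 < \<rho> k" "m \<le> \<rho> k" for k
    proof -
      show "0 < \<rho> k" using m by (simp add: \<rho>_def)
      have "1 * m \<le> 2 ^ Suc k * m" using m by (intro mult_right_mono one_le_power) auto
      then show "m \<le> \<rho> k" by (simp add: \<rho>_def)
    qed
    have pos: "0 < \<eta> x r" "0 < \<phi> x r" if "0 < r" for x r
      using growth_class_pos[OF \<phi> that] growth_class_pos[OF \<eta>(1) that] by auto
    \<comment> \<open>The total weighted volume of all atoms that sit within distance and size \<open>r\<close> of \<open>z\<close>.\<close>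
    have packing: "(\<Sum>j. ennreal (lam j powr p * l j ^ ?n) * indicator {j. D j \<le> r} j)
        \<le> ennreal ((b * \<phi> z r) powr p * (3 * r) ^ ?n)" if r: "0 < r" for r
    proof -
      have "ennreal (lam j powr p * l j ^ ?n) * indicator {j. D j \<le> r} j \<le>
          (\<integral>\<^sup>+ x\<in>cube z (3 * r). ennreal (lam j powr p) * indicator (cube (c j) (l j)) x \<partial>lebesgue)" for j
      proof (cases "D j \<le> r")
        case True
        have "cube (c j) (l j) \<subseteq> cube z (3 * r)"
        proof
          fix y assume y: "y \<in> cube (c j) (l j)"
          show "y \<in> cube z (3 * r)" unfolding mem_cube_iff
          proof
            fix i
            have "\<bar>y $ i - c j $ i\<bar> \<le> l j / 2" using y by (simp add: mem_cube_iff)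
            moreover have "\<bar>z $ i - c j $ i\<bar> \<le> norm (z - c j)"
              using component_le_norm_cart[of "z - c j" i] by simp
            ultimately show "\<bar>y $ i - z $ i\<bar> \<le> 3 * r / 2" using D(3,4)[of j] True by linarith
          qed
        qed
        then have "(\<integral>\<^sup>+ x\<in>cube z (3 * r). ennreal (lam j powr p) * indicator (cube (c j) (l j)) x \<partial>lebesgue) =
            (\<integral>\<^sup>+ x. ennreal (lam j powr p) * indicator (cube (c j) (l j)) x \<partial>lebesgue)"
          by (intro nn_integral_cong) (auto simp: indicator_def)
        also have "\<dots> = ennreal (lam j powr p * l j ^ ?n)"
          using l[of j] by (simp add: nn_integral_cmult_indicator emeasure_cube ennreal_mult)
        finally show ?thesis by (simp add: indicator_def)
      qed simp
      then have "(\<Sum>j. ennreal (lam j powr p * l j ^ ?n) * indicator {j. D j \<le> r} j) \<le>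
          (\<Sum>j. \<integral>\<^sup>+ x\<in>cube z (3 * r). ennreal (lam j powr p) * indicator (cube (c j) (l j)) x \<partial>lebesgue)"
        by (intro suminf_le) auto
      also have "\<dots> = (\<integral>\<^sup>+ x\<in>cube z (3 * r). weighted_cubes p lam c l x \<partial>lebesgue)"
        by (subst nn_integral_suminf[symmetric]) auto
      also have "\<dots> \<le> ennreal ((b * \<phi> z (3 * r)) powr p * (3 * r) ^ ?n)" using r by (intro sum_le) auto
      also have "\<dots> \<le> ennreal ((b * \<phi> z r) powr p * (3 * r) ^ ?n)"
        using r b p pos(2)[of "3 * r" z] growth_class_antimono[OF \<phi>, of r "3 * r" z]
        by (intro ennreal_leI mult_right_mono powr_mono2 mult_left_mono) auto
      finally show ?thesis .
    qed
    \<comment> \<open>The atom \<open>j\<close> is charged to the level \<open>k\<close> with \<open>2 ^ k * m \<le> D j < \<rho> k\<close>, where \<open>\<rho> k = 2 ^ (k + 1) * m\<close>.\<close>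
    define w where "w k = C1 * (\<eta> z m / \<eta> z (\<rho> k)) powr p / (2 ^ k) ^ ?n" for k :: nat
    have w0: "0 \<le> w k" for k using C1 by (simp add: w_def)
    define t where "t k j = ennreal (w k) * (ennreal (lam j powr p * l j ^ ?n) * indicator {j. D j \<le> \<rho> k} j)"
      for k j
    have term_le: "ennreal (lam j powr p) * power_integral (atom_majorant N (c j) (l j) (F j)) p (cube z m)
        \<le> (\<Sum>k. t k j)" for j
    proof -
      have "1 \<le> D j / m" using D(2)[of j] m by simp
      then obtain k :: nat where k: "2 ^ k \<le> D j / m" "D j / m < 2 ^ Suc k" by (rule dyadic_bracket)
      then have k1: "2 ^ k * m \<le> D j" "D j \<le> \<rho> k" using m by (auto simp: \<rho>_def field_simps)
      have \<eta>le: "\<eta> z m / \<eta> z (D j) \<le> \<eta> z m / \<eta> z (\<rho> k)"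
        using k1 D(1)[of j] m pos(1) \<rho>(1)[of k] growth_class_antimono[OF \<eta>(1) D(1)[of j] k1(2), of z]
        by (intro divide_left_mono mult_pos_pos) (auto intro: less_imp_le)
      have "ennreal (lam j powr p) * power_integral (atom_majorant N (c j) (l j) (F j)) p (cube z m)
          \<le> ennreal (lam j powr p) * ennreal (C1 * m ^ ?n * ((l j / D j) ^ ?n * (\<eta> z m / \<eta> z (D j)) powr p))"
        unfolding D_def by (intro mult_left_mono single atoms m) simp
      also have "\<dots> = ennreal (lam j powr p * (C1 * m ^ ?n * ((l j / D j) ^ ?n * (\<eta> z m / \<eta> z (D j)) powr p)))"
        using C1 m l[of j] D(1)[of j] by (subst ennreal_mult) auto
      also have "\<dots> \<le> ennreal (lam j powr p * (C1 * m ^ ?n * ((l j / (2 ^ k * m)) ^ ?n * (\<eta> z m / \<eta> z (\<rho> k)) powr p)))"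
      proof -
        have "(l j / D j) ^ ?n \<le> (l j / (2 ^ k * m)) ^ ?n"
          using m l[of j] D(1)[of j] k1 by (intro power_mono divide_left_mono) auto
        moreover have "(\<eta> z m / \<eta> z (D j)) powr p \<le> (\<eta> z m / \<eta> z (\<rho> k)) powr p"
          using \<eta>le p pos(1)[OF m, of z] pos(1)[OF D(1), of z j] by (intro powr_mono2) auto
        ultimately show ?thesis
          using C1 m l[of j] by (intro ennreal_leI mult_left_mono mult_mono) auto
      qed
      also have "lam j powr p * (C1 * m ^ ?n * ((l j / (2 ^ k * m)) ^ ?n * (\<eta> z m / \<eta> z (\<rho> k)) powr p))
          = w k * (lam j powr p * l j ^ ?n)"
        using m by (simp add: w_def power_divide power_mult_distrib field_simps)
      also have "ennreal \<dots> = t k j" using w0[of k] k1 l[of j] by (simp add: t_def ennreal_mult)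
      also have "\<dots> \<le> (\<Sum>k. t k j)" by (rule ennreal_term_le_suminf)
      finally show ?thesis .
    qed
    define E where "E = C1 * 6 ^ ?n * m ^ ?n * (b * \<phi> z m) powr p * (K powr p * \<theta> powr p)"
    have level_le: "(\<Sum>j. t k j) \<le> ennreal (E * (\<theta> powr p) ^ k)" for k
    proof -
      have "(\<Sum>j. t k j) = ennreal (w k) * (\<Sum>j. ennreal (lam j powr p * l j ^ ?n) * indicator {j. D j \<le> \<rho> k} j)"
        unfolding t_def by simp
      also have "\<dots> \<le> ennreal (w k) * ennreal ((b * \<phi> z (\<rho> k)) powr p * (3 * \<rho> k) ^ ?n)"
        by (intro mult_left_mono packing \<rho>) simp
      also have "\<dots> = ennreal (w k * ((b * \<phi> z (\<rho> k)) powr p * (3 * \<rho> k) ^ ?n))"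
        using w0[of k] \<rho>(1)[of k] by (subst ennreal_mult) auto
      also have "w k * ((b * \<phi> z (\<rho> k)) powr p * (3 * \<rho> k) ^ ?n) =
          C1 * 6 ^ ?n * m ^ ?n * b powr p * \<eta> z m powr p * (\<phi> z (\<rho> k) / \<eta> z (\<rho> k)) powr p"
      proof -
        define X :: real where "X = (2 ^ k) ^ ?n"
        have X0: "X \<noteq> 0" by (simp add: X_def)
        have "3 * \<rho> k = 6 * m * 2 ^ k" by (simp add: \<rho>_def)
        then have 1: "(3 * \<rho> k) ^ ?n = 6 ^ ?n * m ^ ?n * X" by (simp only: power_mult_distrib X_def)
        have 2: "(b * \<phi> z (\<rho> k)) powr p = b powr p * \<phi> z (\<rho> k) powr p" by (rule powr_mult)
        have 3: "(\<eta> z m / \<eta> z (\<rho> k)) powr p = \<eta> z m powr p / \<eta> z (\<rho> k) powr p"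
          "(\<phi> z (\<rho> k) / \<eta> z (\<rho> k)) powr p = \<phi> z (\<rho> k) powr p / \<eta> z (\<rho> k) powr p"
          by (simp_all only: powr_divide)
        show ?thesis
          unfolding w_def 1 2 3 X_def[symmetric] using X0 by simp
      qed
      also have "\<dots> \<le> C1 * 6 ^ ?n * m ^ ?n * b powr p * \<eta> z m powr p *
          (K * \<theta> ^ Suc k * (\<phi> z m / \<eta> z m)) powr p"
        unfolding \<rho>_def using C1 m p decay[OF m, of z "Suc k"] pos[of "2 ^ Suc k * m" z]
        by (intro mult_left_mono powr_mono2) auto
      also have "\<dots> = E * (\<theta> powr p) ^ k"
      proof -
        have "(\<theta> ^ Suc k) powr p = \<theta> powr p * (\<theta> powr p) ^ k"
        proof -
          have "(\<theta> ^ Suc k) powr p = (\<theta> powr real (Suc k)) powr p"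
            using \<theta> by (subst powr_realpow) auto
          also have "\<dots> = (\<theta> powr p) powr real (Suc k)" by (simp only: powr_powr mult.commute)
          also have "\<dots> = (\<theta> powr p) ^ Suc k" using \<theta> by (intro powr_realpow) auto
          finally show ?thesis by simp
        qed
        then have "(K * \<theta> ^ Suc k * (\<phi> z m / \<eta> z m)) powr p =
            K powr p * (\<theta> powr p * (\<theta> powr p) ^ k) * (\<phi> z m powr p / \<eta> z m powr p)"
          using K \<theta> pos[OF m, of z] by (simp add: powr_mult powr_divide del: power_Suc)
        moreover have "(b * \<phi> z m) powr p = b powr p * \<phi> z m powr p" by (rule powr_mult)
        moreover have "\<eta> z m powr p \<noteq> 0" using pos[OF m, of z] by simp
        ultimately show ?thesis by (simp add: E_def)
      qed
      finally show ?thesis by (simp add: ennreal_leI)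
    qed
    have "(\<integral>\<^sup>+ x\<in>cube z m. weighted_majorants N p lam c l F x \<partial>lebesgue) =
        (\<Sum>j. ennreal (lam j powr p) * power_integral (atom_majorant N (c j) (l j) (F j)) p (cube z m))"
    proof -
      have "(\<integral>\<^sup>+ x\<in>cube z m. weighted_majorants N p lam c l F x \<partial>lebesgue) =
        (\<integral>\<^sup>+ x. (\<Sum>j. ennreal (lam j powr p) *
          (ennpowr (atom_majorant N (c j) (l j) (F j) x) p * indicator (cube z m) x)) \<partial>lebesgue)"
        by (intro nn_integral_cong) (simp add: mult.assoc[symmetric])
      also have "\<dots> = (\<Sum>j. \<integral>\<^sup>+ x. ennreal (lam j powr p) *
          (ennpowr (atom_majorant N (c j) (l j) (F j) x) p * indicator (cube z m) x) \<partial>lebesgue)"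
        by (rule nn_integral_suminf) measurable
      also have "\<dots> = (\<Sum>j. ennreal (lam j powr p) * power_integral (atom_majorant N (c j) (l j) (F j)) p (cube z m))"
        by (intro suminf_cong nn_integral_cmult) measurable
      finally show ?thesis .
    qed
    also have "\<dots> \<le> (\<Sum>j. \<Sum>k. t k j)" by (intro suminf_le term_le) auto
    also have "\<dots> = (\<Sum>k. \<Sum>j. t k j)" by (rule suminf_swap_ennreal)
    also have "\<dots> \<le> (\<Sum>k. ennreal (E * (\<theta> powr p) ^ k))" by (intro suminf_le level_le) auto
    also have "\<dots> = ennreal (E * (1 / (1 - \<theta> powr p)))"
      unfolding E_def using \<theta>p C1 m by (intro suminf_ennreal_geometric) auto
    also have "\<dots> = ennreal (C * (b * \<phi> z m) powr p * m ^ ?n)" by (simp add: C_def E_def mult_ac)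
    finally show ?thesis .
  qed
  show ?thesis
  proof (intro exI conjI allI impI)
    show "0 < C" by (rule C0)
  qed (rule main; blast)
qed

section \<open>Moments and Taylor expansion\<close>

text \<open>Polynomial functions, with an upper bound for the degree. Multiplication by one coordinate at a time
  matches both the moments, where it raises one exponent, and the product rule.\<close>

inductive poly_deg :: "nat \<Rightarrow> (real ^ 'n \<Rightarrow> real) \<Rightarrow> bool" where
  const: "poly_deg m (\<lambda>_. k)"
| coord: "poly_deg m P \<Longrightarrow> poly_deg (Suc m) (\<lambda>x. x $ i * P x)"
| add: "poly_deg m P \<Longrightarrow> poly_deg m Q \<Longrightarrow> poly_deg m (\<lambda>x. P x + Q x)"

lemma poly_deg_weaken: "poly_deg m P \<Longrightarrow> m \<le> m' \<Longrightarrow> poly_deg m' P"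
proof (induction arbitrary: m' rule: poly_deg.induct)
  case (coord m P i)
  then obtain k where "m' = Suc k" "m \<le> k" by (cases m') auto
  with coord show ?case by (auto intro: poly_deg.coord)
qed (auto intro: poly_deg.intros)

lemma poly_deg_cmult: "poly_deg m P \<Longrightarrow> poly_deg m (\<lambda>x. c * P x)"
proof (induction rule: poly_deg.induct)
  case (coord m P i)
  then show ?case using poly_deg.coord[of m "\<lambda>x. c * P x" i] by (simp add: mult.left_commute)
next
  case (add m P Q)
  then show ?case using poly_deg.add[of m "\<lambda>x. c * P x" "\<lambda>x. c * Q x"] by (simp add: distrib_left)
qed (auto intro: poly_deg.intros)

lemma continuous_on_poly_deg: "poly_deg m P \<Longrightarrow> continuous_on UNIV P"
  by (induction rule: poly_deg.induct) (auto intro!: continuous_intros)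

lemma poly_deg_translated_product: "poly_deg (length is) (\<lambda>y. \<Prod>i\<leftarrow>is. (y - c) $ i)"
proof (induction "is")
  case Nil
  then show ?case by (simp add: poly_deg.const)
next
  case (Cons i js)
  let ?P = "\<lambda>y. \<Prod>i\<leftarrow>js. (y - c) $ i"
  have "poly_deg (Suc (length js)) (\<lambda>y. y $ i * ?P y + (- (c $ i)) * ?P y)"
    by (intro poly_deg.add poly_deg.coord poly_deg_cmult poly_deg_weaken[OF Cons]) (auto intro: Cons)
  then show ?case by (simp add: algebra_simps)
qed

text \<open>The part of the notion of an atom on \<open>cube c l\<close> that enters into pairings with smooth functions:
  support, mean size and vanishing moments. The constant 2 in the bound for the mean arises from
  \<open>u \<le> 1 + u powr q\<close> when the normalization is given for the power \<open>q\<close>.\<close>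

definition cancelling :: "nat \<Rightarrow> real ^ 'n \<Rightarrow> real \<Rightarrow> (real ^ 'n \<Rightarrow> complex) \<Rightarrow> bool" where
  "cancelling L c l a \<longleftrightarrow> 0 < l \<and> a \<in> borel_measurable lebesgue \<and>
     (AE y in lebesgue. y \<notin> cube c l \<longrightarrow> a y = 0) \<and>
     (\<integral>\<^sup>+ y. modulus a y \<partial>lebesgue) \<le> ennreal (2 * l ^ CARD('n)) \<and>
     (\<forall>\<alpha>. (\<Sum>i\<in>UNIV. \<alpha> i) \<le> L \<longrightarrow> (LINT x:cube c l|lebesgue. monomial \<alpha> x *\<^sub>R a x) = 0)"

lemma compact_cube: "compact (cube c l)" by (simp add: cube_def)

lemma cancelling_integrable:
  fixes a h :: "real ^ 'n \<Rightarrow> complex"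
  assumes a: "cancelling L c l a" and h: "continuous_on UNIV h"
  shows "integrable lebesgue (\<lambda>y. a y * h y)"
    and "(\<And>y. y \<in> cube c l \<Longrightarrow> cmod (h y) \<le> B) \<Longrightarrow> 0 \<le> B \<Longrightarrow>
      cmod (LINT y|lebesgue. a y * h y) \<le> 2 * l ^ CARD('n) * B"
proof -
  have l: "0 < l" and [measurable]: "a \<in> borel_measurable lebesgue"
    and supp: "AE y in lebesgue. y \<notin> cube c l \<longrightarrow> a y = 0"
    and a1: "(\<integral>\<^sup>+ y. modulus a y \<partial>lebesgue) \<le> ennreal (2 * l ^ CARD('n))"
    using a by (auto simp: cancelling_def)
  have [measurable]: "h \<in> borel_measurable lebesgue"
    using h by (intro measurable_completion) (simp add: borel_measurable_continuous_onI)
  have [measurable]: "modulus a \<in> borel_measurable lebesgue"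
    unfolding modulus_def[abs_def] by measurable
  have bound: "(\<integral>\<^sup>+ y. ennreal (cmod (a y * h y)) \<partial>lebesgue) \<le> ennreal (2 * l ^ CARD('n) * B)"
    if B: "\<And>y. y \<in> cube c l \<Longrightarrow> cmod (h y) \<le> B" "0 \<le> B" for B
  proof -
    have "(\<integral>\<^sup>+ y. ennreal (cmod (a y * h y)) \<partial>lebesgue) \<le> (\<integral>\<^sup>+ y. modulus a y * ennreal B \<partial>lebesgue)"
    proof (intro nn_integral_mono_AE, use supp in eventually_elim)
      fix y assume "y \<notin> cube c l \<longrightarrow> a y = 0"
      then have "cmod (a y * h y) \<le> cmod (a y) * B"
        using B by (cases "y \<in> cube c l") (auto simp: norm_mult intro: mult_left_mono)
      then show "ennreal (cmod (a y * h y)) \<le> modulus a y * ennreal B"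
        using B by (simp add: modulus_def ennreal_leI flip: ennreal_mult)
    qed
    also have "\<dots> = (\<integral>\<^sup>+ y. modulus a y \<partial>lebesgue) * ennreal B"
      by (rule nn_integral_multc) measurable
    also have "\<dots> \<le> ennreal (2 * l ^ CARD('n)) * ennreal B" by (intro mult_right_mono a1) simp
    also have "\<dots> = ennreal (2 * l ^ CARD('n) * B)" using l B by (subst ennreal_mult) auto
    finally show ?thesis .
  qed
  have "bounded (h ` cube c l)"
    using compact_cube h by (intro compact_imp_bounded compact_continuous_image) (auto intro: continuous_on_subset)
  then obtain B where "\<forall>y\<in>cube c l. cmod (h y) \<le> B" by (auto simp: bounded_iff)
  then have B: "\<And>y. y \<in> cube c l \<Longrightarrow> cmod (h y) \<le> max B 0" by force
  show int: "integrable lebesgue (\<lambda>y. a y * h y)"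
  proof (rule integrableI_bounded)
    show "(\<integral>\<^sup>+ y. ennreal (cmod (a y * h y)) \<partial>lebesgue) < \<infinity>"
      using bound[OF B] by (auto intro: le_less_trans)
  qed measurable
  show "cmod (LINT y|lebesgue. a y * h y) \<le> 2 * l ^ CARD('n) * B"
    if "\<And>y. y \<in> cube c l \<Longrightarrow> cmod (h y) \<le> B" "0 \<le> B" for B
  proof -
    have "ennreal (cmod (LINT y|lebesgue. a y * h y)) \<le> ennreal (2 * l ^ CARD('n) * B)"
      using integral_norm_bound_ennreal[OF int] bound[OF that] by (rule order_trans)
    then show ?thesis using that l by (subst (asm) ennreal_le_iff) auto
  qed
qed

lemma continuous_on_monomial: "continuous_on UNIV (monomial \<alpha>)"
  unfolding monomial_def[abs_def] by (intro continuous_intros)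

lemma monomial_zero: "monomial (\<lambda>_. 0) x = 1" by (simp add: monomial_def)

lemma monomial_times_coord: "monomial \<beta> x * x $ i = monomial (\<beta>(i := Suc (\<beta> i))) x"
proof -
  have "monomial (\<beta>(i := Suc (\<beta> i))) x = (\<Prod>j\<in>UNIV. (x $ j) ^ \<beta> j * (if j = i then x $ i else 1))"
    unfolding monomial_def by (intro prod.cong) auto
  also have "\<dots> = monomial \<beta> x * x $ i" by (simp add: prod.distrib monomial_def prod.delta)
  finally show ?thesis by simp
qed

text \<open>An atom annihilates all polynomials of degree at most \<open>L\<close>. The induction has to carry a monomial
  factor: multiplying the polynomial by a coordinate is absorbed into that monomial.\<close>

lemma cancelling_poly_deg:
  fixes a :: "real ^ 'n \<Rightarrow> complex"
  assumes a: "cancelling L c l a" and P: "poly_deg m P" and m: "m \<le> L"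
  shows "(LINT y|lebesgue. a y * of_real (P y)) = 0"
proof -
  have "\<forall>\<beta>. (\<Sum>i\<in>UNIV. \<beta> i) + m \<le> L \<longrightarrow>
      (LINT y|lebesgue. a y * of_real (monomial \<beta> y * P y)) = 0" using P
  proof (induction rule: poly_deg.induct)
    case (const m k)
    show ?case
    proof (intro allI impI)
      fix \<beta> :: "'n \<Rightarrow> nat" assume "(\<Sum>i\<in>UNIV. \<beta> i) + m \<le> L"
      then have "(LINT x:cube c l|lebesgue. monomial \<beta> x *\<^sub>R a x) = 0"
        using a by (simp add: cancelling_def)
      moreover have [measurable]: "monomial \<beta> \<in> borel_measurable lebesgue" "a \<in> borel_measurable lebesgue"
        using a continuous_on_monomial
        by (auto simp: cancelling_def intro!: measurable_completion borel_measurable_continuous_onI)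
      have "(LINT x:cube c l|lebesgue. monomial \<beta> x *\<^sub>R a x) = (LINT x|lebesgue. a x * of_real (monomial \<beta> x))"
        unfolding set_lebesgue_integral_def
      proof (intro integral_cong_AE)
        have "AE y in lebesgue. y \<notin> cube c l \<longrightarrow> a y = 0" using a by (simp add: cancelling_def)
        then show "AE x in lebesgue. indicat_real (cube c l) x *\<^sub>R monomial \<beta> x *\<^sub>R a x =
            a x * of_real (monomial \<beta> x)"
          by eventually_elim (auto simp: indicator_def scaleR_conv_of_real)
      qed measurable
      ultimately have "(LINT x|lebesgue. a x * of_real (monomial \<beta> x) * complex_of_real k) = 0"
        by simp
      then show "(LINT y|lebesgue. a y * of_real (monomial \<beta> y * k)) = 0"
        by (simp add: mult.assoc)
    qed
  next
    case (coord m P i)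
    show ?case
    proof (intro allI impI)
      fix \<beta> :: "'n \<Rightarrow> nat" assume \<beta>: "(\<Sum>i\<in>UNIV. \<beta> i) + Suc m \<le> L"
      have "(\<Sum>j\<in>UNIV. (\<beta>(i := Suc (\<beta> i))) j) = (\<Sum>j\<in>UNIV. \<beta> j + (if j = i then 1 else 0))"
        by (intro sum.cong) auto
      also have "\<dots> = (\<Sum>j\<in>UNIV. \<beta> j) + 1" by (simp add: sum.distrib)
      finally have "(LINT y|lebesgue. a y * of_real (monomial (\<beta>(i := Suc (\<beta> i))) y * P y)) = 0"
        using coord \<beta> by simp
      then show "(LINT y|lebesgue. a y * of_real (monomial \<beta> y * (y $ i * P y))) = 0"
        by (simp only: monomial_times_coord[symmetric] mult.assoc)
    qed
  next
    case (add m P Q)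
    show ?case
    proof (intro allI impI)
      fix \<beta> :: "'n \<Rightarrow> nat" assume \<beta>: "(\<Sum>i\<in>UNIV. \<beta> i) + m \<le> L"
      have int: "integrable lebesgue (\<lambda>y. a y * of_real (monomial \<beta> y * R y))"
        if "poly_deg m R" for R by (rule cancelling_integrable(1)[OF a])
          (intro continuous_on_of_real continuous_on_mult continuous_on_monomial continuous_on_poly_deg[OF that])
      from int[OF add.hyps(1)] int[OF add.hyps(2)]
      have "(LINT y|lebesgue. a y * of_real (monomial \<beta> y * P y) +
          a y * of_real (monomial \<beta> y * Q y)) = 0" using add.IH \<beta> by simp
      then show "(LINT y|lebesgue. a y * of_real (monomial \<beta> y * (P y + Q y))) = 0"
        by (simp add: distrib_left)
    qed
  qed
  from this[rule_format, of "\<lambda>_. 0"] m show ?thesis by (simp add: monomial_zero)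
qed

lemma partial_derivs_simps [simp]:
  "partial_derivs [] f = f"
  "partial_derivs (i # is) f = partial_deriv i (partial_derivs is f)"
  by (simp_all add: partial_derivs_def)

lemma smooth_continuous_on: "smooth g \<Longrightarrow> continuous_on UNIV (partial_derivs is g)"
  by (auto simp: smooth_def continuous_on_eq_continuous_at intro: differentiable_imp_continuous_within)

lemma finite_lists_of_length [simp]: "finite {is :: 'n::finite list. length is = k}"
  using finite_lists_length_eq[of "UNIV :: 'n set" k] by simp

lemma sum_lists_Suc:
  "(\<Sum>is | length is = Suc k. f is) = (\<Sum>is | length is = k. \<Sum>i\<in>UNIV. f (i # is))"
  for f :: "'n::finite list \<Rightarrow> 'a::comm_monoid_add"
proof -
  have "(\<Sum>is | length is = Suc k. f is) = (\<Sum>(is, i)\<in>{is. length is = k} \<times> UNIV. f (i # is))"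
    by (rule sum.reindex_bij_witness[where i = "\<lambda>(is, i). i # is" and j = "\<lambda>is. (tl is, hd is)"])
      (auto simp: length_Suc_conv)
  then show ?thesis by (simp add: sum.cartesian_product)
qed

text \<open>The \<open>k\<close>-th derivative of \<open>g\<close> at \<open>z\<close> in the direction \<open>h\<close>, expanded in iterated partial derivatives.\<close>

definition directional_derivs :: "(real ^ 'n \<Rightarrow> complex) \<Rightarrow> real ^ 'n \<Rightarrow> nat \<Rightarrow> real ^ 'n \<Rightarrow> complex" where
  "directional_derivs g h k z = (\<Sum>is | length is = k. (\<Prod>i\<leftarrow>is. h $ i) *\<^sub>R partial_derivs is g z)"

lemma has_vector_derivative_along_line:
  fixes F :: "real ^ 'n \<Rightarrow> complex"
  assumes "F differentiable (at (c + t *\<^sub>R h))"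
  shows "((\<lambda>t. F (c + t *\<^sub>R h)) has_vector_derivative (\<Sum>i\<in>UNIV. h $ i *\<^sub>R partial_deriv i F (c + t *\<^sub>R h)))
    (at t within S)"
proof -
  let ?F' = "frechet_derivative F (at (c + t *\<^sub>R h))"
  have F: "(F has_derivative ?F') (at (c + t *\<^sub>R h))"
    using assms by (simp add: frechet_derivative_works)
  then have lin: "linear ?F'" by (rule has_derivative_linear)
  have line: "((\<lambda>t. c + t *\<^sub>R h) has_derivative (\<lambda>s. s *\<^sub>R h)) (at t within S)"
    by (auto intro!: derivative_eq_intros)
  have "((\<lambda>t. F (c + t *\<^sub>R h)) has_derivative (\<lambda>s. ?F' (s *\<^sub>R h))) (at t within S)"
    by (rule has_derivative_compose[OF line F])
  moreover have "?F' h = (\<Sum>i\<in>UNIV. h $ i *\<^sub>R partial_deriv i F (c + t *\<^sub>R h))"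
  proof -
    have "?F' h = ?F' (\<Sum>i\<in>UNIV. h $ i *\<^sub>R axis i 1)"
      using basis_expansion[of h] by (simp add: scalar_mult_eq_scaleR)
    also have "\<dots> = (\<Sum>i\<in>UNIV. h $ i *\<^sub>R ?F' (axis i 1))"
      by (simp add: linear_sum[OF lin] linear_scale[OF lin])
    finally show ?thesis by (simp add: partial_deriv_def)
  qed
  ultimately show ?thesis by (simp add: has_vector_derivative_def linear_scale[OF lin])
qed

text \<open>Taylor's formula with integral remainder in one variable, along the segment from \<open>c\<close> to \<open>y\<close>. The powers
  of the dimension count the lists of directions.\<close>

lemma taylor_remainder_bound:
  fixes g :: "real ^ 'n \<Rightarrow> complex"
  assumes g: "smooth g" and B: "0 \<le> B"
    and bound: "\<And>t is. 0 \<le> t \<Longrightarrow> t \<le> 1 \<Longrightarrow> length is = Suc L \<Longrightarrow>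
      cmod (partial_derivs is g (c + t *\<^sub>R (y - c))) \<le> B"
  shows "cmod (g y - (\<Sum>k<Suc L. (1 / fact k) *\<^sub>R directional_derivs g (y - c) k c))
    \<le> real CARD('n) ^ Suc L * norm (y - c) ^ Suc L * B"
proof -
  let ?h = "y - c"
  define Df where "Df k t = directional_derivs g ?h k (c + t *\<^sub>R ?h)" for k and t :: real
  have Df: "(Df k has_vector_derivative Df (Suc k) t) (at t within {0..1})" for k t
  proof -
    have "((\<lambda>t. \<Sum>is | length is = k. (\<Prod>i\<leftarrow>is. ?h $ i) *\<^sub>R partial_derivs is g (c + t *\<^sub>R ?h))
        has_vector_derivative (\<Sum>is | length is = k. (\<Prod>i\<leftarrow>is. ?h $ i) *\<^sub>R
          (\<Sum>i\<in>UNIV. ?h $ i *\<^sub>R partial_deriv i (partial_derivs is g) (c + t *\<^sub>R ?h)))) (at t within {0..1})"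
    proof (intro has_vector_derivative_sum)
      fix "is" :: "'n list"
      have "partial_derivs is g differentiable (at (c + t *\<^sub>R ?h))" using g by (simp add: smooth_def)
      from has_vector_derivative_along_line[OF this]
      show "((\<lambda>t. (\<Prod>i\<leftarrow>is. ?h $ i) *\<^sub>R partial_derivs is g (c + t *\<^sub>R ?h)) has_vector_derivative
          (\<Prod>i\<leftarrow>is. ?h $ i) *\<^sub>R (\<Sum>i\<in>UNIV. ?h $ i *\<^sub>R partial_deriv i (partial_derivs is g) (c + t *\<^sub>R ?h)))
          (at t within {0..1})"
        by (intro bounded_linear.has_vector_derivative[OF bounded_linear_scaleR_right])
    qed
    then show ?thesis
      unfolding Df_def[abs_def] directional_derivs_def sum_lists_Suc
      by (simp add: scaleR_sum_right mult.commute del: vector_minus_component)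
  qed
  have card: "card {is :: 'n list. length is = k} = CARD('n) ^ k" for k
    using card_lists_length_eq[of "UNIV :: 'n set" k] by simp
  have prod_le: "\<bar>\<Prod>i\<leftarrow>is. ?h $ i\<bar> \<le> norm ?h ^ length is" for "is" :: "'n list"
  proof (induction "is")
    case (Cons i js)
    then show ?case using component_le_norm_cart[of ?h i] by (simp add: abs_mult mult_mono)
  qed simp
  have Df_le: "norm (((1 - t) ^ L / fact L) *\<^sub>R Df (Suc L) t) \<le> real CARD('n) ^ Suc L * norm ?h ^ Suc L * B"
    if t: "t \<in> {0..1}" for t
  proof -
    have "norm (((1 - t) ^ L / fact L) *\<^sub>R Df (Suc L) t) \<le> 1 * norm (Df (Suc L) t)"
    proof -
      have "(1 - t) ^ L \<le> 1" using t by (intro power_le_one) auto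
      moreover have "(1::real) \<le> fact L" by (rule fact_ge_1)
      ultimately have "(1 - t) ^ L \<le> fact L" by linarith
      then have "(1 - t) ^ L / fact L \<le> 1" by (simp add: divide_le_eq_1)
      then show ?thesis using t unfolding norm_scaleR by (intro mult_right_mono) auto
    qed
    also have "norm (Df (Suc L) t) \<le> (\<Sum>is | length (is :: 'n list) = Suc L. norm ?h ^ Suc L * B)"
      unfolding Df_def directional_derivs_def
    proof (rule sum_norm_le)
      fix js :: "'n list" assume "js \<in> {is. length is = Suc L}"
      then have len: "length js = Suc L" by simp
      have "\<bar>\<Prod>i\<leftarrow>js. ?h $ i\<bar> * cmod (partial_derivs js g (c + t *\<^sub>R ?h)) \<le> norm ?h ^ Suc L * B"
        using prod_le[of js] bound[OF _ _ len, of t] t B unfolding len by (intro mult_mono) auto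
      then show "norm ((\<Prod>i\<leftarrow>js. ?h $ i) *\<^sub>R partial_derivs js g (c + t *\<^sub>R ?h)) \<le> norm ?h ^ Suc L * B"
        by simp
    qed
    finally show ?thesis by (simp add: card mult_ac)
  qed
  have "((\<lambda>t. ((1 - t) ^ (Suc L - 1) / fact (Suc L - 1)) *\<^sub>R Df (Suc L) t) has_integral
      Df 0 1 - (\<Sum>k<Suc L. ((1 - 0) ^ k / fact k) *\<^sub>R Df k 0)) {0..1}"
    by (rule Taylor_has_integral) (use Df in auto)
  then have "norm (Df 0 1 - (\<Sum>k<Suc L. ((1 - 0) ^ k / fact k) *\<^sub>R Df k 0)) \<le>
      real CARD('n) ^ Suc L * norm ?h ^ Suc L * B * measure lborel {0..1::real}"
    using B Df_le by (intro has_integral_bound_real[where S = "{}"]) auto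
  then show ?thesis by (simp add: Df_def directional_derivs_def)
qed

section \<open>Pairing an atom with a smooth kernel\<close>

text \<open>Smooth kernels adapted to the point \<open>x\<close> and the scale \<open>s\<close>. Both bounds are invariant under
  \<open>g y \<mapsto> s powr (- n) * g (x + (y - x) / s)\<close>, so one constant serves all dilates of one
  Schwartz function. The second bound contains no \<open>s\<close>: away from \<open>x\<close> the derivatives of
  order \<open>L + 1\<close> are controlled by the distance alone.\<close>

definition test_kernel :: "nat \<Rightarrow> real ^ 'n \<Rightarrow> real \<Rightarrow> real \<Rightarrow> (real ^ 'n \<Rightarrow> complex) \<Rightarrow> bool" where
  "test_kernel L x s A g \<longleftrightarrow> smooth g \<and> 0 < s \<and> 0 \<le> A \<and>
     (\<forall>y. cmod (g y) * (s + norm (y - x)) ^ (CARD('n) + 1) \<le> A * s) \<and>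
     (\<forall>y is. length is = Suc L \<longrightarrow>
        cmod (partial_derivs is g y) * norm (y - x) ^ (CARD('n) + Suc L) \<le> A)"

text \<open>The kernel is dominated by a convergent combination of normalized indicators of balls of radii
  \<open>2 ^ k * s\<close> around \<open>x\<close>, whose coefficients decay like \<open>2 powr (- k)\<close>.\<close>

lemma pairing_le_maximal:
  fixes a g :: "real ^ 'n \<Rightarrow> complex"
  assumes [measurable]: "a \<in> borel_measurable lebesgue" "g \<in> borel_measurable lebesgue"
    and s: "0 < s" and A: "0 \<le> A"
    and g: "\<And>y. cmod (g y) * (s + norm (y - x)) ^ (CARD('n) + 1) \<le> A * s"
  shows "(\<integral>\<^sup>+ y. ennreal (cmod (a y * g y)) \<partial>lebesgue) \<le> ennreal (2 ^ (CARD('n) + 1) * A) * maximal (modulus a) x"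
proof -
  let ?n = "CARD('n)"
  have [measurable]: "modulus a \<in> borel_measurable lebesgue"
    unfolding modulus_def[abs_def] by measurable
  define r where "r k = 2 ^ Suc k * s" for k :: nat
  have r: "0 < r k" for k using s by (simp add: r_def)
  define w where "w k = 2 ^ (?n + 1) * A * (1 / 2) ^ Suc k * (1 / r k ^ ?n)" for k
  have w: "0 \<le> w k" for k using A r[of k] by (simp add: w_def)
  have g_le: "ennreal (cmod (g y)) \<le> (\<Sum>k. ennreal (w k) * indicator (cball x (r k)) y)" for y
  proof -
    \<comment> \<open>The shift by 1 treats the central ball and the annuli at once.\<close>
    let ?v = "1 + norm (y - x) / s"
    have "1 \<le> ?v" using s by simp
    then obtain k :: nat where k: "2 ^ k \<le> ?v" "?v < 2 ^ Suc k" by (rule dyadic_bracket)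
    then have "norm (y - x) / s \<le> 2 ^ Suc k" by simp
    then have y: "norm (y - x) \<le> r k" using s by (simp add: r_def divide_le_eq)
    have "2 ^ k * s \<le> ?v * s" using k s by (intro mult_right_mono) auto
    also have "?v * s = s + norm (y - x)" using s by (simp add: field_simps)
    finally have sk: "2 ^ k * s \<le> s + norm (y - x)" .
    have "cmod (g y) * (2 ^ k * s) ^ (?n + 1) \<le> cmod (g y) * (s + norm (y - x)) ^ (?n + 1)"
      using sk s by (intro mult_left_mono power_mono) auto
    also have "\<dots> \<le> A * s" by (rule g)
    finally have "cmod (g y) \<le> A * s / (2 ^ k * s) ^ (?n + 1)" using s by (simp add: le_divide_eq)
    also have "\<dots> = w k"
    proof -
      define X :: real where "X = 2 ^ k"
      have X: "X \<noteq> 0" by (simp add: X_def)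
      show ?thesis using s X unfolding w_def r_def power_Suc X_def[symmetric] power_one_over
        by (simp add: field_simps)
    qed
    finally have "ennreal (cmod (g y)) \<le> ennreal (w k) * indicator (cball x (r k)) y"
      using y by (simp add: dist_norm norm_minus_commute ennreal_leI)
    also have "\<dots> \<le> (\<Sum>k. ennreal (w k) * indicator (cball x (r k)) y)"
      by (rule ennreal_term_le_suminf)
    finally show ?thesis .
  qed
  have "(\<integral>\<^sup>+ y. ennreal (cmod (a y * g y)) \<partial>lebesgue)
      \<le> (\<integral>\<^sup>+ y. (\<Sum>k. ennreal (w k) * (modulus a y * indicator (cball x (r k)) y)) \<partial>lebesgue)"
  proof (intro nn_integral_mono)
    fix y
    have "ennreal (cmod (a y * g y)) = modulus a y * ennreal (cmod (g y))"
      by (simp add: modulus_def norm_mult ennreal_mult)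
    also have "\<dots> \<le> modulus a y * (\<Sum>k. ennreal (w k) * indicator (cball x (r k)) y)"
      by (intro mult_left_mono g_le) simp
    also have "\<dots> = (\<Sum>k. modulus a y * (ennreal (w k) * indicator (cball x (r k)) y))"
      by (rule ennreal_suminf_cmult[symmetric])
    finally show "ennreal (cmod (a y * g y)) \<le> (\<Sum>k. ennreal (w k) * (modulus a y * indicator (cball x (r k)) y))"
      by (simp only: mult.left_commute)
  qed
  also have "\<dots> = (\<Sum>k. \<integral>\<^sup>+ y. ennreal (w k) * (modulus a y * indicator (cball x (r k)) y) \<partial>lebesgue)"
    by (rule nn_integral_suminf) measurable
  also have "\<dots> = (\<Sum>k. ennreal (w k) * ball_integral (modulus a) x (r k))"
    by (intro suminf_cong nn_integral_cmult) measurable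
  also have "\<dots> \<le> (\<Sum>k. ennreal (2 ^ (?n + 1) * A * (1 / 2) ^ Suc k) * maximal (modulus a) x)"
  proof (intro suminf_le)
    fix k
    have "ennreal (w k) * ball_integral (modulus a) x (r k) =
        ennreal (2 ^ (?n + 1) * A * (1 / 2) ^ Suc k) *
          (ennreal (1 / r k ^ ?n) * ball_integral (modulus a) x (r k))"
      unfolding w_def using A r[of k] by (subst ennreal_mult) (auto simp: mult.assoc)
    also have "\<dots> \<le> ennreal (2 ^ (?n + 1) * A * (1 / 2) ^ Suc k) * maximal (modulus a) x"
      unfolding maximal_def using r[of k] by (intro mult_left_mono SUP_upper) auto
    finally show "ennreal (w k) * ball_integral (modulus a) x (r k)
        \<le> ennreal (2 ^ (?n + 1) * A * (1 / 2) ^ Suc k) * maximal (modulus a) x" .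
  qed auto
  also have "\<dots> = (\<Sum>k. ennreal (2 ^ (?n + 1) * A * (1 / 2) ^ Suc k)) * maximal (modulus a) x"
    by (rule ennreal_suminf_multc)
  also have "(\<Sum>k. ennreal (2 ^ (?n + 1) * A * (1 / 2) ^ Suc k)) = ennreal (2 ^ (?n + 1) * A * 1)"
  proof -
    have "(\<lambda>k. 2 ^ (?n + 1) * A * (1 / 2) ^ Suc k) sums (2 ^ (?n + 1) * A * 1)"
      by (intro sums_mult power_half_series)
    then show ?thesis using A by (subst suminf_ennreal_eq) auto
  qed
  finally show ?thesis by simp
qed

text \<open>Near the cube only the size of the kernel is used. Far away the Taylor polynomial of degree \<open>L\<close> at
  the centre is annihilated by the atom, and the remainder gains \<open>l ^ (L + 1)\<close> against derivatives
  of order \<open>L + 1\<close>, which on the cube are of size \<open>A / \<bar>x - c\<bar> ^ (n + L + 1)\<close>; the remaining factor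
  \<open>l ^ n\<close> is the mean size of the atom.\<close>

theorem pairing_le_atom_majorant:
  fixes a g :: "real ^ 'n \<Rightarrow> complex"
  assumes a: "cancelling L c l a" and g: "test_kernel L x s A g"
  shows "ennreal (cmod (LINT y|lebesgue. a y * g y)) \<le>
    ennreal (2 ^ (CARD('n) + Suc L + 1) * real CARD('n) ^ (2 * Suc L) * A) *
      atom_majorant (CARD('n) + Suc L) c l (modulus a) x"
proof -
  let ?n = "CARD('n)"
  let ?N = "?n + Suc L"
  let ?K = "2 ^ (?N + 1) * real ?n ^ (2 * Suc L)"
  have n1: "1 \<le> real ?n" by (simp add: Suc_leI)
  have l: "0 < l" and a_meas: "a \<in> borel_measurable lebesgue" using a by (auto simp: cancelling_def)
  have smooth: "smooth g" and s: "0 < s" and A: "0 \<le> A"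
    and g0: "\<And>y. cmod (g y) * (s + norm (y - x)) ^ (?n + 1) \<le> A * s"
    and gL: "\<And>y is. length is = Suc L \<Longrightarrow> cmod (partial_derivs is g y) * norm (y - x) ^ ?N \<le> A"
    using g by (auto simp: test_kernel_def)
  have g_cont: "continuous_on UNIV g" using smooth_continuous_on[OF smooth, of "[]"] by simp
  show ?thesis
  proof (cases "norm (x - c) < real ?n * l")
    case True
    have g_meas: "g \<in> borel_measurable lebesgue"
      using g_cont by (intro measurable_completion) (simp add: borel_measurable_continuous_onI)
    have "ennreal (cmod (LINT y|lebesgue. a y * g y)) \<le> (\<integral>\<^sup>+ y. ennreal (cmod (a y * g y)) \<partial>lebesgue)"
      by (intro integral_norm_bound_ennreal cancelling_integrable(1)[OF a g_cont])
    also have "\<dots> \<le> ennreal (2 ^ (?n + 1) * A) * maximal (modulus a) x"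
      by (rule pairing_le_maximal[OF a_meas g_meas s A g0])
    also have "\<dots> \<le> ennreal (?K * A) * maximal (modulus a) x"
    proof (rule mult_right_mono, rule ennreal_leI)
      have "2 ^ (?n + 1) * 1 \<le> 2 ^ (?N + 1) * real ?n ^ (2 * Suc L)"
        using n1 by (intro mult_mono power_increasing one_le_power) auto
      then show "2 ^ (?n + 1) * A \<le> ?K * A" using A by (intro mult_right_mono) auto
    qed simp
    finally show ?thesis using True by (simp add: atom_majorant_def)
  next
    case False
    let ?\<rho> = "norm (x - c)"
    have "1 * l \<le> real ?n * l" using n1 l by (intro mult_right_mono) auto
    then have \<rho>: "0 < ?\<rho>" using False l by linarith
    define T where "T y = (\<Sum>k<Suc L. (1 / fact k) *\<^sub>R directional_derivs g (y - c) k c)" for y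
    define B where "B = A * 2 ^ ?N / ?\<rho> ^ ?N"
    have B: "0 \<le> B" using A by (simp add: B_def)
    have near: "cmod (g y - T y) \<le> real ?n ^ Suc L * (real ?n * l) ^ Suc L * B" if y: "y \<in> cube c l" for y
    proof -
      have yc: "norm (y - c) \<le> real ?n * l / 2" using y by (rule norm_le_of_mem_cube)
      have "cmod (g y - T y) \<le> real ?n ^ Suc L * norm (y - c) ^ Suc L * B"
        unfolding T_def
      proof (rule taylor_remainder_bound[OF smooth B])
        fix t :: real and js :: "'n list"
        assume t: "0 \<le> t" "t \<le> 1" and js: "length js = Suc L"
        let ?z = "c + t *\<^sub>R (y - c)"
        have "norm (t *\<^sub>R (y - c)) \<le> 1 * norm (y - c)"
          using t unfolding norm_scaleR by (intro mult_right_mono) auto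
        moreover have "norm (x - c) \<le> norm (?z - x) + norm (t *\<^sub>R (y - c))"
          using norm_triangle_ineq[of "x - ?z" "t *\<^sub>R (y - c)"] by (simp add: norm_minus_commute)
        \<comment> \<open>The whole segment stays at distance at least \<open>\<bar>x - c\<bar> / 2\<close> from \<open>x\<close>.\<close>
        ultimately have z: "?\<rho> / 2 \<le> norm (?z - x)" using yc False by linarith
        have "cmod (partial_derivs js g ?z) * (?\<rho> / 2) ^ ?N \<le> cmod (partial_derivs js g ?z) * norm (?z - x) ^ ?N"
          using z by (intro mult_left_mono power_mono) auto
        also have "\<dots> \<le> A" using js by (rule gL)
        finally show "cmod (partial_derivs js g ?z) \<le> B"
          using \<rho> by (simp add: B_def power_divide field_simps)
      qed
      also have "\<dots> \<le> real ?n ^ Suc L * (real ?n * l) ^ Suc L * B"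
      proof -
        have "0 \<le> real ?n * l" using l by simp
        then have "norm (y - c) \<le> real ?n * l" using yc by linarith
        then show ?thesis using B by (intro mult_right_mono mult_left_mono power_mono) auto
      qed
      finally show ?thesis .
    qed
    have T_eq: "T y = (\<Sum>k<Suc L. \<Sum>is | length is = k. complex_of_real (\<Prod>i\<leftarrow>is. (y - c) $ i) *
        ((1 / fact k) *\<^sub>R partial_derivs is g c))" for y
      unfolding T_def directional_derivs_def scaleR_sum_right
      by (intro sum.cong refl) (simp add: scaleR_conv_of_real del: vector_minus_component)
    have cont: "continuous_on UNIV (\<lambda>y. complex_of_real (\<Prod>i\<leftarrow>is. (y - c) $ i))" for "is" :: "'n list"
      by (intro continuous_on_of_real continuous_on_poly_deg[OF poly_deg_translated_product])
    have T_cont: "continuous_on UNIV T"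
      unfolding T_eq[abs_def] by (intro continuous_intros cont)
    have T_zero: "(LINT y|lebesgue. a y * T y) = 0"
    proof -
      have "(LINT y|lebesgue. a y * T y) = (LINT y|lebesgue. (\<Sum>k<Suc L. \<Sum>is | length is = k.
          (a y * of_real (\<Prod>i\<leftarrow>is. (y - c) $ i)) * ((1 / fact k) *\<^sub>R partial_derivs is g c)))"
        unfolding T_eq by (simp only: sum_distrib_left mult.assoc)
      also have "\<dots> = (\<Sum>k<Suc L. \<Sum>is | length is = k. (LINT y|lebesgue.
          a y * of_real (\<Prod>i\<leftarrow>is. (y - c) $ i)) * ((1 / fact k) *\<^sub>R partial_derivs is g c))"
        using cancelling_integrable(1)[OF a cont] by simp
      also have "\<dots> = 0"
      proof (intro sum.neutral ballI)
        fix k and js :: "'n list" assume "k \<in> {..<Suc L}" "js \<in> {is. length is = k}"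
        then have "length js \<le> L" by simp
        from cancelling_poly_deg[OF a poly_deg_translated_product this]
        show "(LINT y|lebesgue. a y * of_real (\<Prod>i\<leftarrow>js. (y - c) $ i)) * ((1 / fact k) *\<^sub>R partial_derivs js g c) = 0"
          by simp
      qed
      finally show ?thesis .
    qed
    have "(LINT y|lebesgue. a y * g y) = (LINT y|lebesgue. a y * (g y - T y))"
      using cancelling_integrable(1)[OF a g_cont] cancelling_integrable(1)[OF a T_cont] T_zero
      by (simp add: right_diff_distrib)
    then have "cmod (LINT y|lebesgue. a y * g y) \<le> 2 * l ^ ?n * (real ?n ^ Suc L * (real ?n * l) ^ Suc L * B)"
      using cancelling_integrable(2)[OF a continuous_on_diff[OF g_cont T_cont] near] l B by simp
    also have "\<dots> = ?K * A * (l / ?\<rho>) ^ ?N"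
    proof -
      have 1: "(real ?n * l) ^ Suc L = real ?n ^ Suc L * l ^ Suc L" by (rule power_mult_distrib)
      have 2: "real ?n ^ (2 * Suc L) = real ?n ^ Suc L * real ?n ^ Suc L" by (simp only: mult_2 power_add)
      have 3: "(l / ?\<rho>) ^ ?N = l ^ ?n * l ^ Suc L / ?\<rho> ^ ?N" 
        by (simp only: power_divide power_add[of l])
      have 4: "(2::real) ^ (?N + 1) = 2 * 2 ^ ?N" by simp
      show ?thesis unfolding 1 2 3 4 B_def by (simp only: times_divide_eq_right times_divide_eq_left mult_ac)
    qed
    finally have "ennreal (cmod (LINT y|lebesgue. a y * g y)) \<le> ennreal (?K * A * (l / ?\<rho>) ^ ?N)"
      by (rule ennreal_leI)
    also have "\<dots> = ennreal (?K * A) * ennreal ((l / ?\<rho>) ^ ?N)"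
      using A l by (subst ennreal_mult) auto
    finally show ?thesis using False by (simp add: atom_majorant_def)
  qed
qed

section \<open>The heat kernel\<close>

lemma poly_deg_has_derivative:
  fixes P :: "real ^ 'n \<Rightarrow> real"
  assumes "poly_deg m P"
  shows "\<exists>P'. poly_deg m P' \<and> (\<forall>z. \<exists>D. (P has_derivative D) (at z) \<and> D (axis i 1) = P' z)"
  using assms
proof (induction rule: poly_deg.induct)
  case (const m k)
  show ?case
    by (intro exI[of _ "\<lambda>_. 0"] conjI allI exI[of _ "\<lambda>_. 0"]) (auto intro: poly_deg.const)
next
  case (coord m P j)
  then obtain P' where P': "poly_deg m P'" "\<And>z. \<exists>D. (P has_derivative D) (at z) \<and> D (axis i 1) = P' z" by blast
  show ?case
  proof (rule exI, intro conjI allI)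
    show "poly_deg (Suc m) (\<lambda>z. (if j = i then 1 else 0) * P z + z $ j * P' z)"
      using coord P' by (intro poly_deg.add poly_deg.coord poly_deg_cmult) (auto intro: poly_deg_weaken)
    fix z
    obtain D where D: "(P has_derivative D) (at z)" "D (axis i 1) = P' z" using P' by blast
    have "((\<lambda>z. z $ j) has_derivative (\<lambda>v. v $ j)) (at z)"
      by (rule bounded_linear_imp_has_derivative[OF bounded_linear_vec_nth])
    from has_derivative_mult[OF this D(1)]
    have "((\<lambda>z. z $ j * P z) has_derivative (\<lambda>v. z $ j * D v + v $ j * P z)) (at z)" .
    moreover have "z $ j * D (axis i 1) + axis i 1 $ j * P z = (if j = i then 1 else 0) * P z + z $ j * P' z"
      unfolding D(2) by (simp add: axis_def)
    ultimately show "\<exists>D. ((\<lambda>z. z $ j * P z) has_derivative D) (at z) \<and>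
        D (axis i 1) = (if j = i then 1 else 0) * P z + z $ j * P' z" by blast
  qed
next
  case (add m P Q)
  then obtain P' Q' where P': "poly_deg m P'" "\<And>z. \<exists>D. (P has_derivative D) (at z) \<and> D (axis i 1) = P' z"
    and Q': "poly_deg m Q'" "\<And>z. \<exists>D. (Q has_derivative D) (at z) \<and> D (axis i 1) = Q' z" by blast
  show ?case
  proof (rule exI, intro conjI allI)
    show "poly_deg m (\<lambda>z. P' z + Q' z)" using P' Q' by (intro poly_deg.add)
    fix z
    obtain D E where D: "(P has_derivative D) (at z)" "D (axis i 1) = P' z"
      and E: "(Q has_derivative E) (at z)" "E (axis i 1) = Q' z" using P' Q' by blast
    have "((\<lambda>z. P z + Q z) has_derivative (\<lambda>v. D v + E v)) (at z)"
      using D E by (intro has_derivative_add)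
    moreover have "D (axis i 1) + E (axis i 1) = P' z + Q' z" by (simp add: D E)
    ultimately show "\<exists>D. ((\<lambda>z. P z + Q z) has_derivative D) (at z) \<and> D (axis i 1) = P' z + Q' z" by blast
  qed
qed

lemma poly_deg_bound:
  fixes P :: "real ^ 'n \<Rightarrow> real"
  assumes "poly_deg m P"
  shows "\<exists>K\<ge>0. \<forall>z. \<bar>P z\<bar> \<le> K * (1 + norm z) ^ m" using assms
proof (induction rule: poly_deg.induct)
  case (const m k)
  have "\<bar>k\<bar> * 1 \<le> \<bar>k\<bar> * (1 + norm z) ^ m" for z :: "real ^ 'n"
    by (intro mult_left_mono one_le_power) auto
  then show ?case by (intro exI[of _ "\<bar>k\<bar>"]) auto
next
  case (coord m P i)
  then obtain K where K: "0 \<le> K" "\<And>z. \<bar>P z\<bar> \<le> K * (1 + norm z) ^ m" by blast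
  have "\<bar>z $ i * P z\<bar> \<le> K * (1 + norm z) ^ Suc m" for z
  proof -
    have "\<bar>z $ i\<bar> * \<bar>P z\<bar> \<le> (1 + norm z) * (K * (1 + norm z) ^ m)"
      using component_le_norm_cart[of z i] K by (intro mult_mono) auto
    then show ?thesis by (simp add: abs_mult mult_ac)
  qed
  with K show ?case by blast
next
  case (add m P Q)
  then obtain K K' where K: "0 \<le> K" "\<And>z. \<bar>P z\<bar> \<le> K * (1 + norm z) ^ m"
    "0 \<le> K'" "\<And>z. \<bar>Q z\<bar> \<le> K' * (1 + norm z) ^ m" by blast
  have "\<bar>P z + Q z\<bar> \<le> (K + K') * (1 + norm z) ^ m" for z
    using K(2,4)[of z] by (auto simp: distrib_right intro: order_trans[OF abs_triangle_ineq])
  with K show ?case by (intro exI[of _ "K + K'"]) auto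
qed

text \<open>This class contains the heat kernel at time 1, is closed under partial derivatives and consists of rapidly
  decreasing functions.\<close>

definition poly_gaussian :: "(real ^ 'n \<Rightarrow> complex) \<Rightarrow> bool" where
  "poly_gaussian f \<longleftrightarrow> (\<exists>m P. poly_deg m P \<and> f = (\<lambda>z. complex_of_real (P z * exp (- (norm z)\<^sup>2 / 4))))"

lemma poly_gaussian_partial_deriv:
  fixes f :: "real ^ 'n \<Rightarrow> complex"
  assumes "poly_gaussian f"
  shows "f differentiable (at z)" "poly_gaussian (partial_deriv i f)"
proof -
  obtain m P where P: "poly_deg m P" and f: "f = (\<lambda>z. complex_of_real (P z * exp (- (norm z)\<^sup>2 / 4)))"
    using assms by (auto simp: poly_gaussian_def)
  obtain P' where P': "poly_deg m P'" "\<And>z. \<exists>D. (P has_derivative D) (at z) \<and> D (axis i 1) = P' z"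
    using poly_deg_has_derivative[OF P] by blast
  have der: "f differentiable (at z) \<and>
    partial_deriv i f z = complex_of_real ((P' z + z $ i * (- 1 / 2 * P z)) * exp (- (norm z)\<^sup>2 / 4))" for z
  proof -
    obtain D where D: "(P has_derivative D) (at z)" "D (axis i 1) = P' z" using P' by blast
    let ?e = "exp ((- 1 / 4) * (z \<bullet> z))"
    have "((\<lambda>z. (- 1 / 4) * (z \<bullet> z)) has_derivative (\<lambda>v. (- 1 / 4) * (z \<bullet> v + v \<bullet> z))) (at z)"
      by (intro has_derivative_mult_right has_derivative_inner has_derivative_ident)
    then have e: "((\<lambda>z. exp ((- 1 / 4) * (z \<bullet> z))) has_derivative
        (\<lambda>v. (- 1 / 4) * (z \<bullet> v + v \<bullet> z) * ?e)) (at z)" by (rule has_derivative_exp)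
    have "((\<lambda>z. complex_of_real (P z * exp ((- 1 / 4) * (z \<bullet> z)))) has_derivative
        (\<lambda>v. complex_of_real (P z * ((- 1 / 4) * (z \<bullet> v + v \<bullet> z) * ?e) + D v * ?e))) (at z)"
      by (intro has_derivative_of_real has_derivative_mult D e)
    then have F: "(f has_derivative
        (\<lambda>v. complex_of_real (P z * ((- 1 / 4) * (z \<bullet> v + v \<bullet> z) * ?e) + D v * ?e))) (at z)"
      by (simp add: f power2_norm_eq_inner)
    have "z \<bullet> axis i 1 = z $ i" "axis i 1 \<bullet> z = z $ i" by (simp_all add: inner_axis inner_axis')
    then have "partial_deriv i f z = complex_of_real ((P' z + z $ i * (- 1 / 2 * P z)) * exp (- (norm z)\<^sup>2 / 4))"
      unfolding partial_deriv_def frechet_derivative_at[OF F, symmetric] D(2) power2_norm_eq_inner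
      by (intro arg_cong[where f = complex_of_real]) (simp add: algebra_simps)
    with F show ?thesis by (auto simp: differentiable_def)
  qed
  then show "f differentiable (at z)" by blast
  have "poly_deg (Suc m) (\<lambda>z. P' z + z $ i * (- 1 / 2 * P z))"
    using P P' by (intro poly_deg.add poly_deg.coord poly_deg_cmult) (auto intro: poly_deg_weaken)
  moreover have "partial_deriv i f = (\<lambda>z. complex_of_real ((P' z + z $ i * (- 1 / 2 * P z)) * exp (- (norm z)\<^sup>2 / 4)))"
    using der by blast
  ultimately show "poly_gaussian (partial_deriv i f)"
    unfolding poly_gaussian_def by blast
qed

lemma poly_gaussian_partial_derivs: "poly_gaussian f \<Longrightarrow> poly_gaussian (partial_derivs is f)"
  by (induction "is") (auto intro: poly_gaussian_partial_deriv)

lemma smooth_poly_gaussian: "poly_gaussian f \<Longrightarrow> smooth f"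
  unfolding smooth_def by (auto intro: poly_gaussian_partial_deriv poly_gaussian_partial_derivs)

lemma poly_gaussian_decay:
  assumes "poly_gaussian f"
  shows "\<exists>B\<ge>0. \<forall>z. cmod (f z) * (1 + norm z) ^ M \<le> B"
proof -
  obtain m P where P: "poly_deg m P" and f: "f = (\<lambda>z. complex_of_real (P z * exp (- (norm z)\<^sup>2 / 4)))"
    using assms by (auto simp: poly_gaussian_def)
  obtain K where K: "0 \<le> K" "\<And>z. \<bar>P z\<bar> \<le> K * (1 + norm z) ^ m" using poly_deg_bound[OF P] by blast
  have "cmod (f z) * (1 + norm z) ^ M \<le> K * (fact (m + M) * exp 2)" for z
  proof -
    let ?r = "norm z"
    have "(1 + ?r) ^ (m + M) / fact (m + M) \<le> (\<Sum>k. (1 + ?r) ^ k / fact k)"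
      using sum_le_suminf[OF summable_exp[of "1 + ?r"], of "{m + M}"]
      by (simp add: divide_inverse mult.commute)
    also have "\<dots> = exp (1 + ?r)" by (simp add: exp_def divide_inverse mult.commute)
    \<comment> \<open>One term of the exponential series.\<close>
    finally have 1: "(1 + ?r) ^ (m + M) \<le> fact (m + M) * exp (1 + ?r)" by (simp add: divide_le_eq mult.commute)
    have "0 \<le> (?r / 2 - 1)\<^sup>2" by simp
    then have 2: "- ?r\<^sup>2 / 4 \<le> 1 - ?r" by (simp add: power2_eq_square field_simps)
    have "cmod (f z) * (1 + ?r) ^ M = \<bar>P z\<bar> * (exp (- ?r\<^sup>2 / 4) * (1 + ?r) ^ M)"
      unfolding f norm_of_real by (simp add: abs_mult)
    also have "\<dots> \<le> (K * (1 + ?r) ^ m) * (exp (1 - ?r) * (1 + ?r) ^ M)"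
      using K 2 by (intro mult_mono) auto
    also have "\<dots> = K * ((1 + ?r) ^ (m + M) * exp (1 - ?r))" by (simp add: power_add)
    also have "\<dots> \<le> K * ((fact (m + M) * exp (1 + ?r)) * exp (1 - ?r))"
      using K 1 by (intro mult_left_mono mult_right_mono) auto
    also have "\<dots> = K * (fact (m + M) * exp 2)" by (simp add: mult.assoc flip: exp_add)
    finally show ?thesis .
  qed
  with K show ?thesis by (intro exI[of _ "K * (fact (m + M) * exp 2)"]) auto
qed

lemma partial_derivs_rescale:
  fixes F :: "real ^ 'n \<Rightarrow> complex"
  assumes F: "smooth F" and s: "0 < s"
  shows "partial_derivs is (\<lambda>y. \<kappa> * F ((1 / s) *\<^sub>R (y - x))) =
    (\<lambda>y. \<kappa> / complex_of_real s ^ length is * partial_derivs is F ((1 / s) *\<^sub>R (y - x)))"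
    "smooth (\<lambda>y. \<kappa> * F ((1 / s) *\<^sub>R (y - x)))"
proof -
  have step: "((\<lambda>y. \<kappa>' * G ((1 / s) *\<^sub>R (y - x))) has_derivative
      (\<lambda>v. \<kappa>' * frechet_derivative G (at ((1 / s) *\<^sub>R (y - x))) ((1 / s) *\<^sub>R v))) (at y)"
    if "\<And>z. G differentiable (at z)" for \<kappa>' and G :: "real ^ 'n \<Rightarrow> complex" and y
  proof -
    have G: "(G has_derivative frechet_derivative G (at ((1 / s) *\<^sub>R (y - x)))) (at ((1 / s) *\<^sub>R (y - x)))"
      using that by (simp add: frechet_derivative_works)
    have "((\<lambda>y. (1 / s) *\<^sub>R (y - x)) has_derivative (\<lambda>v. (1 / s) *\<^sub>R v)) (at y)"
      by (auto intro!: derivative_eq_intros)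
    from has_derivative_mult_right[OF has_derivative_compose[OF this G]] show ?thesis .
  qed
  show eq: "partial_derivs is (\<lambda>y. \<kappa> * F ((1 / s) *\<^sub>R (y - x))) =
    (\<lambda>y. \<kappa> / complex_of_real s ^ length is * partial_derivs is F ((1 / s) *\<^sub>R (y - x)))" for "is"
  proof (induction "is")
    case (Cons i js)
    let ?G = "partial_derivs js F" and ?\<kappa> = "\<kappa> / complex_of_real s ^ length js"
    have G: "\<And>z. ?G differentiable (at z)" using F by (simp add: smooth_def)
    show ?case
    proof
      fix y
      let ?z = "(1 / s) *\<^sub>R (y - x)"
      have lin: "linear (frechet_derivative ?G (at ?z))"
        using G by (intro linear_frechet_derivative)
      have "partial_deriv i (\<lambda>y. ?\<kappa> * ?G ((1 / s) *\<^sub>R (y - x))) y =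
          ?\<kappa> * frechet_derivative ?G (at ?z) ((1 / s) *\<^sub>R axis i 1)"
        unfolding partial_deriv_def by (subst frechet_derivative_at[OF step[OF G], symmetric]) simp
      also have "\<dots> = ?\<kappa> / complex_of_real s * partial_deriv i ?G ?z"
        unfolding partial_deriv_def linear_scale[OF lin] by (simp add: scaleR_conv_of_real)
      finally show "partial_derivs (i # js) (\<lambda>y. \<kappa> * F ((1 / s) *\<^sub>R (y - x))) y =
          \<kappa> / complex_of_real s ^ length (i # js) * partial_derivs (i # js) F ?z"
        by (simp add: Cons.IH mult.commute)
    qed
  qed simp
  show "smooth (\<lambda>y. \<kappa> * F ((1 / s) *\<^sub>R (y - x)))"
    unfolding smooth_def eq
  proof (intro allI)
    fix "is" y
    have "\<And>z. partial_derivs is F differentiable (at z)" using F by (simp add: smooth_def)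
    from step[OF this]
    show "(\<lambda>y. \<kappa> / complex_of_real s ^ length is * partial_derivs is F ((1 / s) *\<^sub>R (y - x))) differentiable (at y)"
      unfolding differentiable_def by blast
  qed
qed

text \<open>The heat kernel at time \<open>t\<close> is the dilate by \<open>sqrt t\<close> of the one at time 1, and the bounds defining
  \<open>test_kernel\<close> are invariant under dilation; this is why the constant does not depend on \<open>t\<close>.\<close>

theorem test_kernel_heat_kernel:
  "\<exists>A>0. \<forall>t x. 0 < t \<longrightarrow>
    test_kernel L x (sqrt t) A (\<lambda>y :: real ^ 'n. complex_of_real (heat_kernel t x y))"
proof -
  let ?n = "CARD('n)"
  define F :: "real ^ 'n \<Rightarrow> complex"
    where "F z = complex_of_real ((4 * pi) powr (- real ?n / 2) * exp (- (norm z)\<^sup>2 / 4))" for z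
  have pg: "poly_gaussian F"
    unfolding poly_gaussian_def F_def[abs_def]
    by (intro exI[of _ 0] exI[of _ "\<lambda>_. (4 * pi) powr (- real ?n / 2)"]) (auto intro: poly_deg.const)
  have sm: "smooth F" using pg by (rule smooth_poly_gaussian)
  have "\<forall>is. \<exists>B\<ge>0. \<forall>z. cmod (partial_derivs is F z) * (1 + norm z) ^ (?n + Suc L) \<le> B"
    using poly_gaussian_decay[OF poly_gaussian_partial_derivs[OF pg]] by blast
  then obtain B where B: "\<And>is. 0 \<le> B is"
    "\<And>is z. cmod (partial_derivs is F z) * (1 + norm z) ^ (?n + Suc L) \<le> B is" by metis
  define A where "A = 1 + B [] + (\<Sum>is | length is = Suc L. B is)"
  have A1: "B [] \<le> A" and A0: "0 < A"
    using B(1) by (simp_all add: A_def sum_nonneg add_pos_nonneg)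
  have A2: "B is \<le> A" if "length is = Suc L" for "is"
  proof -
    have "B is \<le> (\<Sum>is | length is = Suc L. B is)" using that B(1) by (intro member_le_sum) auto
    then show ?thesis using B(1)[of "[]"] by (simp add: A_def)
  qed
  have "test_kernel L x (sqrt t) A (\<lambda>y. complex_of_real (heat_kernel t x y))" if t: "0 < t" for t and x :: "real ^ 'n"
  proof -
    define s where "s = sqrt t"
    have s: "0 < s" and st: "t = s\<^sup>2" using t by (auto simp: s_def)
    have hk: "(\<lambda>y. complex_of_real (heat_kernel t x y)) =
        (\<lambda>y. complex_of_real (1 / s ^ ?n) * F ((1 / s) *\<^sub>R (y - x)))"
    proof
      fix y
      have "(4 * pi * t) powr (- real ?n / 2) = (4 * pi) powr (- real ?n / 2) * (s\<^sup>2) powr (- real ?n / 2)"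
        unfolding st by (rule powr_mult)
      also have "(s\<^sup>2) powr (- real ?n / 2) = 1 / s ^ ?n"
      proof -
        have "s\<^sup>2 = s powr 2" using s by simp
        then have "(s\<^sup>2) powr (- real ?n / 2) = s powr (- real ?n)" by (simp only: powr_powr) simp
        then show ?thesis using s by (simp add: powr_minus_divide powr_realpow)
      qed
      finally have "heat_kernel t x y = 1 / s ^ ?n * ((4 * pi) powr (- real ?n / 2) * exp (- (norm ((1 / s) *\<^sub>R (y - x)))\<^sup>2 / 4))"
        using s by (simp add: heat_kernel_def st norm_minus_commute power_divide)
      then show "complex_of_real (heat_kernel t x y) = complex_of_real (1 / s ^ ?n) * F ((1 / s) *\<^sub>R (y - x))"
        by (simp add: F_def)
    qed
    have scale: "s + norm (y - x) = s * (1 + norm ((1 / s) *\<^sub>R (y - x)))"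
      "norm (y - x) = s * norm ((1 / s) *\<^sub>R (y - x))" for y
      unfolding norm_scaleR using s by (auto simp: field_simps)
    show ?thesis
      unfolding test_kernel_def hk s_def[symmetric]
    proof (intro conjI allI impI partial_derivs_rescale(2)[OF sm s] s less_imp_le[OF A0])
      fix y
      let ?z = "(1 / s) *\<^sub>R (y - x)"
      have "cmod (F ?z) * (1 + norm ?z) ^ (?n + 1) \<le> cmod (F ?z) * (1 + norm ?z) ^ (?n + Suc L)"
        by (intro mult_left_mono power_increasing) auto
      also have "\<dots> \<le> A" using B(2)[of "[]" ?z] A1 by simp
      finally have "s * (cmod (F ?z) * (1 + norm ?z) ^ (?n + 1)) \<le> s * A" using s by (intro mult_left_mono) auto
      then show "cmod (complex_of_real (1 / s ^ ?n) * F ?z) * (s + norm (y - x)) ^ (?n + 1) \<le> A * s"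
        unfolding scale(1) using s by (simp add: norm_mult norm_divide norm_power power_mult_distrib mult_ac)
    next
      fix y and js :: "'n list" assume js: "length js = Suc L"
      let ?z = "(1 / s) *\<^sub>R (y - x)"
      have "cmod (partial_derivs js F ?z) * norm ?z ^ (?n + Suc L) \<le>
          cmod (partial_derivs js F ?z) * (1 + norm ?z) ^ (?n + Suc L)"
        by (intro mult_left_mono power_mono) auto
      also have "\<dots> \<le> A" using B(2) A2[OF js] by (rule order_trans)
      finally have le: "cmod (partial_derivs js F ?z) * norm ?z ^ (?n + Suc L) \<le> A" .
      have "cmod (complex_of_real (1 / s ^ ?n) / complex_of_real s ^ length js * partial_derivs js F ?z) *
          norm (y - x) ^ (?n + Suc L) = cmod (partial_derivs js F ?z) * norm ?z ^ (?n + Suc L)"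
        unfolding scale(2)[of y] js power_mult_distrib power_add[of s]
        using s by (simp add: norm_mult norm_divide norm_power)
      with le show "cmod (partial_derivs js (\<lambda>y. complex_of_real (1 / s ^ ?n) * F ((1 / s) *\<^sub>R (y - x))) y) *
          norm (y - x) ^ (?n + Suc L) \<le> A"
        unfolding partial_derivs_rescale(1)[OF sm s] by simp
    qed
  qed
  with A0 show ?thesis by blast
qed

section \<open>Tempered distributions\<close>

lemma schwartz_smooth: "g \<in> schwartz \<Longrightarrow> smooth g" by (simp add: schwartz_def)

lemma schwartz_continuous: "g \<in> schwartz \<Longrightarrow> continuous_on UNIV g"
  using smooth_continuous_on[of g "[]"] by (simp add: schwartz_def)

lemma schwartz_seminorm_upper:
  assumes "g \<in> schwartz"
  shows "\<bar>monomial \<alpha> y\<bar> * cmod (partial_derivs is g y) \<le> schwartz_seminorm \<alpha> is g"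
proof -
  have "bounded (range (\<lambda>x. monomial \<alpha> x *\<^sub>R partial_derivs is g x))"
    using assms by (simp add: schwartz_def)
  then have "bdd_above (range (\<lambda>x. cmod (monomial \<alpha> x *\<^sub>R partial_derivs is g x)))"
    by (auto simp: bounded_iff bdd_above_def)
  then have "cmod (monomial \<alpha> y *\<^sub>R partial_derivs is g y) \<le> schwartz_seminorm \<alpha> is g"
    unfolding schwartz_seminorm_def by (intro cSUP_upper) auto
  then show ?thesis by simp
qed

lemma schwartz_seminorm_nonneg: "g \<in> schwartz \<Longrightarrow> 0 \<le> schwartz_seminorm \<alpha> is g"
  using schwartz_seminorm_upper[of g \<alpha> 0 "is"] by (meson abs_ge_zero mult_nonneg_nonneg norm_ge_zero order_trans)

lemma partial_derivs_diff:
  fixes f g :: "real ^ 'n \<Rightarrow> complex"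
  assumes f: "smooth f" and g: "smooth g"
  shows "partial_derivs is (\<lambda>x. f x - g x) = (\<lambda>x. partial_derivs is f x - partial_derivs is g x)"
proof (induction "is")
  case (Cons i js)
  show ?case
  proof
    fix x
    let ?F = "partial_derivs js f" and ?G = "partial_derivs js g"
    have "(?F has_derivative frechet_derivative ?F (at x)) (at x)"
      "(?G has_derivative frechet_derivative ?G (at x)) (at x)"
      using f g unfolding smooth_def frechet_derivative_works by blast+
    from frechet_derivative_at[OF has_derivative_diff[OF this], symmetric]
    show "partial_derivs (i # js) (\<lambda>x. f x - g x) x = partial_derivs (i # js) f x - partial_derivs (i # js) g x"
      by (simp add: Cons.IH partial_deriv_def)
  qed
qed simp

lemma schwartz_diff:
  assumes f: "f \<in> schwartz" and g: "g \<in> schwartz"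
  shows "(\<lambda>x. f x - g x) \<in> schwartz"
  unfolding schwartz_def
proof (intro CollectI conjI allI)
  note eq = partial_derivs_diff[OF f[THEN schwartz_smooth] g[THEN schwartz_smooth]]
  show "smooth (\<lambda>x. f x - g x)"
    using f g unfolding smooth_def eq by (auto simp: schwartz_def smooth_def intro!: differentiable_diff)
  fix \<alpha> "is"
  have "bounded (range (\<lambda>x. monomial \<alpha> x *\<^sub>R partial_derivs is f x))"
    "bounded (range (\<lambda>x. monomial \<alpha> x *\<^sub>R partial_derivs is g x))"
    using f g by (auto simp: schwartz_def)
  from bounded_minus_comp[OF this]
  show "bounded (range (\<lambda>x. monomial \<alpha> x *\<^sub>R partial_derivs is (\<lambda>x. f x - g x) x))"
    unfolding eq by (simp add: scaleR_diff_right)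
qed

lemma partial_derivs_zero: "partial_derivs is (\<lambda>x :: real ^ 'n. 0) = (\<lambda>x. 0)"
proof (induction "is")
  case (Cons i js)
  have "frechet_derivative (\<lambda>x :: real ^ 'n. 0 :: complex) (at x) = (\<lambda>x. 0)" for x
    by (rule frechet_derivative_const)
  then show ?case by (auto simp: Cons partial_deriv_def)
qed simp

lemma topspace_schwartz [simp]: "topspace (schwartz_topology :: (real ^ 'n \<Rightarrow> complex) topology) = schwartz"
proof -
  let ?B = "{{g \<in> schwartz. schwartz_seminorm \<alpha> is (\<lambda>x. g x - f x) < e} | (f :: real ^ 'n \<Rightarrow> complex) \<alpha> is e.
        f \<in> schwartz \<and> 0 < e}"
  have "f \<in> \<Union>?B" if f: "f \<in> schwartz" for f
  proof (rule UnionI)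
    show "{g \<in> schwartz. schwartz_seminorm (\<lambda>_. 0) [] (\<lambda>x. g x - f x) < 1} \<in> ?B"
      using f by (intro CollectI exI[of _ f] exI[of _ "\<lambda>_. 0"] exI[of _ "[]"] exI[of _ 1]) simp
    show "f \<in> {g \<in> schwartz. schwartz_seminorm (\<lambda>_. 0) [] (\<lambda>x. g x - f x) < 1}"
      using f by (simp add: schwartz_seminorm_def)
  qed
  moreover have "\<Union>?B \<subseteq> schwartz" by blast
  ultimately show ?thesis
    unfolding schwartz_topology_def topology_generated_by_topspace by blast
qed

abbreviation seminorm_sum :: "(('n \<Rightarrow> nat) \<times> 'n list) set \<Rightarrow> (real ^ 'n \<Rightarrow> complex) \<Rightarrow> real" where
  "seminorm_sum S g \<equiv> (\<Sum>(\<alpha>, is)\<in>S. schwartz_seminorm \<alpha> is g)"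

text \<open>A functional that is Lipschitz with respect to finitely many seminorms is continuous, since finite
  intersections of seminorm balls are open.\<close>

lemma continuous_map_schwartz:
  fixes T :: "('n::finite) functional"
  assumes S: "finite S" and C: "0 \<le> C"
    and bound: "\<And>f g. f \<in> schwartz \<Longrightarrow> g \<in> schwartz \<Longrightarrow>
      cmod (T g - T f) \<le> C * seminorm_sum S (\<lambda>x. g x - f x)"
  shows "continuous_map schwartz_topology euclidean T"
  unfolding continuous_map_def
proof (intro conjI allI impI)
  fix U :: "complex set" assume "openin euclidean U"
  then have U: "open U" by simp
  show "openin schwartz_topology {f \<in> topspace schwartz_topology. T f \<in> U}"
  proof (subst openin_subopen, intro ballI)
    fix f assume "f \<in> {f \<in> topspace schwartz_topology. T f \<in> U}"
    then have f: "f \<in> schwartz" and "T f \<in> U" by auto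
    then obtain e where e: "0 < e" "ball (T f) e \<subseteq> U" using U by (meson openE)
    \<comment> \<open>The summand 1 covers the case of an empty set of seminorms.\<close>
    define e' where "e' = e / (C * real (card S) + 1)"
    have den: "0 < C * real (card S) + 1" using C by (intro add_nonneg_pos) auto
    have e': "0 < e'" unfolding e'_def using e den by simp
    define V where "V a = {g \<in> schwartz. schwartz_seminorm (fst a) (snd a) (\<lambda>x. g x - f x) < e'}"
      for a :: "('n \<Rightarrow> nat) \<times> 'n list"
    have V: "openin schwartz_topology (V a)" for a
      unfolding schwartz_topology_def V_def using f e'
      by (intro topology_generated_by_Basis CollectI exI[of _ f] exI[of _ "fst a"] exI[of _ "snd a"]
          exI[of _ e']) simp
    have fV: "f \<in> V a" for a
      using f e' by (simp add: V_def schwartz_seminorm_def partial_derivs_zero)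
    let ?W = "\<Inter>(insert schwartz (V ` S))"
    show "\<exists>W. openin schwartz_topology W \<and> f \<in> W \<and> W \<subseteq> {f \<in> topspace schwartz_topology. T f \<in> U}"
    proof (intro exI conjI)
      have "openin schwartz_topology (schwartz :: (real ^ 'n \<Rightarrow> complex) set)"
        using openin_topspace[of "schwartz_topology :: (real ^ 'n \<Rightarrow> complex) topology"] by simp
      then show "openin schwartz_topology ?W" using S V by (intro openin_Inter) auto
      show "f \<in> ?W" using f fV by auto
      show "?W \<subseteq> {f \<in> topspace schwartz_topology. T f \<in> U}"
      proof
        fix g assume g: "g \<in> ?W"
        then have gs: "g \<in> schwartz" by simp
        have "cmod (T g - T f) \<le> C * seminorm_sum S (\<lambda>x. g x - f x)" by (rule bound[OF f gs])
        also have "\<dots> \<le> C * (\<Sum>a\<in>S. e')"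
          using g C by (intro mult_left_mono sum_mono) (auto simp: V_def intro: less_imp_le)
        also have "\<dots> = C * real (card S) / (C * real (card S) + 1) * e" by (simp add: e'_def)
        also have "\<dots> < 1 * e" using e den by (intro mult_strict_right_mono) auto
        finally have "T g \<in> ball (T f) e" by (simp add: dist_norm norm_minus_commute)
        then show "g \<in> {f \<in> topspace schwartz_topology. T f \<in> U}" using gs e by auto
      qed
    qed
  qed
qed auto

lemma tempered_of_seminorm_bound:
  fixes T :: "('n::finite) functional"
  assumes add: "\<And>f g. f \<in> schwartz \<Longrightarrow> g \<in> schwartz \<Longrightarrow> T (\<lambda>x. f x + g x) = T f + T g"
    and diff: "\<And>f g. f \<in> schwartz \<Longrightarrow> g \<in> schwartz \<Longrightarrow> T (\<lambda>x. f x - g x) = T f - T g"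
    and cmult: "\<And>c f. f \<in> schwartz \<Longrightarrow> T (\<lambda>x. c * f x) = c * T f"
    and S: "finite S" "0 \<le> C"
    and bound: "\<And>g. g \<in> schwartz \<Longrightarrow> cmod (T g) \<le> C * seminorm_sum S g"
  shows "T \<in> tempered"
proof -
  have "continuous_map schwartz_topology euclidean T"
    using bound[OF schwartz_diff] diff by (intro continuous_map_schwartz[OF S]) simp
  with add cmult show ?thesis by (simp add: tempered_def)
qed

text \<open>The largest of 1 and the moduli of the coordinates dominates \<open>1 + norm y\<close> up to the factor \<open>n + 1\<close>.
  This reduces weights in the norm to the monomial weights of the seminorms.\<close>

lemma one_plus_norm_power_le:
  fixes y :: "real ^ 'n"
  shows "(1 + norm y) ^ N \<le> (real CARD('n) + 1) ^ N * (1 + (\<Sum>i\<in>UNIV. \<bar>y $ i\<bar> ^ N))"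
proof -
  define u where "u = Max (insert 1 (range (\<lambda>i. \<bar>y $ i\<bar>)))"
  have u: "1 \<le> u" "\<And>i. \<bar>y $ i\<bar> \<le> u" unfolding u_def by (rule Max_ge; simp)+
  have "u \<in> insert 1 (range (\<lambda>i. \<bar>y $ i\<bar>))" unfolding u_def by (intro Max_in) auto
  then have uN: "u ^ N \<le> 1 + (\<Sum>i\<in>UNIV. \<bar>y $ i\<bar> ^ N)"
  proof (elim insertE rangeE)
    fix i assume "u = \<bar>y $ i\<bar>"
    then have "u ^ N \<le> (\<Sum>i\<in>UNIV. \<bar>y $ i\<bar> ^ N)" by (auto intro: member_le_sum)
    then show ?thesis by simp
  qed (simp add: sum_nonneg)
  have "norm y \<le> (\<Sum>i\<in>UNIV. \<bar>y $ i\<bar>)" by (rule norm_le_l1_cart)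
  also have "\<dots> \<le> (\<Sum>i\<in>(UNIV :: 'n set). u)" by (intro sum_mono u)
  finally have "1 + norm y \<le> (real CARD('n) + 1) * u" using u by (simp add: distrib_right)
  then have "(1 + norm y) ^ N \<le> ((real CARD('n) + 1) * u) ^ N" by (intro power_mono) auto
  also have "\<dots> \<le> (real CARD('n) + 1) ^ N * (1 + (\<Sum>i\<in>UNIV. \<bar>y $ i\<bar> ^ N))"
    unfolding power_mult_distrib using uN by (intro mult_left_mono) auto
  finally show ?thesis .
qed

lemma monomial_single: "monomial (\<lambda>j. if j = i then N else 0) y = (y $ i) ^ N"
proof -
  have "monomial (\<lambda>j. if j = i then N else 0) y = (\<Prod>j\<in>UNIV. if j = i then (y $ i) ^ N else 1)"
    unfolding monomial_def by (intro prod.cong) auto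
  then show ?thesis by simp
qed

text \<open>Any Schwartz function is a kernel at scale 1 around any fixed point, with a constant that is a continuous
  seminorm.\<close>

theorem test_kernel_schwartz:
  fixes x :: "real ^ 'n"
  shows "\<exists>S C. finite S \<and> 0 < C \<and> (\<forall>g\<in>schwartz.
    test_kernel L x 1 (C * seminorm_sum S g) g)"
proof -
  let ?n = "CARD('n)"
  define N where "N = ?n + Suc L"
  define M :: "('n \<Rightarrow> nat) set" where "M = insert (\<lambda>_. 0) (range (\<lambda>i j. if j = i then N else 0))"
  define J :: "'n list set" where "J = insert [] {is. length is = Suc L}"
  define S where "S = M \<times> J"
  define C where "C = (1 + norm x) ^ N * ((real ?n + 1) ^ N * (real ?n + 1))"
  have fin: "finite S" by (simp add: S_def M_def J_def)
  have C0: "0 < C" unfolding C_def by (intro mult_pos_pos zero_less_power) (auto intro: add_pos_nonneg add_nonneg_pos)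
  have kernel: "test_kernel L x 1 (C * seminorm_sum S g) g" if g: "g \<in> schwartz" for g
  proof -
    define A where "A = seminorm_sum S g"
    have A0: "0 \<le> A" unfolding A_def using schwartz_seminorm_nonneg[OF g] by (intro sum_nonneg) auto
    have semi: "\<bar>monomial \<alpha> y\<bar> * cmod (partial_derivs is g y) \<le> A" if "\<alpha> \<in> M" "is \<in> J" for \<alpha> y "is"
    proof -
      have "schwartz_seminorm \<alpha> is g \<le> A"
        unfolding A_def using that schwartz_seminorm_nonneg[OF g] fin
          member_le_sum[of "(\<alpha>, is)" S "\<lambda>(\<alpha>, is). schwartz_seminorm \<alpha> is g"] by (auto simp: S_def)
      then show ?thesis using schwartz_seminorm_upper[OF g] order_trans by blast
    qed
    have main: "cmod (partial_derivs is g y) * (1 + norm (y - x)) ^ N \<le> C * A" if "is \<in> J" for y "is"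
    proof -
      let ?G = "cmod (partial_derivs is g y)"
      have zero: "?G \<le> A" using semi[of "\<lambda>_. 0" "is" y] that by (simp add: M_def monomial_zero)
      have single: "\<bar>y $ i\<bar> ^ N * ?G \<le> A" for i
        using semi[of "\<lambda>j. if j = i then N else 0" "is" y] that by (simp add: M_def monomial_single power_abs)
      have "?G * (1 + (\<Sum>i\<in>UNIV. \<bar>y $ i\<bar> ^ N)) = ?G + (\<Sum>i\<in>UNIV. \<bar>y $ i\<bar> ^ N * ?G)"
        by (simp add: distrib_left sum_distrib_left mult.commute)
      also have "\<dots> \<le> A + (\<Sum>i\<in>(UNIV :: 'n set). A)" by (intro add_mono sum_mono zero single)
      also have "\<dots> = (real ?n + 1) * A" by (simp add: distrib_right)
      finally have sum: "?G * (1 + (\<Sum>i\<in>UNIV. \<bar>y $ i\<bar> ^ N)) \<le> (real ?n + 1) * A" .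
      have "norm (y - x) \<le> norm y + norm x" by (rule norm_triangle_ineq4)
      then have "1 + norm (y - x) \<le> (1 + norm x) * (1 + norm y)"
      proof -
        assume "norm (y - x) \<le> norm y + norm x"
        moreover have "0 \<le> norm x * norm y" by simp
        moreover have "(1 + norm x) * (1 + norm y) = 1 + norm x + norm y + norm x * norm y"
          by (simp add: algebra_simps)
        ultimately show ?thesis by linarith
      qed
      then have "?G * (1 + norm (y - x)) ^ N \<le> ?G * ((1 + norm x) * (1 + norm y)) ^ N"
        by (intro mult_left_mono power_mono) auto
      also have "\<dots> = (1 + norm x) ^ N * (?G * (1 + norm y) ^ N)" by (simp only: power_mult_distrib mult_ac)
      also have "\<dots> \<le> (1 + norm x) ^ N * (?G * ((real ?n + 1) ^ N * (1 + (\<Sum>i\<in>UNIV. \<bar>y $ i\<bar> ^ N))))"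
        by (intro mult_left_mono one_plus_norm_power_le) auto
      also have "\<dots> = (1 + norm x) ^ N * ((real ?n + 1) ^ N * (?G * (1 + (\<Sum>i\<in>UNIV. \<bar>y $ i\<bar> ^ N))))"
        by (simp only: mult.left_commute)
      also have "\<dots> \<le> (1 + norm x) ^ N * ((real ?n + 1) ^ N * ((real ?n + 1) * A))"
        by (intro mult_left_mono sum) auto
      finally show ?thesis by (simp only: C_def mult.assoc)
    qed
    show ?thesis
      unfolding test_kernel_def A_def[symmetric]
    proof (intro conjI allI impI schwartz_smooth[OF g])
      show "0 \<le> C * A" using A0 C0 by simp
      fix y
      have "cmod (g y) * (1 + norm (y - x)) ^ (?n + 1) \<le> cmod (g y) * (1 + norm (y - x)) ^ N"
        unfolding N_def by (intro mult_left_mono power_increasing) auto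
      also have "\<dots> \<le> C * A" using main[of "[]" y] by (simp add: J_def)
      finally show "cmod (g y) * (1 + norm (y - x)) ^ (?n + 1) \<le> C * A * 1" by simp
    next
      fix y and js :: "'n list" assume "length js = Suc L"
      then have js: "js \<in> J" by (simp add: J_def)
      have "cmod (partial_derivs js g y) * norm (y - x) ^ N \<le> cmod (partial_derivs js g y) * (1 + norm (y - x)) ^ N"
        by (intro mult_left_mono power_mono) auto
      also have "\<dots> \<le> C * A" by (rule main[OF js])
      finally show "cmod (partial_derivs js g y) * norm (y - x) ^ (?n + Suc L) \<le> C * A" by (simp add: N_def)
    qed simp
  qed
  show ?thesis by (intro exI[of _ S] exI[of _ C] conjI ballI fin C0 kernel)
qed

section \<open>Morrey norms and atoms\<close>

text \<open>The complement of the support is a union of possibly uncountably many open sets on which the function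
  vanishes almost everywhere; countably many of them suffice by the Lindeloef property.\<close>

lemma AE_zero_outside_supp:
  fixes f :: "real ^ 'n \<Rightarrow> complex"
  shows "AE x in lebesgue. x \<notin> supp f \<longrightarrow> f x = 0"
proof -
  let ?\<U> = "{U. open U \<and> (AE x in lebesgue. x \<in> U \<longrightarrow> f x = 0)}"
  obtain \<U>' where \<U>': "\<U>' \<subseteq> ?\<U>" "countable \<U>'" "\<Union>\<U>' = \<Union>?\<U>" using Lindelof[of ?\<U>] by auto
  have "AE x in lebesgue. \<forall>U\<in>\<U>'. x \<in> U \<longrightarrow> f x = 0" using \<U>' by (subst AE_ball_countable) auto
  then show ?thesis by eventually_elim (use \<U>'(3) in \<open>auto simp: supp_def\<close>)
qed

lemma ennreal_scaled_le_iff: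
  assumes "0 < c"
  shows "ennreal (1 / c) * Y \<le> Z \<longleftrightarrow> Y \<le> ennreal c * Z"
proof
  assume "ennreal (1 / c) * Y \<le> Z"
  then have "ennreal c * (ennreal (1 / c) * Y) \<le> ennreal c * Z" by (rule mult_left_mono) simp
  moreover have "ennreal c * (ennreal (1 / c) * Y) = Y"
    using assms by (simp add: mult.assoc[symmetric] flip: ennreal_mult)
  ultimately show "Y \<le> ennreal c * Z" by simp
next
  assume "Y \<le> ennreal c * Z"
  then have "ennreal (1 / c) * Y \<le> ennreal (1 / c) * (ennreal c * Z)" by (rule mult_left_mono) simp
  moreover have "ennreal (1 / c) * (ennreal c * Z) = Z"
    using assms by (simp add: mult.assoc[symmetric] flip: ennreal_mult)
  ultimately show "ennreal (1 / c) * Y \<le> Z" by simp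
qed

lemma morrey_norm_le_iff:
  fixes \<phi> :: "real ^ 'n \<Rightarrow> real \<Rightarrow> real"
  assumes p: "0 < p" and b: "0 \<le> b" and \<phi>: "\<And>z r. 0 < r \<Longrightarrow> 0 < \<phi> z r"
  shows "morrey_norm (ennreal p) \<phi> F \<le> ennreal b \<longleftrightarrow>
    (\<forall>z L. 0 < L \<longrightarrow> power_integral F p (cube z L) \<le> ennreal ((b * \<phi> z L) powr p * L ^ CARD('n)))"
proof -
  have single: "ennreal (1 / at_cube \<phi> (cube z L)) * cube_mean (ennreal p) F (cube z L) \<le> ennreal b \<longleftrightarrow>
      power_integral F p (cube z L) \<le> ennreal ((b * \<phi> z L) powr p * L ^ CARD('n))"
    if L: "0 < L" for z L
  proof -
    let ?I = "\<integral>\<^sup>+ y\<in>cube z L. ennpowr (F y) p \<partial>lebesgue"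
    have "?I / emeasure lebesgue (cube z L) = ennreal (1 / L ^ CARD('n)) * ?I"
      using L by (simp add: emeasure_cube divide_ennreal_def inverse_ennreal mult.commute inverse_eq_divide)
    then have mean: "cube_mean (ennreal p) F (cube z L) = ennpowr (ennreal (1 / L ^ CARD('n)) * ?I) (1 / p)"
      using p by (simp add: cube_mean_def)
    have "ennreal (1 / at_cube \<phi> (cube z L)) * cube_mean (ennreal p) F (cube z L) \<le> ennreal b \<longleftrightarrow>
        ennpowr (ennreal (1 / L ^ CARD('n)) * ?I) (1 / p) \<le> ennreal (\<phi> z L) * ennreal b"
      using L \<phi>[OF L] by (simp only: at_cube_def cube_center_cube cube_side_cube ennreal_scaled_le_iff mean)
    also have "\<dots> \<longleftrightarrow> ennreal (1 / L ^ CARD('n)) * ?I \<le> ennpowr (ennreal (b * \<phi> z L)) p"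
      using p b \<phi>[OF L, of z] by (simp add: ennpowr_le_iff mult.commute flip: ennreal_mult)
    also have "\<dots> \<longleftrightarrow> ?I \<le> ennreal (L ^ CARD('n)) * ennpowr (ennreal (b * \<phi> z L)) p"
      using L by (intro ennreal_scaled_le_iff) simp
    also have "ennreal (L ^ CARD('n)) * ennpowr (ennreal (b * \<phi> z L)) p = ennreal ((b * \<phi> z L) powr p * L ^ CARD('n))"
      using b L \<phi>[OF L, of z] by (simp add: ennpowr_ennreal mult.commute flip: ennreal_mult)
    finally show ?thesis .
  qed
  have "morrey_norm (ennreal p) \<phi> F \<le> ennreal b \<longleftrightarrow>
      (\<forall>z L. 0 < L \<longrightarrow> ennreal (1 / at_cube \<phi> (cube z L)) * cube_mean (ennreal p) F (cube z L) \<le> ennreal b)"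
    unfolding morrey_norm_def SUP_le_iff by (auto simp: cubes_def)
  with single show ?thesis by blast
qed

lemma morrey_norm_infinity_le:
  fixes \<phi> :: "real ^ 'n \<Rightarrow> real \<Rightarrow> real"
  assumes norm: "morrey_norm \<infinity> \<phi> F \<le> ennreal b" and b: "0 \<le> b" and \<phi>: "\<And>z r. 0 < r \<Longrightarrow> 0 < \<phi> z r"
    and L: "0 < L" and q: "0 < q"
  shows "power_integral F q (cube z L) \<le> ennreal ((b * \<phi> z L) powr q * L ^ CARD('n))"
proof -
  have "ennreal (1 / at_cube \<phi> (cube z L)) * cube_mean \<infinity> F (cube z L) \<le> ennreal b"
    using norm L unfolding morrey_norm_def SUP_le_iff by (auto simp: cubes_def)
  then have "esssup (lebesgue_on (cube z L)) F \<le> ennreal (\<phi> z L) * ennreal b"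
    using L \<phi>[OF L] by (simp add: at_cube_def cube_center_cube cube_side_cube ennreal_scaled_le_iff cube_mean_def)
  then have le: "esssup (lebesgue_on (cube z L)) F \<le> ennreal (b * \<phi> z L)"
    using b \<phi>[OF L, of z] by (simp add: mult.commute flip: ennreal_mult)
  have "AE y in lebesgue_on (cube z L). F y \<le> ennreal (b * \<phi> z L)"
    using esssup_AE[of F "lebesgue_on (cube z L)"] by eventually_elim (use le in auto)
  then have ae: "AE y in lebesgue. y \<in> cube z L \<longrightarrow> F y \<le> ennreal (b * \<phi> z L)"
    by (subst (asm) AE_restrict_space_iff) auto
  have "power_integral F q (cube z L) \<le>
      (\<integral>\<^sup>+ y. ennpowr (ennreal (b * \<phi> z L)) q * indicator (cube z L) y \<partial>lebesgue)"
    by (intro nn_integral_mono_AE, use ae in eventually_elim)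
      (use q in \<open>auto simp: indicator_def intro: ennpowr_mono\<close>)
  also have "\<dots> = ennreal ((b * \<phi> z L) powr q * L ^ CARD('n))"
    using b L \<phi>[OF L, of z] by (simp add: nn_integral_cmult_indicator emeasure_cube ennpowr_ennreal flip: ennreal_mult)
  finally show ?thesis .
qed

text \<open>A finite exponent is kept. For \<open>q = \<infinity>\<close> any finite exponent larger than \<open>p\<close> will do, because the
  essential supremum dominates all means.\<close>

lemma morrey_atom_of_morrey_norm:
  fixes \<eta> :: "real ^ 'n \<Rightarrow> real \<Rightarrow> real"
  assumes p: "0 < p" "p \<le> 1" and q: "1 \<le> q" "ennreal p < q" and \<eta>: "\<eta> \<in> growth_class 1"
  shows "\<exists>q'\<ge>1. p < q' \<and> (\<forall>c l F. F \<in> borel_measurable lebesgue \<longrightarrow> 0 < l \<longrightarrow>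
    morrey_norm q \<eta> F \<le> ennreal (1 / \<eta> c l) \<longrightarrow> morrey_atom q' \<eta> c l F)"
proof (cases "q = \<infinity>")
  case True
  have "morrey_atom 2 \<eta> c l F" if "F \<in> borel_measurable lebesgue" "0 < l" "morrey_norm q \<eta> F \<le> ennreal (1 / \<eta> c l)"
    for c l F
  proof -
    have "0 \<le> 1 / \<eta> c l" using growth_class_pos[OF \<eta> that(2), of c] by simp
    from morrey_norm_infinity_le[OF that(3)[unfolded True] this growth_class_pos[OF \<eta>], of _ 2] that(1,2)
    show ?thesis by (simp add: morrey_atom_def)
  qed
  then show ?thesis using p by (intro exI[of _ 2]) auto
next
  case False
  then obtain r where r: "0 \<le> r" "q = ennreal r" by (cases q) auto
  then have r1: "1 \<le> r" "p < r" using p q by (auto simp: ennreal_less_iff)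
  have "morrey_atom r \<eta> c l F" if F: "F \<in> borel_measurable lebesgue" "0 < l" "morrey_norm q \<eta> F \<le> ennreal (1 / \<eta> c l)"
    for c l F
  proof -
    have "0 \<le> 1 / \<eta> c l" using growth_class_pos[OF \<eta> F(2), of c] by simp
    from morrey_norm_le_iff[OF _ this, of r \<eta> F] F growth_class_pos[OF \<eta>] r1
    show ?thesis unfolding morrey_atom_def r(2) by auto
  qed
  then show ?thesis using r1 by (intro exI[of _ r]) auto
qed

lemma cancelling_of_atom:
  fixes \<eta> :: "real ^ 'n \<Rightarrow> real \<Rightarrow> real"
  assumes \<eta>: "\<eta> \<in> growth_class 1" and q: "1 \<le> q" and a: "a \<in> borel_measurable lebesgue"
    and atom: "morrey_atom q \<eta> c l (modulus a)" and supp: "supp a \<subseteq> cube c l"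
    and moments: "\<And>\<alpha>. (\<Sum>i\<in>UNIV. \<alpha> i) \<le> L \<Longrightarrow> (LINT x:cube c l|lebesgue. monomial \<alpha> x *\<^sub>R a x) = 0"
  shows "cancelling L c l a"
proof -
  have l: "0 < l" and [measurable]: "modulus a \<in> borel_measurable lebesgue"
    using atom by (auto simp: morrey_atom_def)
  have *: "(\<eta> c l / \<eta> c l) powr q = 1" using growth_class_pos[OF \<eta> l, of c] by simp
  have q_le: "power_integral (modulus a) q (cube c l) \<le> ennreal (l ^ CARD('n))"
  proof -
    have "power_integral (modulus a) q (cube c l) \<le>
        ennreal ((\<eta> c l / \<eta> c l) powr q * l ^ CARD('n))"
      using atom l unfolding morrey_atom_def by blast
    then show ?thesis unfolding * by simp
  qed
  have AE: "AE x in lebesgue. x \<notin> cube c l \<longrightarrow> a x = 0"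
    using AE_zero_outside_supp[of a] by eventually_elim (use supp in auto)
  have "(\<integral>\<^sup>+ y. modulus a y \<partial>lebesgue) \<le>
      (\<integral>\<^sup>+ y. indicator (cube c l) y + ennpowr (modulus a y) q * indicator (cube c l) y \<partial>lebesgue)"
    by (intro nn_integral_mono_AE, use AE in eventually_elim)
      (auto simp: indicator_def le_one_add_ennpowr[OF q] modulus_def)
  also have "\<dots> = ennreal (l ^ CARD('n)) + power_integral (modulus a) q (cube c l)"
    using l by (simp add: nn_integral_add emeasure_cube)
  also have "\<dots> \<le> ennreal (l ^ CARD('n)) + ennreal (l ^ CARD('n))" by (intro add_left_mono q_le)
  also have "\<dots> = ennreal (2 * l ^ CARD('n))" using l by (simp flip: ennreal_plus)
  finally show ?thesis using a l AE moments by (simp add: cancelling_def)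
qed

text \<open>The value 0 in the absence of absolute convergence keeps \<open>modulus_atomic_functional_le\<close> true for
  every argument, so that the heat extension can be estimated without first checking absolute
  convergence of the series at the heat kernels.\<close>

definition atomic_functional :: "(nat \<Rightarrow> real) \<Rightarrow> (nat \<Rightarrow> real ^ 'n \<Rightarrow> complex) \<Rightarrow> ('n::finite) functional" where
  "atomic_functional lam a g =
     (if summable (\<lambda>j. cmod (of_real (lam j) * distribution_of (a j) g))
      then (\<Sum>j. of_real (lam j) * distribution_of (a j) g) else 0)"

lemma modulus_atomic_functional_le:
  "ennreal (cmod (atomic_functional lam a g)) \<le>
    (\<Sum>j. ennreal (cmod (of_real (lam j) * distribution_of (a j) g)))"
proof (cases "summable (\<lambda>j. cmod (of_real (lam j) * distribution_of (a j) g))")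
  case True
  then have "cmod (atomic_functional lam a g) \<le> (\<Sum>j. cmod (of_real (lam j) * distribution_of (a j) g))"
    unfolding atomic_functional_def by (simp only: if_True summable_norm)
  then have "ennreal (cmod (atomic_functional lam a g)) \<le> ennreal (\<Sum>j. cmod (of_real (lam j) * distribution_of (a j) g))"
    by (rule ennreal_leI)
  also have "\<dots> = (\<Sum>j. ennreal (cmod (of_real (lam j) * distribution_of (a j) g)))"
    using True by (intro suminf_ennreal2[symmetric]) auto
  finally show ?thesis .
qed (simp add: atomic_functional_def)

abbreviation majorant_series ::
    "nat \<Rightarrow> (nat \<Rightarrow> real) \<Rightarrow> (nat \<Rightarrow> real ^ 'n) \<Rightarrow> (nat \<Rightarrow> real) \<Rightarrow> (nat \<Rightarrow> real ^ 'n \<Rightarrow> complex) \<Rightarrow>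
      real ^ 'n \<Rightarrow> ennreal" where
  "majorant_series L lam c l a x \<equiv>
     (\<Sum>j. ennreal (lam j) * atom_majorant (CARD('n) + Suc L) (c j) (l j) (modulus (a j)) x)"

lemma atomic_series_le_majorant:
  fixes a :: "nat \<Rightarrow> real ^ 'n \<Rightarrow> complex"
  assumes a: "\<And>j. cancelling L (c j) (l j) (a j)" and lam: "\<And>j. 0 \<le> lam j"
    and g: "test_kernel L x s A g"
  shows "(\<Sum>j. ennreal (cmod (of_real (lam j) * distribution_of (a j) g))) \<le>
    ennreal (2 ^ (CARD('n) + Suc L + 1) * real CARD('n) ^ (2 * Suc L) * A) *
      majorant_series L lam c l a x"
    (is "_ \<le> ?K * _")
proof -
  have "ennreal (cmod (of_real (lam j) * distribution_of (a j) g)) \<le>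
      ?K * (ennreal (lam j) * atom_majorant (CARD('n) + Suc L) (c j) (l j) (modulus (a j)) x)" for j
  proof -
    have "ennreal (cmod (of_real (lam j) * distribution_of (a j) g)) =
        ennreal (lam j) * ennreal (cmod (distribution_of (a j) g))"
      using lam[of j] by (simp add: norm_mult ennreal_mult)
    also have "\<dots> \<le> ennreal (lam j) * (?K * atom_majorant (CARD('n) + Suc L) (c j) (l j) (modulus (a j)) x)"
      unfolding distribution_of_def by (intro mult_left_mono pairing_le_atom_majorant[OF a g]) simp
    finally show ?thesis by (simp only: mult.left_commute)
  qed
  then have "(\<Sum>j. ennreal (cmod (of_real (lam j) * distribution_of (a j) g))) \<le>
      (\<Sum>j. ?K * (ennreal (lam j) * atom_majorant (CARD('n) + Suc L) (c j) (l j) (modulus (a j)) x))"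
    by (intro suminf_le) auto
  then show ?thesis by simp
qed

lemma distribution_of_linear:
  fixes a :: "real ^ 'n \<Rightarrow> complex"
  assumes a: "\<forall>h. continuous_on UNIV h \<longrightarrow> integrable lebesgue (\<lambda>y. a y * h y)"
    and f: "continuous_on UNIV f" and g: "continuous_on UNIV g"
  shows "distribution_of a (\<lambda>x. f x + g x) = distribution_of a f + distribution_of a g"
    "distribution_of a (\<lambda>x. f x - g x) = distribution_of a f - distribution_of a g"
    "distribution_of a (\<lambda>x. k * f x) = k * distribution_of a f"
  using a[rule_format, OF f] a[rule_format, OF g]
  by (simp_all add: distribution_of_def distrib_left right_diff_distrib mult.left_commute[of _ k])

abbreviation partial_sum :: "(nat \<Rightarrow> real) \<Rightarrow> (nat \<Rightarrow> 'a \<Rightarrow> complex) \<Rightarrow> nat \<Rightarrow> 'a \<Rightarrow> complex" where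
  "partial_sum lam a N \<equiv> (\<lambda>x. \<Sum>j<N. of_real (lam j) * a j x)"

lemma distribution_of_partial_sum:
  fixes a :: "nat \<Rightarrow> real ^ 'n \<Rightarrow> complex"
  assumes a: "\<And>j. cancelling L (c j) (l j) (a j)" and h: "continuous_on UNIV h"
  shows "integrable lebesgue (\<lambda>y. (\<Sum>j<N. of_real (lam j) * a j y) * h y)"
    "distribution_of (partial_sum lam a N) h =
      (\<Sum>j<N. of_real (lam j) * distribution_of (a j) h)" using cancelling_integrable(1)[OF a h]
  by (simp_all add: distribution_of_def sum_distrib_right mult.assoc)

text \<open>Finiteness of the sum of the majorants at one single point suffices: every Schwartz function is
  an admissible kernel around that point, so the pairings are absolutely summable with a bound by
  finitely many seminorms, uniformly over partial sums.\<close>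

theorem atomic_series_converges:
  fixes a :: "nat \<Rightarrow> real ^ 'n \<Rightarrow> complex"
  assumes a: "\<And>j. cancelling L (c j) (l j) (a j)" and lam: "\<And>j. 0 \<le> lam j"
    and fin: "majorant_series L lam c l a x0 < top"
  shows "tempered_tendsto (\<lambda>N. distribution_of (partial_sum lam a N))
    (atomic_functional lam a)"
proof -
  obtain h where h: "0 \<le> h"
    "majorant_series L lam c l a x0 = ennreal h"
    using fin by (cases "majorant_series L lam c l a x0") auto
  define K where "K = (2::real) ^ (CARD('n) + Suc L + 1) * real CARD('n) ^ (2 * Suc L)"
  obtain S and C :: real where S: "finite S" and C: "0 < C" and
    kernel: "\<And>g. g \<in> schwartz \<Longrightarrow> test_kernel L x0 1 (C * seminorm_sum S g) g"
    using test_kernel_schwartz[of L x0] by blast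
  define u where "u g j = of_real (lam j) * distribution_of (a j) g" for g j
  define R where "R g = K * C * h * seminorm_sum S g" for g
  have R0: "0 \<le> R g" if "g \<in> schwartz" for g
    unfolding R_def K_def using C h schwartz_seminorm_nonneg[OF that]
    by (intro mult_nonneg_nonneg sum_nonneg) auto
  have series: "(\<Sum>j. ennreal (cmod (u g j))) \<le> ennreal (R g)" if g: "g \<in> schwartz" for g
  proof -
    have nn: "0 \<le> K * (C * seminorm_sum S g)"
      unfolding K_def using C schwartz_seminorm_nonneg[OF g]
      by (intro mult_nonneg_nonneg sum_nonneg) auto
    have "(\<Sum>j. ennreal (cmod (u g j))) \<le>
        ennreal (K * (C * seminorm_sum S g)) * ennreal h"
      using atomic_series_le_majorant[of L c l a lam, OF a lam kernel[OF g]]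
      by (simp only: u_def h K_def mult.assoc)
    also have "\<dots> = ennreal (R g)"
      using nn h by (subst ennreal_mult[symmetric]) (auto simp: R_def mult_ac)
    finally show ?thesis .
  qed
  have summ: "summable (\<lambda>j. cmod (u g j))" if g: "g \<in> schwartz" for g
  proof (rule summable_suminf_not_top)
    show "(\<Sum>j. ennreal (cmod (u g j))) \<noteq> top" using series[OF g] by (auto simp: top_unique)
  qed simp
  have f_eq: "atomic_functional lam a g = (\<Sum>j. u g j)" if "g \<in> schwartz" for g
    using summ[OF that] by (simp add: atomic_functional_def u_def)
  note cont = schwartz_continuous
  have "\<forall>h. continuous_on UNIV h \<longrightarrow> integrable lebesgue (\<lambda>y. a j y * h y)" for j
    using cancelling_integrable(1)[OF a] by blast
  note lin = distribution_of_linear[OF this]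
  have bound: "cmod (atomic_functional lam a g) \<le> R g" if g: "g \<in> schwartz" for g
  proof -
    have "ennreal (cmod (atomic_functional lam a g)) \<le> ennreal (R g)"
      using modulus_atomic_functional_le[of lam a g] series[OF g] by (simp add: u_def)
    then show ?thesis using R0[OF g] by (subst (asm) ennreal_le_iff) auto
  qed
  have summ': "summable (u g)" if "g \<in> schwartz" for g
    using summ[OF that] by (rule summable_norm_cancel)
  have eqI: "atomic_functional lam a g = k" if "u g sums k" "summable (\<lambda>j. cmod (u g j))" for g k
    using that(2) sums_unique[OF that(1)] unfolding u_def by (simp add: atomic_functional_def)
  have K0: "0 \<le> K * C * h" unfolding K_def using C h by simp
  have limit: "atomic_functional lam a \<in> tempered"
  proof (rule tempered_of_seminorm_bound[OF _ _ _ S K0])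
    fix f g :: "real ^ 'n \<Rightarrow> complex" assume f: "f \<in> schwartz" and g: "g \<in> schwartz"
    have u_add: "u (\<lambda>x. f x + g x) = (\<lambda>j. u f j + u g j)"
      by (rule ext) (simp add: u_def lin(1)[OF cont[OF f] cont[OF g]] distrib_left)
    show "atomic_functional lam a (\<lambda>x. f x + g x) = atomic_functional lam a f + atomic_functional lam a g"
    proof (rule eqI)
      show "u (\<lambda>x. f x + g x) sums (atomic_functional lam a f + atomic_functional lam a g)"
        unfolding u_add f_eq[OF f] f_eq[OF g] by (intro sums_add summable_sums summ' f g)
      show "summable (\<lambda>j. cmod (u (\<lambda>x. f x + g x) j))"
        unfolding u_add
        by (rule summable_comparison_test'[OF summable_add[OF summ[OF f] summ[OF g]]])
          (simp add: norm_triangle_ineq)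
    qed
    have u_diff: "u (\<lambda>x. f x - g x) = (\<lambda>j. u f j - u g j)"
      by (rule ext) (simp add: u_def lin(2)[OF cont[OF f] cont[OF g]] right_diff_distrib)
    show "atomic_functional lam a (\<lambda>x. f x - g x) = atomic_functional lam a f - atomic_functional lam a g"
    proof (rule eqI)
      show "u (\<lambda>x. f x - g x) sums (atomic_functional lam a f - atomic_functional lam a g)"
        unfolding u_diff f_eq[OF f] f_eq[OF g] by (intro sums_diff summable_sums summ' f g)
      show "summable (\<lambda>j. cmod (u (\<lambda>x. f x - g x) j))" by (rule summ[OF schwartz_diff[OF f g]])
    qed
  next
    fix k and f :: "real ^ 'n \<Rightarrow> complex" assume f: "f \<in> schwartz"
    have u_cmult: "u (\<lambda>x. k * f x) = (\<lambda>j. k * u f j)"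
      by (rule ext) (simp add: u_def lin(3)[OF cont[OF f] cont[OF f]] mult.left_commute)
    show "atomic_functional lam a (\<lambda>x. k * f x) = k * atomic_functional lam a f"
    proof (rule eqI)
      show "u (\<lambda>x. k * f x) sums (k * atomic_functional lam a f)"
        unfolding u_cmult f_eq[OF f] by (intro sums_mult summable_sums summ' f)
      show "summable (\<lambda>j. cmod (u (\<lambda>x. k * f x) j))"
        unfolding u_cmult norm_mult by (intro summable_mult summ f)
    qed
  next
    show "cmod (atomic_functional lam a g) \<le> K * C * h * seminorm_sum S g"
      if "g \<in> schwartz" for g using bound[OF that] by (simp add: R_def)
  qed
  have partial: "distribution_of (partial_sum lam a N) \<in> tempered" for N
  proof (rule tempered_of_seminorm_bound[OF _ _ _ S K0])
    have int: "\<forall>h. continuous_on UNIV h \<longrightarrow>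
        integrable lebesgue (\<lambda>y. (\<Sum>j<N. of_real (lam j) * a j y) * h y)"
      by (intro allI impI distribution_of_partial_sum(1)[of L c l a, OF a])
    fix f g :: "real ^ 'n \<Rightarrow> complex" assume f: "f \<in> schwartz" and g: "g \<in> schwartz"
    note linN = distribution_of_linear[OF int cont[OF f] cont[OF g]]
    show "distribution_of (partial_sum lam a N) (\<lambda>x. f x + g x) =
        distribution_of (partial_sum lam a N) f +
        distribution_of (partial_sum lam a N) g"
      "distribution_of (partial_sum lam a N) (\<lambda>x. f x - g x) =
        distribution_of (partial_sum lam a N) f -
        distribution_of (partial_sum lam a N) g" by (rule linN(1), rule linN(2))
    show "distribution_of (partial_sum lam a N) (\<lambda>x. k * f x) =
        k * distribution_of (partial_sum lam a N) f" for k by (rule linN(3))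
  next
    fix g :: "real ^ 'n \<Rightarrow> complex" assume g: "g \<in> schwartz"
    have "ennreal (\<Sum>j<N. cmod (u g j)) = (\<Sum>j<N. ennreal (cmod (u g j)))" by (simp add: sum_ennreal)
    also have "\<dots> \<le> (\<Sum>j. ennreal (cmod (u g j)))" by (intro sum_le_suminf) auto
    also have "\<dots> \<le> ennreal (R g)" by (rule series[OF g])
    finally have "(\<Sum>j<N. cmod (u g j)) \<le> R g" using R0[OF g] by (subst (asm) ennreal_le_iff) auto
    then have "cmod (\<Sum>j<N. u g j) \<le> R g" by (rule order_trans[OF norm_sum])
    then show "cmod (distribution_of (partial_sum lam a N) g)
        \<le> K * C * h * seminorm_sum S g"
      by (simp add: distribution_of_partial_sum(2)[OF a cont[OF g]] u_def R_def)
  qed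
  have "(\<lambda>N. distribution_of (partial_sum lam a N) g) \<longlonglongrightarrow> atomic_functional lam a g"
    if g: "g \<in> schwartz" for g
    unfolding distribution_of_partial_sum(2)[of L c l a, OF a cont[OF g]] f_eq[OF g]
    using summable_LIMSEQ[OF summ'[OF g]] by (simp only: u_def)
  with limit partial show ?thesis by (simp add: tempered_tendsto_def)
qed

section \<open>Atomic series in generalized Hardy-Morrey spaces\<close>

lemma ennpowr_atomic_sum:
  assumes "0 < p" "\<And>j. 0 \<le> lam j"
  shows "ennpowr (atomic_sum p lam Q x) p = (\<Sum>j. ennreal (lam j powr p) * indicator (Q j) x)"
proof -
  have "ennreal ((lam j * indicator (Q j) x) powr p) = ennreal (lam j powr p) * indicator (Q j) x" for j
    by (simp add: indicator_def)
  then show ?thesis using assms by (simp add: atomic_sum_def ennpowr_ennpowr)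
qed

theorem theorem1p3:
  fixes p d :: real and q :: ennreal and \<phi> \<eta> :: "real ^ 'n \<Rightarrow> real \<Rightarrow> real"
  assumes p: "0 < p" "p \<le> 1"
    and d: "d \<ge> real CARD('n) / p - real CARD('n)"
    and q: "1 \<le> q" "ennreal p < q"
    and phi: "\<phi> \<in> growth_class 1" "cube_monotone 1 \<phi>"
    and eta: "\<eta> \<in> growth_class 1" "cube_monotone 1 \<eta>"
    and int: "\<exists>C0>0. \<forall>x r. 0 < r \<longrightarrow>
      (\<integral>\<^sup>+ s\<in>{r<..}. ennreal (\<phi> x s / (\<eta> x s * s)) \<partial>lborel) \<le> ennreal (C0 * (\<phi> x r / \<eta> x r))"
  shows "\<exists>C>0. \<forall>(Q :: nat \<Rightarrow> (real ^ 'n) set) (a :: nat \<Rightarrow> real ^ 'n \<Rightarrow> complex) (lam :: nat \<Rightarrow> real).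
      (\<forall>j. Q j \<in> cubes) \<and>
      (\<forall>j. a j \<in> morrey_space q \<eta>) \<and>
      (\<forall>j. 0 \<le> lam j) \<and>
      morrey_norm (ennreal p) \<phi> (atomic_sum p lam Q) < \<infinity> \<and>
      (\<forall>j. morrey_norm q \<eta> (modulus (a j)) \<le> ennreal (1 / at_cube \<eta> (Q j))) \<and>
      (\<forall>j. supp (a j) \<subseteq> Q j) \<and>
      (\<forall>j \<alpha>. real (\<Sum>i\<in>UNIV. \<alpha> i) \<le> d \<longrightarrow>
         (LINT x:Q j|lebesgue. monomial \<alpha> x *\<^sub>R a j x) = 0)
      \<longrightarrow> (\<exists>f. tempered_tendsto
                 (\<lambda>N. distribution_of (\<lambda>x. \<Sum>j<N. complex_of_real (lam j) * a j x)) f \<and>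
               f \<in> hardy_morrey_space p \<phi> \<and>
               hardy_morrey_norm p \<phi> f
                 \<le> ennreal C * morrey_norm (ennreal p) \<phi> (atomic_sum p lam Q))"
proof -
  let ?n = "CARD('n)"
  define L where "L = nat \<lfloor>d\<rfloor>"
  define N where "N = ?n + Suc L"
  have "real ?n \<le> real ?n / p" using p by (simp add: le_divide_eq)
  then have d0: "0 \<le> d" using d by linarith
  then have L: "real L \<le> d" "d < real (Suc L)" unfolding L_def by linarith+
  have N: "real ?n < p * real N"
  proof -
    have "real ?n / p < real N" using L(2) d by (simp add: N_def)
    then show ?thesis using p by (simp add: divide_less_eq mult.commute)
  qed
  obtain q' where q': "1 \<le> q'" "p < q'" and to_atom: "\<And>c l F. F \<in> borel_measurable lebesgue \<Longrightarrow> 0 < l \<Longrightarrow>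
      morrey_norm q \<eta> F \<le> ennreal (1 / \<eta> c l) \<Longrightarrow> morrey_atom q' \<eta> c l F"
    using morrey_atom_of_morrey_norm[OF p q eta(1)] by blast
  obtain C1 where C1: "0 < C1" and sum_le: "\<forall>c l F lam b. (\<forall>j::nat. morrey_atom q' \<eta> (c j) (l j) (F j)) \<longrightarrow> 0 \<le> b \<longrightarrow>
    (\<forall>z L. 0 < L \<longrightarrow> (\<integral>\<^sup>+ x\<in>cube z L. weighted_cubes p lam c l x \<partial>lebesgue)
        \<le> ennreal ((b * \<phi> z L) powr p * L ^ ?n)) \<longrightarrow>
    (\<forall>z m. 0 < m \<longrightarrow> (\<integral>\<^sup>+ x\<in>cube z m. weighted_majorants N p lam c l F x \<partial>lebesgue)
        \<le> ennreal (C1 * (b * \<phi> z m) powr p * m ^ ?n))"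
    using nn_integral_sum_atom_majorants[OF p q' N phi(1) eta int] by (elim exE conjE) (rule that)
  obtain A where A: "0 < A" and heat_kernel: "\<And>t x. 0 < t \<Longrightarrow>
      test_kernel L x (sqrt t) A (\<lambda>y :: real ^ 'n. complex_of_real (heat_kernel t x y))"
    using test_kernel_heat_kernel[of L, where 'n = 'n] by blast
  define K where "K = (2::real) ^ (?n + Suc L + 1) * real ?n ^ (2 * Suc L) * A"
  have K: "0 < K" unfolding K_def using A by simp
  define C where "C = K * C1 powr (1 / p)"
  have C: "0 < C" unfolding C_def using K C1 by simp
  have main: "\<exists>f. tempered_tendsto (\<lambda>N. distribution_of (partial_sum lam a N)) f \<and>
      f \<in> hardy_morrey_space p \<phi> \<and>
      hardy_morrey_norm p \<phi> f \<le> ennreal C * morrey_norm (ennreal p) \<phi> (atomic_sum p lam Q)"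
    if Q: "\<And>j. Q j \<in> cubes" and aM: "\<And>j. a j \<in> morrey_space q \<eta>" and lam: "\<And>j. 0 \<le> lam j"
      and finite: "morrey_norm (ennreal p) \<phi> (atomic_sum p lam Q) < \<infinity>"
      and norm_a: "\<And>j. morrey_norm q \<eta> (modulus (a j)) \<le> ennreal (1 / at_cube \<eta> (Q j))"
      and supp_a: "\<And>j. supp (a j) \<subseteq> Q j"
      and moments: "\<And>j \<alpha>. real (\<Sum>i\<in>UNIV. \<alpha> i) \<le> d \<Longrightarrow> (LINT x:Q j|lebesgue. monomial \<alpha> x *\<^sub>R a j x) = 0"
    for Q and a :: "nat \<Rightarrow> real ^ 'n \<Rightarrow> complex" and lam :: "nat \<Rightarrow> real"
  proof -
    have "\<forall>j. \<exists>c l. 0 < l \<and> Q j = cube c l" using Q unfolding cubes_def by blast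
    then obtain c l where l: "\<And>j. 0 < l j" and Q_eq: "\<And>j. Q j = cube (c j) (l j)" by metis
    obtain b where b: "0 \<le> b" "morrey_norm (ennreal p) \<phi> (atomic_sum p lam Q) = ennreal b"
      using finite by (cases "morrey_norm (ennreal p) \<phi> (atomic_sum p lam Q)") auto
    have a_meas [measurable]: "a j \<in> borel_measurable lebesgue" for j
      using aM by (simp add: morrey_space_def)
    have atom: "morrey_atom q' \<eta> (c j) (l j) (modulus (a j))" for j
    proof (rule to_atom)
      show "modulus (a j) \<in> borel_measurable lebesgue" unfolding modulus_def[abs_def] by measurable
      show "morrey_norm q \<eta> (modulus (a j)) \<le> ennreal (1 / \<eta> (c j) (l j))"
        using norm_a[of j] l[of j] by (simp add: Q_eq at_cube_def cube_center_cube cube_side_cube)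
    qed (rule l)
    have canc: "cancelling L (c j) (l j) (a j)" for j
    proof (rule cancelling_of_atom[OF eta(1) q'(1) a_meas atom])
      show "supp (a j) \<subseteq> cube (c j) (l j)" using supp_a[of j] by (simp add: Q_eq)
      show "(LINT x:cube (c j) (l j)|lebesgue. monomial \<alpha> x *\<^sub>R a j x) = 0" if "(\<Sum>i\<in>UNIV. \<alpha> i) \<le> L" for \<alpha>
      proof -
        have "real (\<Sum>i\<in>UNIV. \<alpha> i) \<le> real L" using that by (rule of_nat_mono)
        then have "real (\<Sum>i\<in>UNIV. \<alpha> i) \<le> d" using L(1) by (rule order_trans)
        then show ?thesis using moments[of \<alpha> j] by (simp only: Q_eq)
      qed
    qed
    have packing: "(\<integral>\<^sup>+ x\<in>cube z m. weighted_cubes p lam c l x \<partial>lebesgue)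
        \<le> ennreal ((b * \<phi> z m) powr p * m ^ ?n)" if m: "0 < m" for z m
    proof -
      have "morrey_norm (ennreal p) \<phi> (atomic_sum p lam Q) \<le> ennreal b" by (simp add: b)
      moreover have "morrey_norm (ennreal p) \<phi> (atomic_sum p lam Q) \<le> ennreal b \<longleftrightarrow>
          (\<forall>z L. 0 < L \<longrightarrow> power_integral (atomic_sum p lam Q) p (cube z L)
            \<le> ennreal ((b * \<phi> z L) powr p * L ^ ?n))"
        by (rule morrey_norm_le_iff[OF p(1) b(1)]) (rule growth_class_pos[OF phi(1)])
      ultimately have "power_integral (atomic_sum p lam Q) p (cube z m) \<le> ennreal ((b * \<phi> z m) powr p * m ^ ?n)"
        using m by (simp only:)
      then show ?thesis by (simp only: ennpowr_atomic_sum[OF p(1) lam] Q_eq)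
    qed
    define H where "H j x = atom_majorant N (c j) (l j) (modulus (a j)) x" for j x
    define W where "W x = (\<Sum>j. ennreal (lam j powr p) * ennpowr (H j x) p)" for x
    have W_le: "(\<integral>\<^sup>+ x\<in>cube z m. W x \<partial>lebesgue) \<le> ennreal (C1 * (b * \<phi> z m) powr p * m ^ ?n)" if "0 < m" for z m
      unfolding W_def H_def  by (rule sum_le[rule_format, OF atom b(1) packing that])
    have H_sum: "(\<Sum>j. ennreal (lam j) * H j x) \<le> ennpowr (W x) (1 / p)" for x
    proof -
      have "ennpowr (ennreal (lam j) * H j x) p = ennreal (lam j powr p) * ennpowr (H j x) p" for j
        using lam[of j] by (simp add: ennpowr_mult ennpowr_ennreal)
      then show ?thesis
        unfolding W_def using suminf_le_ennpowr_suminf[OF p, of "\<lambda>j. ennreal (lam j) * H j x"] by simp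
    qed
    \<comment> \<open>The integral of \<open>W\<close> over the unit cube is finite, so \<open>W\<close> is finite somewhere.\<close>
    have "\<exists>x. W x \<noteq> top"
    proof (rule ccontr)
      assume "\<nexists>x. W x \<noteq> top"
      then have "(\<integral>\<^sup>+ x\<in>cube 0 1. W x \<partial>lebesgue) = (\<integral>\<^sup>+ x. top * indicator (cube 0 1) (x :: real ^ 'n) \<partial>lebesgue)"
        by (intro nn_integral_cong) auto
      also have "\<dots> = top" by (simp add: nn_integral_cmult_indicator emeasure_cube)
      finally show False using W_le[of 1 0] by (simp add: top_unique)
    qed
    then obtain x0 where "W x0 \<noteq> top" by blast
    then have "ennpowr (W x0) (1 / p) < top" unfolding less_top[symmetric] by simp
    then have "majorant_series L lam c l a x0 < top"
      using H_sum[of x0] unfolding H_def N_def by (rule le_less_trans[rotated])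
    then have conv: "tempered_tendsto (\<lambda>N. distribution_of (partial_sum lam a N))
        (atomic_functional lam a)" by (intro atomic_series_converges[OF canc lam])
    have heat_le: "modulus (heat t (atomic_functional lam a)) x \<le> ennreal K * ennpowr (W x) (1 / p)" if t: "0 < t" for t x
    proof -
      have "modulus (heat t (atomic_functional lam a)) x =
          ennreal (cmod (atomic_functional lam a (\<lambda>y. complex_of_real (heat_kernel t x y))))"
        by (simp only: modulus_def heat_def)
      also have "\<dots> \<le> (\<Sum>j. ennreal (cmod (complex_of_real (lam j) *
          distribution_of (a j) (\<lambda>y. complex_of_real (heat_kernel t x y)))))"
        by (rule modulus_atomic_functional_le)
      also have "\<dots> \<le> ennreal K * (\<Sum>j. ennreal (lam j) * H j x)"
        unfolding K_def H_def N_def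
        by (rule atomic_series_le_majorant[of L c l a lam, OF canc lam heat_kernel[OF t]])
      also have "\<dots> \<le> ennreal K * ennpowr (W x) (1 / p)" by (intro mult_left_mono H_sum) simp
      finally show ?thesis .
    qed
    have norm_le: "hardy_morrey_norm p \<phi> (atomic_functional lam a) \<le> ennreal (C * b)"
      unfolding hardy_morrey_norm_def
    proof (rule morrey_norm_le_iff[THEN iffD2, OF p(1)], goal_cases)
      case 1
      show ?case using C b by simp
    next
      case (2 z r)
      then show ?case by (rule growth_class_pos[OF phi(1)])
    next
      case 3
      show ?case
      proof (intro allI impI)
      fix z :: "real ^ 'n" and m :: real assume m: "0 < m"
      have "ennpowr (SUP t\<in>{0<..}. modulus (heat t (atomic_functional lam a)) x) p \<le> ennreal (K powr p) * W x" for x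
      proof -
        have "(SUP t\<in>{0<..}. modulus (heat t (atomic_functional lam a)) x) \<le> ennreal K * ennpowr (W x) (1 / p)"
          using heat_le by (intro SUP_least) auto
        then have "ennpowr (SUP t\<in>{0<..}. modulus (heat t (atomic_functional lam a)) x) p \<le>
            ennpowr (ennreal K * ennpowr (W x) (1 / p)) p" using p by (intro ennpowr_mono) auto
        also have "\<dots> = ennreal (K powr p) * W x"
          using p K by (simp add: ennpowr_mult ennpowr_ennreal ennpowr_ennpowr)
        finally show ?thesis .
      qed
      then have "(\<integral>\<^sup>+ x\<in>cube z m. ennpowr (SUP t\<in>{0<..}. modulus (heat t (atomic_functional lam a)) x) p \<partial>lebesgue)
          \<le> (\<integral>\<^sup>+ x. ennreal (K powr p) * (W x * indicator (cube z m) x) \<partial>lebesgue)"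
        by (intro nn_integral_mono) (auto simp: indicator_def)
      also have "\<dots> = ennreal (K powr p) * (\<integral>\<^sup>+ x\<in>cube z m. W x \<partial>lebesgue)"
        unfolding W_def[abs_def] H_def[abs_def] by (rule nn_integral_cmult) measurable
      also have "\<dots> \<le> ennreal (K powr p) * ennreal (C1 * (b * \<phi> z m) powr p * m ^ ?n)"
        by (intro mult_left_mono W_le m) simp
      also have "\<dots> = ennreal ((C * b * \<phi> z m) powr p * m ^ ?n)"
      proof -
        have "(C * b * \<phi> z m) powr p = K powr p * (C1 * (b * \<phi> z m) powr p)"
          using p C1 by (simp add: C_def powr_mult powr_powr mult.assoc)
        then show ?thesis using C1 m by (subst ennreal_mult[symmetric]) (auto simp: mult.assoc)
      qed
      finally show "(\<integral>\<^sup>+ x\<in>cube z m. ennpowr (SUP t\<in>{0<..}. modulus (heat t (atomic_functional lam a)) x) p \<partial>lebesgue)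
          \<le> ennreal ((C * b * \<phi> z m) powr p * m ^ ?n)" .
      qed
    qed
    have mem: "atomic_functional lam a \<in> hardy_morrey_space p \<phi>"
      using conv le_less_trans[OF norm_le, of top] by (simp add: hardy_morrey_space_def tempered_tendsto_def)
    have "hardy_morrey_norm p \<phi> (atomic_functional lam a) \<le>
        ennreal C * morrey_norm (ennreal p) \<phi> (atomic_sum p lam Q)"
      using norm_le C b by (simp add: ennreal_mult)
    with conv mem show ?thesis by blast
  qed
  show ?thesis
    by (rule exI[of _ C], rule conjI, rule C, intro allI impI, elim conjE) (rule main; blast)
qed

end
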